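(* Let $t, r, a, b$ be integers with $t\geq r\geq 3$, $a\geq 2(r-1)$ and $b\geq (a-1)!+1$. Then, for $n$ large enough, $$\mathrm{ex}(n,K_r,(t+1)K_{a,b})\leq \sum_{s=0}^{r}\binom{t}{r-s}\left(\frac{1}{s!}+o(1)\right)(b-1)^{\frac{s(s-1)}{2a}}(n-t)^{s-\frac{s(s-1)}{2a}},$$ and $$\mathrm{ex}(n,K_r,(t+1)K_{a,b})\geq \sum_{s=0}^{r}\binom{t}{r-s}\left(\frac{1}{s!}+o(1)\right)(n-t)^{s-\frac{s(s-1)}{2a}},$$ where the $o(1)$ terms tend to $0$ as $n\to\infty$ (with $t,r,a,b$ fixed).
   Context: For graphs $T$ and $F$, the generalized Turán number $\mathrm{ex}(n,T,F)$ is the maximum number of (not necessarily induced) copies of $T$ in an $n$-vertex graph containing no copy of $F$ as a subgraph. $K_r$ is the complete graph on $r$ vertices and $K_{a,b}$ is the complete bipartite graph with parts of sizes $a$ and $b$. For a graph $F$ and integer $t\geq 1$, $tF$ denotes the vertex-disjoint union of $t$ copies of $F$. *)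

theory Defs
  imports Complex_Main "HOL-Library.Ramsey"
begin

type_synonym 'a graph = "'a set \<times> 'a set set"

abbreviation verts :: "'a graph \<Rightarrow> 'a set" where "verts G \<equiv> fst G"
abbreviation edges :: "'a graph \<Rightarrow> 'a set set" where "edges G \<equiv> snd G"

definition simple_graph :: "'a graph \<Rightarrow> bool" where
  "simple_graph G \<longleftrightarrow> finite (verts G) \<and> edges G \<subseteq> [verts G]\<^bsup>2\<^esup>"

definition subgraph :: "'a graph \<Rightarrow> 'a graph \<Rightarrow> bool" where
  "subgraph H G \<longleftrightarrow> simple_graph H \<and> verts H \<subseteq> verts G \<and> edges H \<subseteq> edges G"

definition graph_iso :: "'a graph \<Rightarrow> 'b graph \<Rightarrow> bool" where
  "graph_iso G H \<longleftrightarrow>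
     (\<exists>f. bij_betw f (verts G) (verts H) \<and> edges H = (\<lambda>e. f ` e) ` edges G)"

(* A copy is a not necessarily induced subgraph, so embeddings differing by an
   automorphism of T are counted once. *)
definition copies :: "'b graph \<Rightarrow> 'a graph \<Rightarrow> 'a graph set" where
  "copies T G = {H. subgraph H G \<and> graph_iso T H}"

definition complete_graph :: "nat \<Rightarrow> nat graph" where
  "complete_graph r = ({..<r}, [{..<r}]\<^bsup>2\<^esup>)"

definition complete_bipartite :: "nat \<Rightarrow> nat \<Rightarrow> (nat + nat) graph" where
  "complete_bipartite a b = ({..<a} <+> {..<b}, {{Inl i, Inr j} | i j. i < a \<and> j < b})"

definition disjoint_copies :: "nat \<Rightarrow> 'a graph \<Rightarrow> (nat \<times> 'a) graph" where
  "disjoint_copies t F = ({..<t} \<times> verts F, {Pair i ` e | i e. i < t \<and> e \<in> edges F})"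

(* Every n-vertex graph is isomorphic to one with vertices in nat.  The maximum is over a
   finite set (see below); it is unspecified if no n-vertex graph is F-free. *)
definition gen_turan :: "nat \<Rightarrow> 'a graph \<Rightarrow> 'b graph \<Rightarrow> nat" where
  "gen_turan n T F =
     Max {card (copies T G) | G :: nat graph.
            simple_graph G \<and> card (verts G) = n \<and> copies F G = {}}"

lemma copies_subset:
  assumes "simple_graph G"
  shows "copies T G \<subseteq> Pow (verts G) \<times> Pow (Pow (verts G))"
proof
  fix H assume "H \<in> copies T G"
  then have "verts H \<subseteq> verts G" "edges H \<subseteq> [verts G]\<^bsup>2\<^esup>"
    using assms unfolding copies_def subgraph_def simple_graph_def by blast+
  then have "fst H \<in> Pow (verts G)" "snd H \<in> Pow (Pow (verts G))"
    unfolding nsets_def by blast+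
  then show "H \<in> Pow (verts G) \<times> Pow (Pow (verts G))"
    by (simp add: mem_Times_iff)
qed

lemma finite_copies: "simple_graph G \<Longrightarrow> finite (copies T G)"
  by (rule finite_subset[OF copies_subset]) (auto simp: simple_graph_def)

lemma finite_gen_turan_set:
  "finite {card (copies T G) | G :: nat graph.
             simple_graph G \<and> card (verts G) = n \<and> copies F G = {}}"
proof (rule finite_subset)
  show "{card (copies T G) | G :: nat graph.
           simple_graph G \<and> card (verts G) = n \<and> copies F G = {}} \<subseteq> {..2 ^ n * 2 ^ 2 ^ n}"
  proof clarify
    fix V :: "nat set" and E
    assume G: "simple_graph (V, E)" and n: "n = card (verts (V, E))"
    then have fin: "finite V" by (simp add: simple_graph_def)
    then have "card (copies T (V, E)) \<le> card (Pow V \<times> Pow (Pow V))"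
      using copies_subset[OF G, of T] by (intro card_mono) auto
    also have "\<dots> = 2 ^ card V * 2 ^ 2 ^ card V"
      using fin by (simp add: card_cartesian_product card_Pow)
    finally show "card (copies T (V, E)) \<le> 2 ^ card (verts (V, E)) * 2 ^ 2 ^ card (verts (V, E))"
      by simp
  qed
qed simp

end

theory Submission
  imports Defs "HOL-Complex_Analysis.Complex_Analysis" "HOL-Number_Theory.Number_Theory"
    "HOL-Real_Asymp.Real_Asymp" "HOL-Library.Function_Algebras" "Jordan_Normal_Form.Char_Poly"
begin

text \<open>
  As \<open>n\<close> grows, the summand \<open>s = r\<close> dominates all others, so it suffices to bound the Turan number by the
  claimed constant times \<open>n\<close> to the power \<open>r - r (r - 1) / (2 a)\<close>.

  Upper bound: deleting a maximal packing of bicliques \<open>K\<^bsub>a,b\<^esub>\<close> removes boundedly many vertices and leaves a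
  \<open>K\<^bsub>a,b\<^esub>\<close>-free graph. There the neighbourhood of a vertex is \<open>K\<^bsub>a-1,b\<^esub>\<close>-free, so an induction on \<open>r\<close>
  bounds the cliques through a vertex by a power of its degree, and the power sums of the degrees are
  controlled by the double count of Kovari, Sos and Turan.

  Lower bound: for a prime power \<open>q\<close> and \<open>k = a - 1\<close> the projective norm graph has \<open>q\<^sup>k (q - 1)\<close> vertices and
  contains no \<open>K\<^bsub>a,b\<^esub>\<close> as soon as \<open>b > k!\<close>. This amounts to a system of \<open>k\<close> equations, each prescribing a
  product of \<open>k\<close> linear forms, having at most \<open>k!\<close> solutions; the functions on the solution set are shown
  to be spanned by \<open>k! = \<Sum>\<^sub>D eulerian k D\<close> elements, counted degree by degree. Almost exact degrees and
  codegrees give, by a second moment argument, the expected number of cliques. Prime powers \<open>q\<close> with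
  \<open>q\<^sup>a\<close> just below \<open>n\<close> exist because \<open>\<zeta>\<close> has no zeros on \<open>Re s = 1\<close>: testing \<open>\<Lambda>(n) - 1\<close> against a Fejer
  kernel centred at \<open>ln n = T\<close> gives a quantity that tends to \<open>0\<close> as \<open>T\<close> grows, by the Riemann-Lebesgue lemma.
\<close>

section \<open>Products of linear forms modulo an ideal\<close>

text \<open>The constant \<open>1 / fact r\<close> leaves no room for a constant factor anywhere.
  For the vertex number this means that \<open>q ^ a\<close> must be asymptotic to \<open>n\<close>;
  primes of Bertrand type are too thin, and prime powers in every interval
  \<open>[exp (- \<delta>) * x, x]\<close> are wanted. As existence is all that is asked, the kernel
  can have a compactly supported transform, and then \<open>\<zeta>\<close> enters through a bounded
  segment of the line only. For the cliques, the second moment controls a set of \<open>s\<close>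
  vertices only if \<open>s ^ 2\<close> exceeds about \<open>q ^ (a + 1)\<close>. It is last used on
  common neighbourhoods of \<open>r - 2\<close> vertices, of size about
  \<open>q ^ (a - r + 2)\<close>; hence \<open>a \<ge> 2 * (r - 1)\<close>. The bound
  \<open>k!\<close> is of Bezout type: the \<open>k\<close> conjugates \<open>x ^ (q ^ j)\<close> of
  the unknown are treated as independent variables. One more row, the constant 1, homogenises the
  system, and the Eulerian numbers bound the Hilbert function of the quotient in the multidegrees
  \<open>(D, ..., D)\<close>. Since the order of the field grows with \<open>n\<close>, the field is
  represented by congruences modulo an ideal of one fixed ring.\<close>

fun eulerian :: "nat \<Rightarrow> nat \<Rightarrow> nat" where
  "eulerian m 0 = 1"
| "eulerian 0 (Suc D) = 0"
| "eulerian (Suc m) (Suc D) = (D + 2) * eulerian m (Suc D) + (m - D) * eulerian m D"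

lemma eulerian_eq_0: "m > 0 \<Longrightarrow> D \<ge> m \<Longrightarrow> eulerian m D = 0"
proof (induction m D rule: eulerian.induct)
  case (3 m D)
  then show ?case by (cases "m = 0") auto
qed auto

text \<open>In the recurrence each \<open>eulerian m D\<close> feeds row \<open>Suc m\<close> twice,
  with weights \<open>D + 1\<close> and \<open>m - D\<close>, together \<open>m + 1\<close>. These
  are the Eulerian numbers, which count permutations by descents.\<close>

lemma sum_eulerian: "m > 0 \<Longrightarrow> (\<Sum>D<m. eulerian m D) = fact m"
proof (induction m)
  case (Suc m)
  show ?case
  proof (cases "m = 0")
    case False
    have "(\<Sum>D<Suc m. eulerian (Suc m) D)
        = 1 + (\<Sum>D<m. (D + 2) * eulerian m (Suc D)) + (\<Sum>D<m. (m - D) * eulerian m D)"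
      by (subst sum.lessThan_Suc_shift) (simp add: sum.distrib)
    also have "1 + (\<Sum>D<m. (D + 2) * eulerian m (Suc D)) = (\<Sum>D<Suc m. (D + 1) * eulerian m D)"
      by (subst sum.lessThan_Suc_shift) simp
    also have "\<dots> = (\<Sum>D<m. (D + 1) * eulerian m D)"
      using False by (simp add: eulerian_eq_0)
    also have "\<dots> + (\<Sum>D<m. (m - D) * eulerian m D) = (\<Sum>D<m. (m + 1) * eulerian m D)"
      unfolding sum.distrib[symmetric]
    proof (rule sum.cong)
      fix D assume "D \<in> {..<m}"
      then have "(D + 1) + (m - D) = m + 1" by simp
      then show "(D + 1) * eulerian m D + (m - D) * eulerian m D = (m + 1) * eulerian m D"
        by (metis distrib_right)
    qed simp
    also have "\<dots> = (m + 1) * fact m"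
      using Suc False by (subst sum_distrib_left[symmetric]) simp
    finally show ?thesis by simp
  qed simp
qed simp

text \<open>Linear algebra in the quotient by the ideal \<open>N\<close>, with coefficients from the
  subring \<open>K\<close>. It is applied to a ring of functions, with \<open>K\<close> the
  constants and \<open>N\<close> the functions that vanish modulo an ideal on a solution
  set.\<close>

locale scalars_mod_ideal =
  fixes K N :: "'a :: comm_ring_1 set"
  assumes one_K: "1 \<in> K" and add_K: "x \<in> K \<Longrightarrow> y \<in> K \<Longrightarrow> x + y \<in> K"
    and mult_K: "x \<in> K \<Longrightarrow> y \<in> K \<Longrightarrow> x * y \<in> K" and uminus_K: "x \<in> K \<Longrightarrow> - x \<in> K"
    and zero_N: "0 \<in> N" and add_N: "x \<in> N \<Longrightarrow> y \<in> N \<Longrightarrow> x + y \<in> N"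
    and mult_N: "x \<in> N \<Longrightarrow> y * x \<in> N"
begin

inductive_set modspan :: "'a set \<Rightarrow> 'a set" for G where
  modspan_null: "x \<in> N \<Longrightarrow> x \<in> modspan G"
| modspan_base: "x \<in> G \<Longrightarrow> x \<in> modspan G"
| modspan_add: "x \<in> modspan G \<Longrightarrow> y \<in> modspan G \<Longrightarrow> x + y \<in> modspan G"
| modspan_scale: "x \<in> modspan G \<Longrightarrow> c \<in> K \<Longrightarrow> c * x \<in> modspan G"

lemma modspan_uminus: "x \<in> modspan G \<Longrightarrow> - x \<in> modspan G"
  using modspan_scale[of x G "-1"] uminus_K[OF one_K] by simp

lemma modspan_diff: "x \<in> modspan G \<Longrightarrow> y \<in> modspan G \<Longrightarrow> x - y \<in> modspan G"
  using modspan_add[of x G "- y"] modspan_uminus by simp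

lemma modspan_sum: "(\<And>i. i \<in> I \<Longrightarrow> f i \<in> modspan G) \<Longrightarrow> sum f I \<in> modspan G"
  by (induction I rule: infinite_finite_induct) (auto intro: modspan_add modspan_null zero_N)

text \<open>The form in which all reductions below are carried out: a product is rewritten by
  treating the generators of one factor only.\<close>

lemma modspan_mult_subset:
  assumes "x \<in> modspan G" and "\<And>g. g \<in> G \<Longrightarrow> h * g \<in> modspan H"
  shows "h * x \<in> modspan H"
  using assms(1)
proof induction
  case (modspan_scale x c)
  then show ?case using modspan.modspan_scale[of "h * x" H c] by (simp add: algebra_simps)
qed (auto simp: distrib_left intro: modspan_null mult_N modspan_add assms(2))

lemma modspan_mono: "x \<in> modspan G \<Longrightarrow> G \<subseteq> modspan H \<Longrightarrow> x \<in> modspan H"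
  using modspan_mult_subset[of x G 1 H] by auto

definition unit :: "'a \<Rightarrow> bool" where
  "unit c \<longleftrightarrow> (\<exists>w\<in>K. w * c - 1 \<in> N)"

definition powers :: "'a \<Rightarrow> nat \<Rightarrow> 'a set" where
  "powers x d = {x ^ e | e. e < d}"

lemma mult_modspan_powers_linear:
  assumes "u \<in> K" "v \<in> K" "y \<in> modspan (powers x d)"
  shows "(u * x + v) * y \<in> modspan (powers x (Suc d))"
proof (rule modspan_mult_subset[OF assms(3)])
  fix g assume "g \<in> powers x d"
  then obtain e where e: "g = x ^ e" "e < d" by (auto simp: powers_def)
  then have "x ^ Suc e \<in> modspan (powers x (Suc d))" "x ^ e \<in> modspan (powers x (Suc d))"
    by (intro modspan_base; auto simp: powers_def intro: exI[of _ "Suc e"] exI[of _ e])+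
  then have "u * x ^ Suc e + v * x ^ e \<in> modspan (powers x (Suc d))"
    using assms by (intro modspan_add modspan_scale)
  then show "(u * x + v) * g \<in> modspan (powers x (Suc d))"
    by (simp add: e algebra_simps)
qed

context
  fixes u v :: "'i \<Rightarrow> 'a" and x :: 'a and R :: "'i set"
  assumes uv: "\<And>i. i \<in> R \<Longrightarrow> u i \<in> K" "\<And>i. i \<in> R \<Longrightarrow> v i \<in> K"
    and indep: "\<And>i j. i \<in> R \<Longrightarrow> j \<in> R \<Longrightarrow> i \<noteq> j \<Longrightarrow> unit (u i * v j - u j * v i)"
begin

abbreviation (input) lin :: "'i \<Rightarrow> 'a" where "lin i \<equiv> u i * x + v i"

text \<open>Cramer's rule: the determinant of the two forms is a unit, so both \<open>1\<close> and
  \<open>x\<close> are combinations of them modulo \<open>N\<close>. Multiplication by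
  \<open>x ^ e\<close> with \<open>e < d\<close> then reaches every degree up to
  \<open>d\<close>.\<close>

lemma powers_two_forms:
  assumes "i \<in> R" "j \<in> R" "i \<noteq> j" "d > 0"
  shows "powers x (Suc d) \<subseteq> modspan ((*) (lin i) ` powers x d \<union> (*) (lin j) ` powers x d)"
    (is "_ \<subseteq> modspan ?G")
proof -
  obtain w where w: "w \<in> K" "w * (u i * v j - u j * v i) - 1 \<in> N"
    using indep[OF assms(1-3)] by (auto simp: unit_def)
  have l: "lin k * x ^ e \<in> modspan ?G" if "e < d" "k = i \<or> k = j" for e k
    using that by (intro modspan_base) (auto simp: powers_def)
  have 1: "x ^ e \<in> modspan ?G" if "e < d" for e
  proof -
    have "(w * u i) * (lin j * x ^ e) - (w * u j) * (lin i * x ^ e)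
        - x ^ e * (w * (u i * v j - u j * v i) - 1) \<in> modspan ?G"
      using that w uv assms
      by (intro modspan_diff modspan_scale mult_K l modspan_null[OF mult_N]) auto
    then show ?thesis by (simp add: algebra_simps)
  qed
  have 2: "x ^ Suc e \<in> modspan ?G" if "e < d" for e
  proof -
    have "(w * v j) * (lin i * x ^ e) - (w * v i) * (lin j * x ^ e)
        - x ^ Suc e * (w * (u i * v j - u j * v i) - 1) \<in> modspan ?G"
      using that w uv assms
      by (intro modspan_diff modspan_scale mult_K l modspan_null[OF mult_N]) auto
    then show ?thesis by (simp add: algebra_simps)
  qed
  show ?thesis
  proof
    fix y assume "y \<in> powers x (Suc d)"
    then obtain e where e: "y = x ^ e" "e < Suc d" by (auto simp: powers_def)
    then show "y \<in> modspan ?G" using 1[of e] 2[of "d - 1"] assms(4)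
      by (cases "e < d") (auto simp: less_Suc_eq)
  qed
qed

text \<open>At the root of \<open>lin i\<close> none of the other forms vanishes, so a single
  product without the factor \<open>lin i\<close> fills the quotient by \<open>lin i\<close>. The
  induction through \<open>powers_two_forms\<close> avoids speaking of the root, which may lie at
  infinity: \<open>u i\<close> is allowed to be 0.\<close>

lemma powers_form_prod:
  assumes "i \<in> R" "finite J" "J \<subseteq> R" "i \<notin> J"
  shows "powers x (Suc (card J)) \<subseteq>
    modspan (insert (\<Prod>j\<in>J. lin j) ((*) (lin i) ` powers x (card J)))"
  using assms(2-)
proof (induction J rule: finite_induct)
  case empty
  then show ?case by (auto simp: powers_def intro: modspan_base)
next
  case (insert j J)
  let ?G = "insert (\<Prod>j\<in>insert j J. lin j) ((*) (lin i) ` powers x (card (insert j J)))"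
  have c: "card (insert j J) = Suc (card J)" using insert by simp
  have "(*) (lin i) ` powers x (Suc (card J)) \<union> (*) (lin j) ` powers x (Suc (card J)) \<subseteq> modspan ?G"
  proof (intro Un_least subsetI)
    fix y assume "y \<in> (*) (lin i) ` powers x (Suc (card J))"
    then show "y \<in> modspan ?G" unfolding c by (auto intro: modspan_base)
  next
    fix y assume "y \<in> (*) (lin j) ` powers x (Suc (card J))"
    then obtain z where z: "y = lin j * z" "z \<in> powers x (Suc (card J))" by auto
    have "z \<in> modspan (insert (\<Prod>j\<in>J. lin j) ((*) (lin i) ` powers x (card J)))"
      using insert z by auto
    then show "y \<in> modspan ?G" unfolding z(1)
    proof (rule modspan_mult_subset)
      fix g assume "g \<in> insert (\<Prod>j\<in>J. lin j) ((*) (lin i) ` powers x (card J))"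
      then consider "g = (\<Prod>j\<in>J. lin j)" | h where "g = lin i * h" "h \<in> powers x (card J)" by blast
      then show "lin j * g \<in> modspan ?G"
      proof cases
        case 1
        then show ?thesis using insert by (auto intro: modspan_base)
      next
        case 2
        have "lin j * h \<in> modspan (powers x (Suc (card J)))"
          using uv insert 2 by (intro mult_modspan_powers_linear modspan_base) auto
        then have "lin i * (lin j * h) \<in> modspan ?G"
          by (rule modspan_mult_subset) (auto simp: c intro: modspan_base)
        then show ?thesis by (simp add: 2 mult.left_commute)
      qed
    qed
  qed
  moreover have "powers x (Suc (Suc (card J))) \<subseteq>
      modspan ((*) (lin i) ` powers x (Suc (card J)) \<union> (*) (lin j) ` powers x (Suc (card J)))"
    using insert assms(1) by (intro powers_two_forms) auto
  ultimately show ?case unfolding c[symmetric] by (blast intro: modspan_mono)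
qed

lemma prod_forms_modspan_powers:
  assumes "finite J" "J \<subseteq> R"
  shows "(\<Prod>j\<in>J. lin j) \<in> modspan (powers x (Suc (card J)))"
  using assms
proof (induction J rule: finite_induct)
  case empty
  then show ?case by (auto simp: powers_def intro: modspan_base)
next
  case (insert j J)
  then show ?case using mult_modspan_powers_linear[of "u j" "v j" _ x] uv by auto
qed

text \<open>Lagrange interpolation with forms in place of nodes. When \<open>i\<close> joins
  \<open>J\<close>, \<open>powers_form_prod\<close> supplies the product that omits
  \<open>i\<close>, and multiplying the old products by \<open>lin i\<close> gives the rest.\<close>

lemma powers_lagrange:
  assumes "finite J" "J \<subseteq> R" "J \<noteq> {}"
  shows "powers x (card J) \<subseteq> modspan ((\<lambda>k. \<Prod>j\<in>J - {k}. lin j) ` J)"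
  using assms(1,3,2)
proof (induction J rule: finite_ne_induct)
  case (singleton i)
  then show ?case by (auto simp: powers_def intro: modspan_base)
next
  case (insert i J)
  let ?G = "(\<lambda>k. \<Prod>j\<in>insert i J - {k}. lin j) ` insert i J"
  have "insert (\<Prod>j\<in>J. lin j) ((*) (lin i) ` powers x (card J)) \<subseteq> modspan ?G"
  proof (intro insert_subsetI subsetI)
    have "insert i J - {i} = J" using insert by auto
    then have "(\<Prod>j\<in>J. lin j) \<in> ?G" by (metis (no_types, lifting) image_eqI insertI1)
    then show "(\<Prod>j\<in>J. lin j) \<in> modspan ?G" by (rule modspan_base)
  next
    fix y assume "y \<in> (*) (lin i) ` powers x (card J)"
    then obtain z where z: "y = lin i * z" "z \<in> powers x (card J)" by auto
    have "z \<in> modspan ((\<lambda>k. \<Prod>j\<in>J - {k}. lin j) ` J)" using insert z by auto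
    then show "y \<in> modspan ?G" unfolding z(1)
    proof (rule modspan_mult_subset)
      fix g assume "g \<in> (\<lambda>k. \<Prod>j\<in>J - {k}. lin j) ` J"
      then obtain k where k: "k \<in> J" "g = (\<Prod>j\<in>J - {k}. lin j)" by auto
      have "insert i J - {k} = insert i (J - {k})" using insert k by auto
      then have "lin i * g = (\<Prod>j\<in>insert i J - {k}. lin j)" using insert k by simp
      then show "lin i * g \<in> modspan ?G" using k by (auto intro: modspan_base)
    qed
  qed
  moreover have "powers x (Suc (card J)) \<subseteq>
    modspan (insert (\<Prod>j\<in>J. lin j) ((*) (lin i) ` powers x (card J)))"
    using insert by (intro powers_form_prod) auto
  moreover have "card (insert i J) = Suc (card J)" using insert by simp
  ultimately show ?case using modspan_mono by (metis (no_types, lifting) subset_iff)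
qed

end

text \<open>The exponent is bounded in each variable separately, not in total: a product of one
  linear form per variable has multidegree \<open>(1, ..., 1)\<close>, which matches the step from
  \<open>d\<close> to \<open>Suc d\<close>.\<close>

fun monoms :: "'a list \<Rightarrow> nat \<Rightarrow> 'a set" where
  "monoms [] d = {1}"
| "monoms (x # xs) d = {p * m | p m. p \<in> powers x d \<and> m \<in> monoms xs d}"

text \<open>The column is the length of the tail, so the last variable has column 0 and the columns
  of a tail do not shift when the induction removes the head.\<close>

fun row_prod :: "'a list \<Rightarrow> ('i \<Rightarrow> nat \<Rightarrow> 'a) \<Rightarrow> ('i \<Rightarrow> nat \<Rightarrow> 'a) \<Rightarrow> 'i \<Rightarrow> 'a" where
  "row_prod [] u v i = 1"
| "row_prod (x # xs) u v i = (u i (length xs) * x + v i (length xs)) * row_prod xs u v i"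

lemma modspan_monoms_Cons:
  assumes "p \<in> modspan (powers x d)" "m \<in> modspan (monoms xs d)"
  shows "p * m \<in> modspan (monoms (x # xs) d)"
proof (rule modspan_mult_subset[OF assms(2)])
  fix g assume g: "g \<in> monoms xs d"
  have "g * p \<in> modspan (monoms (x # xs) d)"
    by (rule modspan_mult_subset[OF assms(1)]) (use g in \<open>auto intro!: modspan_base simp: mult.commute\<close>)
  then show "p * g \<in> modspan (monoms (x # xs) d)" by (simp add: mult.commute)
qed

lemma row_prod_monoms:
  assumes "\<And>j. j < length xs \<Longrightarrow> u i j \<in> K \<and> v i j \<in> K" "m \<in> monoms xs d"
  shows "row_prod xs u v i * m \<in> modspan (monoms xs (Suc d))"
  using assms
proof (induction xs arbitrary: m)
  case (Cons x xs)
  then obtain p m' where m: "m = p * m'" "p \<in> powers x d" "m' \<in> monoms xs d" by auto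
  have "(u i (length xs) * x + v i (length xs)) * p \<in> modspan (powers x (Suc d))"
    using Cons.prems m by (intro mult_modspan_powers_linear modspan_base) auto
  moreover have "row_prod xs u v i * m' \<in> modspan (monoms xs (Suc d))"
    using Cons m by auto
  ultimately have "((u i (length xs) * x + v i (length xs)) * p) * (row_prod xs u v i * m')
      \<in> modspan (monoms (x # xs) (Suc d))"
    by (rule modspan_monoms_Cons)
  then show ?case by (simp add: m mult_ac)
qed (auto intro: modspan_base)

lemma monoms_one_modspan: "monoms xs (Suc 0) \<subseteq> modspan {1}"
proof -
  have "monoms xs (Suc 0) \<subseteq> {1}" by (induction xs) (auto simp: powers_def)
  then show ?thesis using modspan_base by blast
qed

lemma monoms_Suc_factor:
  "m \<in> monoms xs (Suc (Suc d)) \<Longrightarrow> \<exists>y\<in>monoms xs 2. \<exists>m'\<in>monoms xs (Suc d). m = y * m'"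
proof (induction xs arbitrary: m)
  case (Cons x xs)
  then obtain e m' where m: "m = x ^ e * m'" "e < Suc (Suc d)" "m' \<in> monoms xs (Suc (Suc d))"
    by (auto simp: powers_def)
  then obtain y z where yz: "y \<in> monoms xs 2" "z \<in> monoms xs (Suc d)" "m' = y * z"
    using Cons.IH by blast
  define e1 where "e1 = min e 1"
  have "x ^ e = x ^ e1 * x ^ (e - e1)" by (simp add: e1_def flip: power_add)
  then have "m = (x ^ e1 * y) * (x ^ (e - e1) * z)" by (simp add: m yz mult_ac)
  moreover have "e1 < 2" "e - e1 < Suc d" using m by (auto simp: e1_def)
  then have "x ^ e1 \<in> powers x 2" "x ^ (e - e1) \<in> powers x (Suc d)"
    by (auto simp: powers_def)
  ultimately show ?case using yz by auto
qed auto

lemma monoms_mult: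
  "y \<in> monoms xs 2 \<Longrightarrow> m \<in> monoms xs d \<Longrightarrow> y * m \<in> monoms xs (Suc d)"
proof (induction xs arbitrary: y m)
  case (Cons x xs)
  then obtain e y' f m' where m: "y = x ^ e * y'" "e < 2" "y' \<in> monoms xs 2"
     "m = x ^ f * m'" "f < d" "m' \<in> monoms xs d"
    by (auto simp: powers_def)
  then have "y * m = x ^ (e + f) * (y' * m')" "x ^ (e + f) \<in> powers x (Suc d)"
    by (auto simp: power_add mult_ac powers_def intro!: exI[of _ "e + f"])
  then show ?case using Cons.IH m by auto
qed auto

text \<open>If nothing survives in one degree, nothing survives in the next: a monomial is a
  multilinear one times one of the previous degree.\<close>

lemma monoms_mod_row_prods_mono:
  assumes "monoms xs (Suc d) \<subseteq> modspan (\<Union>i\<in>R. (*) (row_prod xs u v i) ` monoms xs d)"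
  shows "monoms xs (Suc (Suc d)) \<subseteq> modspan (\<Union>i\<in>R. (*) (row_prod xs u v i) ` monoms xs (Suc d))"
proof
  fix m assume "m \<in> monoms xs (Suc (Suc d))"
  then obtain y m' where y: "y \<in> monoms xs 2" "m' \<in> monoms xs (Suc d)" "m = y * m'"
    using monoms_Suc_factor by blast
  have "m' \<in> modspan (\<Union>i\<in>R. (*) (row_prod xs u v i) ` monoms xs d)" using assms y by blast
  then show "m \<in> modspan (\<Union>i\<in>R. (*) (row_prod xs u v i) ` monoms xs (Suc d))" unfolding y(3)
  proof (rule modspan_mult_subset)
    fix g assume "g \<in> (\<Union>i\<in>R. (*) (row_prod xs u v i) ` monoms xs d)"
    then obtain i h where h: "i \<in> R" "h \<in> monoms xs d" "g = row_prod xs u v i * h" by auto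
    have "row_prod xs u v i * (y * h) \<in> modspan (\<Union>i\<in>R. (*) (row_prod xs u v i) ` monoms xs (Suc d))"
      using h monoms_mult[OF y(1)] by (intro modspan_base) auto
    then show "y * g \<in> modspan (\<Union>i\<in>R. (*) (row_prod xs u v i) ` monoms xs (Suc d))"
      by (simp add: h mult_ac)
  qed
qed

text \<open>There is one more row than variables. The proof mirrors the Eulerian recurrence:
  \<open>D + 1\<close> rows interpolate in the first variable, and omitting any one of them leaves
  the problem of degree \<open>D\<close> in the other variables; each of the remaining rows leaves
  one problem of degree \<open>D - 1\<close>.\<close>

theorem monoms_mod_row_prods:
  fixes u v :: "'i \<Rightarrow> nat \<Rightarrow> 'a"
  assumes "finite R" "card R = Suc (length xs)"
    and "\<And>i j. i \<in> R \<Longrightarrow> j < length xs \<Longrightarrow> u i j \<in> K \<and> v i j \<in> K"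
    and "\<And>i i' j. i \<in> R \<Longrightarrow> i' \<in> R \<Longrightarrow> i \<noteq> i' \<Longrightarrow> j < length xs
           \<Longrightarrow> unit (u i j * v i' j - u i' j * v i j)"
  shows "\<exists>B. finite B \<and> card B \<le> eulerian (length xs) D \<and>
    monoms xs (Suc D) \<subseteq> modspan (B \<union> (\<Union>i\<in>R. (*) (row_prod xs u v i) ` monoms xs D))"
  using assms
proof (induction xs arbitrary: R D)
  case Nil
  then obtain i where "R = {i}" by (auto simp: card_1_singleton_iff)
  then show ?case by (intro exI[of _ "{}"]) (auto intro: modspan_base)
next
  case (Cons x xs)
  let ?W = "\<lambda>D. \<Union>i\<in>R. (*) (row_prod (x # xs) u v i) ` monoms (x # xs) D"
  have main: "\<exists>B. finite B \<and> card B \<le> eulerian (length (x # xs)) D \<and>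
    monoms (x # xs) (Suc D) \<subseteq> modspan (B \<union> ?W D)" if Dle: "D \<le> Suc (length xs)" for D
  proof (cases D)
    case 0
    have "modspan {1} \<subseteq> modspan ({1} \<union> ?W D)"
      by (auto intro: modspan_mono modspan_base)
    then show ?thesis using monoms_one_modspan[of "x # xs"] 0
      by (intro exI[of _ "{1}"]) auto
  next
    case (Suc D')
    let ?m = "length xs"
    let ?l = "\<lambda>i. u i ?m * x + v i ?m"
    let ?f = "row_prod xs u v"
    note R = \<open>finite R\<close>
    have uv: "u i ?m \<in> K" "v i ?m \<in> K" if "i \<in> R" for i using Cons.prems(3)[OF that] by auto
    have indep: "unit (u i ?m * v j ?m - u j ?m * v i ?m)" if "i \<in> R" "j \<in> R" "i \<noteq> j" for i j
      using Cons.prems(4)[OF that] by auto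
    have uvK: "u i j \<in> K \<and> v i j \<in> K" if "i \<in> R" "j < length xs" for i j
      using Cons.prems(3)[OF that(1)] that(2) by auto
    \<comment> \<open>The interpolation rows: \<open>Suc D\<close> of them span degree
      \<open>D\<close> in \<open>x\<close>. That there are so many is the reason for the bound on
      \<open>D\<close>.\<close>
    obtain R0 where R0: "R0 \<subseteq> R" "card R0 = Suc D"
      by (rule obtain_subset_with_card_n[of "Suc D" R]) (use Cons.prems Dle in auto)
    have fR0: "finite R0" using R0 R finite_subset by blast
    have cR1: "card (R - R0) = ?m - D'"
      using R0 fR0 Cons.prems Suc by (simp add: card_Diff_subset)
    \<comment> \<open>The choice is arbitrary: \<open>s\<close> only has to have degree
      \<open>D\<close> and no factor \<open>lin i\<close> with \<open>i\<close> outside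
      \<open>R0\<close>.\<close>
    obtain J where J: "J \<subseteq> R0" "card J = D"
      by (rule obtain_subset_with_card_n[of D R0]) (use R0 in auto)
    have fJ: "finite J" using J fR0 finite_subset by blast
    define c where "c k = (\<Prod>j\<in>R0 - {k}. ?l j)" for k
    define s where "s = (\<Prod>j\<in>J. ?l j)"
    \<comment> \<open>With one variable fewer, omitting a row restores the surplus of exactly one
      row.\<close>
    have IH: "\<exists>B. finite B \<and> card B \<le> eulerian ?m E \<and>
      monoms xs (Suc E) \<subseteq> modspan (B \<union> (\<Union>i\<in>R-{k}. (*) (?f i) ` monoms xs E))"
      if "k \<in> R" for k E
      using that R Cons.prems by (intro Cons.IH) auto
    obtain B where B: "\<And>k. k \<in> R \<Longrightarrow> finite (B k)" "\<And>k. k \<in> R \<Longrightarrow> card (B k) \<le> eulerian ?m D"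
      "\<And>k. k \<in> R \<Longrightarrow> monoms xs (Suc D) \<subseteq> modspan (B k \<union> (\<Union>i\<in>R-{k}. (*) (?f i) ` monoms xs D))"
      using IH[of _ D] by metis
    obtain C where C: "\<And>k. k \<in> R \<Longrightarrow> finite (C k)" "\<And>k. k \<in> R \<Longrightarrow> card (C k) \<le> eulerian ?m D'"
      "\<And>k. k \<in> R \<Longrightarrow> monoms xs (Suc D') \<subseteq> modspan (C k \<union> (\<Union>i\<in>R-{k}. (*) (?f i) ` monoms xs D'))"
      using IH[of _ D'] by metis
    define B1 where "B1 = (\<Union>k\<in>R0. (*) (c k) ` B k)"
    define B2 where "B2 = (\<Union>i\<in>R - R0. (*) (s * ?f i) ` C i)"
    have fin: "finite B1" "finite B2" using B C R0 fR0 R by (auto simp: B1_def B2_def)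
    have "card B1 \<le> (\<Sum>k\<in>R0. card ((*) (c k) ` B k))"
      unfolding B1_def using fR0 by (rule card_UN_le)
    also have "\<dots> \<le> (\<Sum>k\<in>R0. eulerian ?m D)"
      using B R0 by (intro sum_mono order.trans[OF card_image_le]) auto
    finally have cB1: "card B1 \<le> (D' + 2) * eulerian ?m D" using R0 Suc by simp
    have "card B2 \<le> (\<Sum>i\<in>R-R0. card ((*) (s * ?f i) ` C i))"
      unfolding B2_def using R by (intro card_UN_le) auto
    also have "\<dots> \<le> (\<Sum>k\<in>R-R0. eulerian ?m D')"
      using C R0 by (intro sum_mono order.trans[OF card_image_le]) auto
    finally have cB2: "card B2 \<le> (?m - D') * eulerian ?m D'" using cR1 by simp
    have cB: "card (B1 \<union> B2) \<le> eulerian (length (x # xs)) D"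
      using card_Un_le[of B1 B2] cB1 cB2 by (simp add: Suc)
    let ?H = "modspan (B1 \<union> B2 \<union> ?W D)"
    have W: "?l i * ?f i * (p * g) \<in> ?H"
      if "i \<in> R" "p \<in> modspan (powers x D)" "g \<in> modspan (monoms xs D)" for i p g
    proof (rule modspan_mult_subset[OF modspan_monoms_Cons[OF that(2,3)]])
      fix h assume "h \<in> monoms (x # xs) D"
      then show "?l i * ?f i * h \<in> ?H" using that(1) by (intro modspan_base UnI2 UN_I) auto
    qed
    have sJ: "s \<in> modspan (powers x (Suc D))"
      unfolding s_def using prod_forms_modspan_powers[of R "\<lambda>i. u i ?m" "\<lambda>i. v i ?m" J x] J R0 fJ uv indep
      by auto
    \<comment> \<open>The factor \<open>g\<close> is reduced once more, in degree \<open>D'\<close>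
      and without row \<open>i\<close>. A remaining term carries the tails of two rows
      \<open>i\<close> and \<open>k\<close>, and \<open>powers_two_forms\<close> splits
      \<open>s\<close> into multiples of \<open>lin i\<close> and of \<open>lin k\<close>, each of
      which completes one of these rows.\<close>
    have s: "s * ?f i * g \<in> ?H" if i: "i \<in> R - R0" and g: "g \<in> monoms xs D" for i g
    proof -
      have "g \<in> modspan (C i \<union> (\<Union>k\<in>R-{i}. (*) (?f k) ` monoms xs D'))"
        using C(3)[of i] i g Suc by auto
      then show ?thesis
      proof (rule modspan_mult_subset)
        fix h assume "h \<in> C i \<union> (\<Union>k\<in>R-{i}. (*) (?f k) ` monoms xs D')"
        then consider "h \<in> C i" | k h' where "k \<in> R" "k \<noteq> i" "h' \<in> monoms xs D'" "h = ?f k * h'" by auto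
        then show "s * ?f i * h \<in> ?H"
        proof cases
          case 1
          then show ?thesis using i by (intro modspan_base) (auto simp: B2_def)
        next
          case 2
          have fm: "?f k * h' \<in> modspan (monoms xs D)" "?f i * h' \<in> modspan (monoms xs D)"
            using row_prod_monoms[of xs u k v h' D'] row_prod_monoms[of xs u i v h' D'] 2 i uvK Suc by auto
          have "powers x (Suc D) \<subseteq> modspan ((*) (?l i) ` powers x D \<union> (*) (?l k) ` powers x D)"
            using powers_two_forms[of R "\<lambda>i. u i ?m" "\<lambda>i. v i ?m" i k D x] i 2 uv indep Suc by auto
          then have "s \<in> modspan ((*) (?l i) ` powers x D \<union> (*) (?l k) ` powers x D)"
            using sJ by (blast intro: modspan_mono)
          then have "(?f i * ?f k * h') * s \<in> ?H"
          proof (rule modspan_mult_subset)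
            fix y assume "y \<in> (*) (?l i) ` powers x D \<union> (*) (?l k) ` powers x D"
            then consider p where "p \<in> powers x D" "y = ?l i * p" | p where "p \<in> powers x D" "y = ?l k * p"
              by auto
            then show "?f i * ?f k * h' * y \<in> ?H"
            proof cases
              case (1 p)
              have "?l i * ?f i * (p * (?f k * h')) \<in> ?H" using 1 i fm
                by (intro W) (auto intro: modspan_base)
              then show ?thesis by (simp add: 1 mult_ac)
            next
              case (2 p)
              have "?l k * ?f k * (p * (?f i * h')) \<in> ?H"
                using 2 \<open>k \<in> R\<close> fm by (intro W) (auto intro: modspan_base)
              then show ?thesis by (simp add: 2 mult_ac)
            qed
          qed
          then show ?thesis by (simp add: 2 mult_ac)
        qed
      qed
    qed
    \<comment> \<open>This treats what is left after reduction by the rows other than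
      \<open>k\<close>. For \<open>i\<close> in \<open>R0\<close> the factor \<open>lin i\<close> of
      \<open>c k\<close> completes row \<open>i\<close>. Otherwise \<open>c k\<close> is a multiple
      of \<open>lin i\<close>, which completes row \<open>i\<close>, plus a multiple of
      \<open>s\<close>.\<close>
    have ck: "c k * (?f i * g) \<in> ?H" if k: "k \<in> R0" and i: "i \<in> R - {k}" and g: "g \<in> monoms xs D" for k i g
    proof (cases "i \<in> R0")
      case True
      have "R0 - {k} = insert i (R0 - {k} - {i})" using True i by auto
      then have "c k = ?l i * (\<Prod>j\<in>R0 - {k} - {i}. ?l j)"
        unfolding c_def using fR0
          by (metis (no_types, lifting) Diff_iff finite_Diff insertI1 prod.insert singletonI)
      moreover have "card (R0 - {k} - {i}) = D'" using R0 fR0 k True i Suc by simp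
      then have "(\<Prod>j\<in>R0 - {k} - {i}. ?l j) \<in> modspan (powers x D)"
        using prod_forms_modspan_powers[of R "\<lambda>i. u i ?m" "\<lambda>i. v i ?m"
          "R0 - {k} - {i}" x] R0 fR0 uv indep Suc
        by auto
      then have "?l i * ?f i * ((\<Prod>j\<in>R0 - {k} - {i}. ?l j) * g) \<in> ?H"
        using i g by (intro W) (auto intro: modspan_base)
      ultimately show ?thesis by (simp add: mult_ac)
    next
      case False
      have "c k \<in> modspan (powers x (Suc D'+1))"
        using prod_forms_modspan_powers[of R "\<lambda>i. u i ?m" "\<lambda>i. v i ?m" "R0 - {k}" x] R0 fR0 uv indep Suc k
        unfolding c_def by auto
      moreover have "powers x (Suc D) \<subseteq> modspan (insert s ((*) (?l i) ` powers x D))"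
        using powers_form_prod[of R "\<lambda>i. u i ?m" "\<lambda>i. v i ?m" i J x] J R0 fJ uv indep False i
        unfolding s_def by auto
      ultimately have "c k \<in> modspan (insert s ((*) (?l i) ` powers x D))"
        using Suc by (auto intro: modspan_mono)
      then have "(?f i * g) * c k \<in> ?H"
      proof (rule modspan_mult_subset)
        fix y assume "y \<in> insert s ((*) (?l i) ` powers x D)"
        then consider "y = s" | p where "p \<in> powers x D" "y = ?l i * p" by auto
        then show "?f i * g * y \<in> ?H"
        proof cases
          case 1
          then show ?thesis using s[of i g] i False g by (simp add: mult_ac)
        next
          case 2
          have "?l i * ?f i * (p * g) \<in> ?H" using 2 i g by (intro W) (auto intro: modspan_base)
          then show ?thesis by (simp add: 2 mult_ac)
        qed
      qed
      then show ?thesis by (simp add: mult_ac)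
    qed
    have ckm: "c k * m \<in> ?H" if k: "k \<in> R0" and m: "m \<in> monoms xs (Suc D)" for k m
    proof -
      have "m \<in> modspan (B k \<union> (\<Union>i\<in>R-{k}. (*) (?f i) ` monoms xs D))"
        using B(3)[of k] k R0 m by auto
      then show ?thesis
      proof (rule modspan_mult_subset)
        fix h assume "h \<in> B k \<union> (\<Union>i\<in>R-{k}. (*) (?f i) ` monoms xs D)"
        then consider "h \<in> B k" | i g where "i \<in> R - {k}" "g \<in> monoms xs D" "h = ?f i * g" by auto
        then show "c k * h \<in> ?H"
        proof cases
          case 1
          then show ?thesis using k by (intro modspan_base) (auto simp: B1_def)
        qed (use ck k in auto)
      qed
    qed
    have lag: "powers x (Suc D) \<subseteq> modspan (c ` R0)"
      using powers_lagrange[of R "\<lambda>i. u i ?m" "\<lambda>i. v i ?m" R0 x] R0 fR0 uv indep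
      unfolding c_def by fastforce
    have "monoms (x # xs) (Suc D) \<subseteq> ?H"
    proof
      fix y assume "y \<in> monoms (x # xs) (Suc D)"
      then obtain p m where y: "p \<in> powers x (Suc D)" "m \<in> monoms xs (Suc D)" "y = p * m" by auto
      have "m * p \<in> ?H"
        by (rule modspan_mult_subset[of p "c ` R0"]) (use lag y ckm in \<open>auto simp: mult.commute\<close>)
      then show "y \<in> ?H" by (simp add: y mult.commute)
    qed
    then show ?thesis using cB fin by (intro exI[of _ "B1 \<union> B2"]) auto
  qed
  show ?case
  proof (cases "D \<le> Suc (length xs)")
    case True
    then show ?thesis by (rule main)
  next
    case False
    obtain B where B: "finite B" "card B \<le> eulerian (length (x # xs)) (Suc (length xs))"
      "monoms (x # xs) (Suc (Suc (length xs))) \<subseteq> modspan (B \<union> ?W (Suc (length xs)))"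
      using main[of "Suc (length xs)"] by auto
    \<comment> \<open>When \<open>D\<close> reaches the number of variables the Eulerian number is
      0, and the vanishing persists in all larger degrees.\<close>
    have "eulerian (Suc (length xs)) (Suc (length xs)) = 0" by (rule eulerian_eq_0) auto
    then have "B = {}" using B by (simp del: eulerian.simps)
    then have base: "monoms (x # xs) (Suc (Suc (length xs))) \<subseteq> modspan (?W (Suc (length xs)))"
      using B by simp
    have "Suc (length xs) \<le> D" using False by simp
    then have "monoms (x # xs) (Suc D) \<subseteq> modspan (?W D)"
    proof (induction D rule: dec_induct)
      case (step n)
      then show ?case by (intro monoms_mod_row_prods_mono)
    qed (use base in simp)
    then show ?thesis by (intro exI[of _ "{}"]) auto
  qed
qed


lemma monoms_ConsI: "e < d \<Longrightarrow> m \<in> monoms xs d \<Longrightarrow> x ^ e * m \<in> monoms (x # xs) d"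
  unfolding monoms.simps powers_def by blast

lemma one_in_monoms: "d > 0 \<Longrightarrow> 1 \<in> monoms xs d"
proof (induction xs)
  case (Cons x xs)
  then show ?case using monoms_ConsI[of 0 d 1 xs x] by simp
qed simp

text \<open>By the equations every row product is a scalar, and the added row has product 1. So
  multiples of row products drop to the previous degree, each degree \<open>D\<close> contributes at
  most \<open>eulerian t D\<close> new generators, and these numbers add up to
  \<open>fact t\<close>.\<close>

corollary powers_in_small_modspan:
  fixes u v :: "nat \<Rightarrow> nat \<Rightarrow> 'a" and b :: "nat \<Rightarrow> 'a"
  assumes t: "length xs = t" "t > 0"
    and uv: "\<And>i j. i < t \<Longrightarrow> j < t \<Longrightarrow> u i j \<in> K \<and> v i j \<in> K"
    and indep: "\<And>i i' j. i < t \<Longrightarrow> i' < t \<Longrightarrow> i \<noteq> i' \<Longrightarrow> j < t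
           \<Longrightarrow> unit (u i j * v i' j - u i' j * v i j)"
    and u_unit: "\<And>i j. i < t \<Longrightarrow> j < t \<Longrightarrow> unit (u i j)"
    and b: "\<And>i. i < t \<Longrightarrow> b i \<in> K" "\<And>i. i < t \<Longrightarrow> row_prod xs u v i - b i \<in> N"
  shows "\<exists>B. finite B \<and> card B \<le> fact t \<and> (\<forall>x\<in>set xs. \<forall>e. x ^ e \<in> modspan B)"
proof -
  \<comment> \<open>Row \<open>t\<close> consists of the constant form 1. Its determinant with row
    \<open>i\<close> is \<open>u i j\<close> up to sign, which is the purpose of
    \<open>u_unit\<close>.\<close>
  define u' where "u' i j = (if i < t then u i j else 0)" for i j
  define v' where "v' i j = (if i < t then v i j else 1)" for i j
  have zero_K: "0 \<in> K" using add_K[OF one_K uminus_K[OF one_K]] by simp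
  have unit_uminus: "unit (- c)" if "unit c" for c
    using that uminus_K by (auto simp: unit_def intro!: bexI[of _ "- w" for w])
  have rp: "row_prod xs' u' v' i = (if i < t then row_prod xs' u v i else 1)" for xs' i
    by (induction xs') (auto simp: u'_def v'_def)
  have "\<exists>B. finite B \<and> card B \<le> eulerian (length xs) D \<and>
    monoms xs (Suc D) \<subseteq> modspan (B \<union> (\<Union>i\<in>{..t}. (*) (row_prod xs u' v' i) ` monoms xs D))" for D
  proof (rule monoms_mod_row_prods)
    fix i i' j assume *: "i \<in> {..t}" "i' \<in> {..t}" "i \<noteq> i'" "j < length xs"
    then consider "i < t" "i' < t" | "i = t" "i' < t" | "i < t" "i' = t" by (auto simp: le_less)
    then show "unit (u' i j * v' i' j - u' i' j * v' i j)"
      using * t indep u_unit unit_uminus by cases (auto simp: u'_def v'_def)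
  qed (use t uv one_K zero_K in \<open>auto simp: u'_def v'_def\<close>)
  then obtain B where B: "\<And>D. finite (B D)" "\<And>D. card (B D) \<le> eulerian t D"
    "\<And>D. monoms xs (Suc D) \<subseteq> modspan (B D \<union> (\<Union>i\<in>{..t}. (*) (row_prod xs u' v' i) ` monoms xs D))"
    unfolding t by metis
  have step: "monoms xs (Suc D) \<subseteq> modspan (B D \<union> monoms xs D)" for D
  proof -
    have "(*) (row_prod xs u' v' i) ` monoms xs D \<subseteq> modspan (B D \<union> monoms xs D)" for i
    proof (cases "i < t")
      case True
      have "(row_prod xs u v i) * m \<in> modspan (B D \<union> monoms xs D)" if "m \<in> monoms xs D" for m
      proof -
        have "m * (row_prod xs u v i - b i) + b i * m \<in> modspan (B D \<union> monoms xs D)"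
          using that b[OF True]
          by (intro modspan_add modspan_scale[of m] modspan_null[OF mult_N] modspan_base) auto
        then show ?thesis by (simp add: algebra_simps)
      qed
      then show ?thesis using True by (auto simp: rp)
    qed (auto simp: rp intro: modspan_base)
    then have "B D \<union> (\<Union>i\<in>{..t}. (*) (row_prod xs u' v' i) ` monoms xs D) \<subseteq> modspan (B D \<union> monoms xs D)"
      by (auto intro: modspan_base)
    then show ?thesis using B(3)[of D] modspan_mono by blast
  qed
  define C where "C = (\<Union>D<t. B D)"
  have below: "monoms xs D \<subseteq> modspan C" if "D \<le> t" for D
    using that
  proof (induction D)
    case 0
    have "monoms xs 0 = {}" using t by (cases xs) (auto simp: powers_def)
    then show ?case by simp
  next
    case (Suc D)
    then have "B D \<subseteq> C" "monoms xs D \<subseteq> modspan C" unfolding C_def by (auto dest: Suc_le_lessD)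
    then have "B D \<union> monoms xs D \<subseteq> modspan C" by (blast intro: modspan_base)
    then show ?case using step[of D] modspan_mono by blast
  qed
  \<comment> \<open>Degree \<open>t\<close> adds nothing new, so the span of the monomials with
    exponents below \<open>t\<close> is closed under multiplication by the variables.\<close>
  have "B t = {}" using B(1,2)[of t] eulerian_eq_0[of t t] t by auto
  then have closed: "monoms xs (Suc t) \<subseteq> modspan (monoms xs t)" using step[of t] by simp
  have mult: "x * m \<in> monoms xs (Suc t)" if "x \<in> set xs" "m \<in> monoms xs t" for x m
  proof (rule monoms_mult[OF _ that(2)])
    show "x \<in> monoms xs 2" using that(1)
    proof (induction xs)
      case (Cons y ys)
      show ?case
      proof (cases "x = y")
        case True
        then show ?thesis using monoms_ConsI[of 1 2 1 ys x] one_in_monoms[of 2 ys] by simp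
      next
        case False
        then have "x \<in> monoms ys 2" using Cons by auto
        then show ?thesis using monoms_ConsI[of 0 2 x ys y] by simp
      qed
    qed auto
  qed
  have pow: "x ^ e \<in> modspan (monoms xs t)" if "x \<in> set xs" for x e
  proof (induction e)
    case 0
    have "1 \<in> monoms xs t" using t by (simp add: one_in_monoms)
    then show ?case by (auto intro: modspan_base)
  next
    case (Suc e)
    have "x * x ^ e \<in> modspan (monoms xs t)"
      by (rule modspan_mult_subset[OF Suc]) (use mult that closed in blast)
    then show ?case by simp
  qed
  have "card C \<le> (\<Sum>D<t. card (B D))" unfolding C_def by (rule card_UN_le) simp
  also have "\<dots> \<le> (\<Sum>D<t. eulerian t D)" by (intro sum_mono B)
  also have "\<dots> = fact t" using t by (simp add: sum_eulerian)
  finally have "card C \<le> fact t" .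
  moreover have "finite C" using B by (auto simp: C_def)
  moreover have "x ^ e \<in> modspan C" if "x \<in> set xs" for x e
    using modspan_mono[OF pow[OF that] below[of t]] by simp
  ultimately show ?thesis by blast
qed

end

section \<open>Solutions of product systems over a finite residue field\<close>

lemma sum_fun_apply: "(\<Sum>i\<in>A. f i) x = (\<Sum>i\<in>A. f i x)" for f :: "'i \<Rightarrow> 'x \<Rightarrow> 'r :: comm_ring_1"
  by (induction A rule: infinite_finite_induct) auto

lemma prod_fun_apply: "(\<Prod>i\<in>A. f i) x = (\<Prod>i\<in>A. f i x)" for f :: "'i \<Rightarrow> 'x \<Rightarrow> 'r :: comm_ring_1"
  by (induction A rule: infinite_finite_induct) auto

locale ring_ideal =
  fixes I :: "'r :: comm_ring_1 set"
  assumes I_zero: "0 \<in> I" and I_add: "x \<in> I \<Longrightarrow> y \<in> I \<Longrightarrow> x + y \<in> I"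
    and I_mult: "x \<in> I \<Longrightarrow> y * x \<in> I"
begin

lemma I_uminus: "x \<in> I \<Longrightarrow> - x \<in> I" using I_mult[of x "-1"] by simp
lemma I_diff: "x \<in> I \<Longrightarrow> y \<in> I \<Longrightarrow> x - y \<in> I" using I_add[of x "-y"] I_uminus by simp
lemma I_sum: "(\<And>i. i \<in> A \<Longrightarrow> f i \<in> I) \<Longrightarrow> sum f A \<in> I"
  by (induction A rule: infinite_finite_induct) (auto intro: I_zero I_add)

lemma I_power_diff: "x - y \<in> I \<Longrightarrow> x ^ n - y ^ n \<in> I"
  unfolding power_diff_sumr2 by (subst mult.commute) (rule I_mult)

lemma frobenius_add:
  assumes "prime p" "of_nat p \<in> I"
  shows "(x + y) ^ (p ^ e) - (x ^ (p ^ e) + y ^ (p ^ e)) \<in> I"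
proof (induction e)
  case (Suc e)
  have base: "(u + v) ^ p - (u ^ p + v ^ p) \<in> I" for u v
  proof -
    have "p > 0" using assms prime_gt_0_nat by blast
    have "(u + v) ^ p = (\<Sum>k\<le>p. of_nat (p choose k) * u ^ k * v ^ (p - k))"
      by (rule binomial_ring)
    also have "{..p} = insert 0 (insert p {0<..<p})" by auto
    finally have "(u + v) ^ p - (u ^ p + v ^ p) = (\<Sum>k\<in>{0<..<p}. of_nat (p choose k) * u ^ k * v ^ (p - k))"
      using \<open>p > 0\<close> by simp
    also have "\<dots> \<in> I"
    proof (rule I_sum)
      fix k assume "k \<in> {0<..<p}"
      then have "p dvd (p choose k)" using assms by (intro dvd_choose_prime) auto
      then obtain c where "p choose k = p * c" by blast
      then have "of_nat (p choose k) * u ^ k * v ^ (p - k) = (of_nat c * u ^ k * v ^ (p - k)) * of_nat p"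
        by (simp add: mult_ac)
      then show "of_nat (p choose k) * u ^ k * v ^ (p - k) \<in> I" using assms by (simp add: I_mult)
    qed
    finally show ?thesis .
  qed
  have "((x + y) ^ p ^ e) ^ p - (x ^ p ^ e + y ^ p ^ e) ^ p \<in> I"
    using Suc by (rule I_power_diff)
  from I_add[OF this base[of "x ^ p ^ e" "y ^ p ^ e"]]
  show ?case by (simp add: power_mult[symmetric] mult.commute algebra_simps)
qed (simp add: I_zero)

end

text \<open>A finite field as the congruence modulo \<open>I\<close>, so that its order can vary
  inside one type. \<open>Rep\<close> holds one element of each class and carries all the
  counting.\<close>

locale residue_field = ring_ideal I for I :: "'r :: comm_ring_1 set" +
  fixes Rep :: "'r set"
  assumes I_proper: "1 \<notin> I" and I_inverse: "x \<notin> I \<Longrightarrow> \<exists>y. y * x - 1 \<in> I"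
    and finite_Rep: "finite Rep" and Rep_ex1: "\<exists>!y. y \<in> Rep \<and> x - y \<in> I"
begin

lemma I_prime: "x * y \<in> I \<Longrightarrow> x \<in> I \<or> y \<in> I"
proof (rule ccontr)
  assume xy: "x * y \<in> I" "\<not> (x \<in> I \<or> y \<in> I)"
  then obtain z where "z * x - 1 \<in> I" using I_inverse by auto
  then have "z * (x * y) - y * (z * x - 1) \<in> I"
    using xy I_diff[OF I_mult I_mult] by blast
  then show False using xy by (simp add: algebra_simps)
qed

lemma I_prod_notin: "finite A \<Longrightarrow> (\<And>i. i \<in> A \<Longrightarrow> f i \<notin> I) \<Longrightarrow> prod f A \<notin> I"
  by (induction A rule: finite_induct) (use I_proper I_prime in auto)

definition rep :: "'r \<Rightarrow> 'r" where "rep x = (THE y. y \<in> Rep \<and> x - y \<in> I)"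

lemma rep: "rep x \<in> Rep" "x - rep x \<in> I"
  using theI'[OF Rep_ex1[of x]] by (auto simp: rep_def)

lemma Rep_unique: "x \<in> Rep \<Longrightarrow> y \<in> Rep \<Longrightarrow> x - y \<in> I \<Longrightarrow> x = y"
  using Rep_ex1[of x] I_zero by auto

lemma card_Rep_ge_2: "card Rep \<ge> 2"
proof -
  have "rep 0 \<noteq> rep 1"
  proof
    assume "rep 0 = rep 1"
    then have "(1 - rep 1) - (0 - rep 0) \<in> I" by (intro I_diff rep)
    then show False using I_proper \<open>rep 0 = rep 1\<close> by simp
  qed
  then have "card {rep 0, rep 1} = 2" by simp
  then show ?thesis using card_mono[OF finite_Rep, of "{rep 0, rep 1}"] rep by auto
qed

text \<open>The functions \<open>\<phi> j\<close> are taken modulo those vanishing on \<open>S\<close>; since powers of \<open>\<phi> 0 = id\<close> separate the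
  points of \<open>S\<close>, a spanning set of that quotient has at least \<open>card S\<close> elements.\<close>
theorem card_product_system_solutions:
  fixes \<phi> :: "nat \<Rightarrow> 'r \<Rightarrow> 'r" and a :: "nat \<Rightarrow> nat \<Rightarrow> 'r" and b :: "nat \<Rightarrow> 'r"
  assumes t: "t > 0" and id: "\<And>x. \<phi> 0 x = x" and S: "S \<subseteq> Rep"
    and a: "\<And>i i' j. i < t \<Longrightarrow> i' < t \<Longrightarrow> i \<noteq> i' \<Longrightarrow> j < t \<Longrightarrow> a i j - a i' j \<notin> I"
    and sol: "\<And>i s. i < t \<Longrightarrow> s \<in> S \<Longrightarrow> (\<Prod>j<t. \<phi> j s - a i j) - b i \<in> I"
  shows "card S \<le> fact t"
proof -
  define K :: "('r \<Rightarrow> 'r) set" where "K = range (\<lambda>c _. c)"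
  define N where "N = {f :: 'r \<Rightarrow> 'r. \<forall>s\<in>S. f s \<in> I}"
  have fS: "finite S" using S finite_Rep finite_subset by blast
  have K_iff: "f \<in> K \<longleftrightarrow> (\<forall>x y. f x = f y)" for f
  proof
    assume "\<forall>x y. f x = f y"
    then have "f = (\<lambda>_. f undefined)" by (auto simp: fun_eq_iff)
    then show "f \<in> K" unfolding K_def by (rule range_eqI)
  qed (auto simp: K_def)
  interpret scalars_mod_ideal K N
  proof
    show "- x \<in> K" if xK: "x \<in> K" for x
    proof -
      obtain c where "x = (\<lambda>_. c)" using xK by (auto simp: K_def)
      then show ?thesis by (simp add: K_iff)
    qed
    fix x y assume "x \<in> K" "y \<in> K"
    then obtain c d where "x = (\<lambda>_. c)" "y = (\<lambda>_. d)" by (auto simp: K_def)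
    then show "x + y \<in> K" "x * y \<in> K" by (simp_all add: K_iff)
  qed (simp_all add: K_iff N_def I_zero I_add I_mult)
  have unit: "unit (\<lambda>_. c)" if c: "c \<notin> I" for c
  proof -
    obtain w where "w * c - 1 \<in> I" using I_inverse[OF c] by blast
    then show ?thesis unfolding unit_def by (intro bexI[of _ "\<lambda>_. w"]) (auto simp: K_iff N_def)
  qed
  \<comment> \<open>Reversed because \<open>row_prod\<close> numbers its columns from the end of the
    list.\<close>
  define xs where "xs = map \<phi> (rev [0..<t])"
  have rp: "row_prod (map \<phi> (rev [0..<n])) u v i = (\<Prod>j<n. u i j * \<phi> j + v i j)"
    for u v :: "nat \<Rightarrow> nat \<Rightarrow> 'r \<Rightarrow> 'r" and i n
    by (induction n) (auto simp: mult.commute)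
  have "\<exists>B. finite B \<and> card B \<le> fact t \<and> (\<forall>x\<in>set xs. \<forall>e. x ^ e \<in> modspan B)"
  proof (rule powers_in_small_modspan[where u = "\<lambda>_ _. 1" and v = "\<lambda>i j _. - a i j" and b = "\<lambda>i _. b i"])
    fix i i' j assume "i < t" "i' < t" "i \<noteq> i'" "j < t"
    then have "unit (\<lambda>_. a i j - a i' j)" using a unit by blast
    then show "unit (1 * (\<lambda>_. - a i' j) - 1 * (\<lambda>_. - a i j))"
      by (simp add: fun_diff_def)
  next
    show "unit (1 :: 'r \<Rightarrow> 'r)" using unit[of 1] I_proper by (simp add: one_fun_def)
  next
    fix i assume "i < t"
    then show "row_prod xs (\<lambda>_ _. 1) (\<lambda>i j _. - a i j) i - (\<lambda>_. b i) \<in> N"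
      unfolding xs_def rp N_def using sol by (simp add: prod_fun_apply)
  qed (use t in \<open>simp_all add: K_iff xs_def\<close>)
  then obtain B where B: "finite B" "card B \<le> fact t" "\<forall>x\<in>set xs. \<forall>e. x ^ e \<in> modspan B"
    by blast
  moreover have "\<phi> 0 \<in> set xs" using t by (auto simp: xs_def)
  ultimately have pow0: "\<phi> 0 ^ e \<in> modspan B" for e by blast
  have "powers (\<phi> 0) d \<subseteq> modspan B" for d using pow0 by (auto simp: powers_def)
  \<comment> \<open>The numerators of Lagrange interpolation on \<open>S\<close>: they are
    polynomials in \<open>\<phi> 0\<close>, whose powers lie in the span. Suitably scaled they are
    indicators of single points, so every function on \<open>S\<close> is spanned.\<close>
  then have lag: "(\<Prod>s'\<in>S - {s}. \<phi> 0 - (\<lambda>_. s')) \<in> modspan B" for s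
  proof -
    have "(\<Prod>s'\<in>S - {s}. 1 * \<phi> 0 + (\<lambda>_. - s')) \<in> modspan (powers (\<phi> 0) (Suc (card (S - {s}))))"
    proof (rule prod_forms_modspan_powers[of S "\<lambda>_. 1" "\<lambda>s _. - s"])
      fix i j assume "i \<in> S" "j \<in> S" "i \<noteq> j"
      then have "unit (\<lambda>_. i - j)" using Rep_unique S unit by blast
      then show "unit (1 * (\<lambda>_. - j) - 1 * (\<lambda>_. - i))" by (simp add: fun_diff_def)
    qed (use fS in \<open>auto simp: K_iff\<close>)
    then have "(\<Prod>s'\<in>S - {s}. 1 * \<phi> 0 + (\<lambda>_. - s')) \<in> modspan B"
      by (rule modspan_mono) fact
    moreover have "1 * \<phi> 0 + (\<lambda>_. - s') = \<phi> 0 - (\<lambda>_. s')" for s' by (auto simp: fun_eq_iff)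
    ultimately show ?thesis by simp
  qed
  have all: "f \<in> modspan B" for f
  proof -
    have "\<exists>w. w * (\<Prod>s'\<in>S - {s}. s - s') - 1 \<in> I" if "s \<in> S" for s
    proof (rule I_inverse, rule I_prod_notin)
      show "s - s' \<notin> I" if "s' \<in> S - {s}" for s'
        using that \<open>s \<in> S\<close> S Rep_unique[of s s'] by auto
    qed (use fS in auto)
    then obtain w where w: "\<And>s. s \<in> S \<Longrightarrow> w s * (\<Prod>s'\<in>S - {s}. s - s') - 1 \<in> I" by metis
    define g where "g = (\<Sum>s\<in>S. (\<lambda>_. f s * w s) * (\<Prod>s'\<in>S - {s}. \<phi> 0 - (\<lambda>_. s')))"
    have "g \<in> modspan B" unfolding g_def
      by (intro modspan_sum modspan_scale lag) (simp add: K_iff)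
    moreover have "f - g \<in> N"
    proof -
      have "f s - g s \<in> I" if s: "s \<in> S" for s
      proof -
        have "g s = (\<Sum>s1\<in>S. f s1 * w s1 * (\<Prod>s'\<in>S - {s1}. s - s'))"
          by (simp add: g_def sum_fun_apply prod_fun_apply id)
        also have "\<dots> = f s * w s * (\<Prod>s'\<in>S - {s}. s - s')
            + (\<Sum>s1\<in>S - {s}. f s1 * w s1 * (\<Prod>s'\<in>S - {s1}. s - s'))"
          using fS s by (subst sum.remove[of _ s]) auto
        also have "(\<Sum>s1\<in>S - {s}. f s1 * w s1 * (\<Prod>s'\<in>S - {s1}. s - s')) = 0"
        proof (rule sum.neutral, rule ballI)
          fix s1 assume "s1 \<in> S - {s}"
          then have "s \<in> S - {s1}" using s by auto
          then have "(\<Prod>s'\<in>S - {s1}. s - s') = 0" using fS by (intro prod_zero) auto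
          then show "f s1 * w s1 * (\<Prod>s'\<in>S - {s1}. s - s') = 0" by simp
        qed
        finally have "f s - g s = - (f s * (w s * (\<Prod>s'\<in>S - {s}. s - s') - 1))"
          by (simp add: algebra_simps)
        then show ?thesis using w[OF s] by (simp add: I_uminus I_mult)
      qed
      then show ?thesis by (auto simp: N_def)
    qed
    ultimately have "g + (f - g) \<in> modspan B" by (intro modspan_add) (auto intro: modspan_null)
    then show ?thesis by simp
  qed
  \<comment> \<open>Coefficients can be taken in \<open>Rep\<close>. A function on \<open>S\<close>
    with values in \<open>Rep\<close> is then recovered from its coefficients on \<open>B\<close>,
    and comparing the two numbers of functions compares \<open>card S\<close> with
    \<open>card B\<close>.\<close>
  have coeffs: "\<exists>c\<in>B \<rightarrow>\<^sub>E Rep. \<forall>s\<in>S. f s - (\<Sum>\<beta>\<in>B. c \<beta> * \<beta> s) \<in> I" for f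
  proof -
    have "\<exists>c. \<forall>s\<in>S. f s - (\<Sum>\<beta>\<in>B. c \<beta> * \<beta> s) \<in> I" using all[of f]
    proof induction
      case (modspan_null x)
      then show ?case by (intro exI[of _ "\<lambda>_. 0"]) (auto simp: N_def)
    next
      case (modspan_base x)
      then have "(\<Sum>\<beta>\<in>B. (if \<beta> = x then 1 else 0) * \<beta> s) = x s" for s
        using B by (simp add: if_distrib[of "\<lambda>c. c * _"] sum.delta cong: if_cong)
      then show ?case by (intro exI[of _ "\<lambda>\<beta>. if \<beta> = x then 1 else 0"]) (auto simp: I_zero)
    next
      case (modspan_add x y)
      then obtain c d where cd: "\<forall>s\<in>S. x s - (\<Sum>\<beta>\<in>B. c \<beta> * \<beta> s) \<in> I" "\<forall>s\<in>S. y s - (\<Sum>\<beta>\<in>B. d \<beta> * \<beta> s) \<in> I"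
        by auto
      show ?case
      proof (intro exI[of _ "\<lambda>\<beta>. c \<beta> + d \<beta>"] ballI)
        fix s assume "s \<in> S"
        then have "(x s - (\<Sum>\<beta>\<in>B. c \<beta> * \<beta> s)) + (y s - (\<Sum>\<beta>\<in>B. d \<beta> * \<beta> s)) \<in> I"
          using cd by (intro I_add) auto
        then show "(x + y) s - (\<Sum>\<beta>\<in>B. (c \<beta> + d \<beta>) * \<beta> s) \<in> I"
          by (simp add: algebra_simps sum.distrib)
      qed
    next
      case (modspan_scale x k)
      then obtain c e where c: "\<forall>s\<in>S. x s - (\<Sum>\<beta>\<in>B. c \<beta> * \<beta> s) \<in> I" "k = (\<lambda>_. e)"
        by (auto simp: K_def)
      show ?case
      proof (intro exI[of _ "\<lambda>\<beta>. e * c \<beta>"] ballI)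
        fix s assume "s \<in> S"
        then have "e * (x s - (\<Sum>\<beta>\<in>B. c \<beta> * \<beta> s)) \<in> I"
          using c by (intro I_mult) auto
        then show "(k * x) s - (\<Sum>\<beta>\<in>B. (e * c \<beta>) * \<beta> s) \<in> I"
          by (simp add: c algebra_simps sum_distrib_left)
      qed
    qed
    then obtain c where c: "\<forall>s\<in>S. f s - (\<Sum>\<beta>\<in>B. c \<beta> * \<beta> s) \<in> I" by blast
    show ?thesis
    proof (intro bexI[of _ "\<lambda>\<beta>\<in>B. rep (c \<beta>)"] ballI)
      fix s assume "s \<in> S"
      then have "(f s - (\<Sum>\<beta>\<in>B. c \<beta> * \<beta> s)) + (\<Sum>\<beta>\<in>B. \<beta> s * (c \<beta> - rep (c \<beta>))) \<in> I"
        using c by (intro I_add I_sum I_mult rep) auto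
      then show "f s - (\<Sum>\<beta>\<in>B. (\<lambda>\<beta>\<in>B. rep (c \<beta>)) \<beta> * \<beta> s) \<in> I"
        by (simp add: algebra_simps sum_subtractf)
    qed (auto simp: rep)
  qed
  then obtain C where C: "\<And>f. C f \<in> B \<rightarrow>\<^sub>E Rep" "\<And>f s. s \<in> S \<Longrightarrow> f s - (\<Sum>\<beta>\<in>B. C f \<beta> * \<beta> s) \<in> I"
    by metis
  have "inj_on C (S \<rightarrow>\<^sub>E Rep)"
  proof (rule inj_onI)
    fix f g assume fg: "f \<in> S \<rightarrow>\<^sub>E Rep" "g \<in> S \<rightarrow>\<^sub>E Rep" "C f = C g"
    show "f = g"
    proof (rule PiE_ext[OF fg(1,2)])
      fix s assume s: "s \<in> S"
      have "(f s - (\<Sum>\<beta>\<in>B. C f \<beta> * \<beta> s)) - (g s - (\<Sum>\<beta>\<in>B. C g \<beta> * \<beta> s)) \<in> I"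
        by (rule I_diff[OF C(2)[OF s] C(2)[OF s]])
      then show "f s = g s" using fg s by (intro Rep_unique) auto
    qed
  qed
  then have "card (S \<rightarrow>\<^sub>E Rep) \<le> card (B \<rightarrow>\<^sub>E Rep)"
    using C(1) B(1) finite_Rep by (intro card_inj_on_le[of C]) (auto intro: finite_PiE)
  then have "card Rep ^ card S \<le> card Rep ^ card B" using fS B by (simp add: card_PiE)
  then have "card S \<le> card B" using card_Rep_ge_2 by (simp add: power_le_imp_le_exp)
  then show ?thesis using B by simp
qed

end

section \<open>Finite fields as quotients of the integer polynomials\<close>

lemma det_cong_mod:
  fixes A B :: "int mat"
  assumes "A \<in> carrier_mat n n" "B \<in> carrier_mat n n"
    and "\<And>i j. i < n \<Longrightarrow> j < n \<Longrightarrow> [A $$ (i, j) = B $$ (i, j)] (mod m)"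
  shows "[Determinant.det A = Determinant.det B] (mod m)"
  unfolding det_def'[OF assms(1)] det_def'[OF assms(2)]
proof (intro cong_sum cong_mult cong_refl cong_prod)
  fix \<pi> i assume "\<pi> \<in> {p. p permutes {0..<n}}" "i \<in> {0..<n}"
  then show "[A $$ (i, \<pi> i) = B $$ (i, \<pi> i)] (mod m)"
    using permutes_in_image[of \<pi> "{0..<n}" i] by (intro assms(3)) auto
qed

lemma root_of_unity_int_span:
  fixes \<omega> :: complex
  assumes "\<omega> ^ N = 1" "N > 0"
  shows "\<exists>c :: nat \<Rightarrow> int. poly (map_poly of_int A) \<omega> = (\<Sum>j<N. of_int (c j) * \<omega> ^ j)"
proof (induction A)
  case 0
  show ?case by (intro exI[of _ "\<lambda>_. 0"]) simp
next
  case (pCons a A)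
  then obtain c :: "nat \<Rightarrow> int" where c: "poly (map_poly of_int A) \<omega> = (\<Sum>j<N. of_int (c j) * \<omega> ^ j)" by blast
  obtain M where N: "N = Suc M" using assms gr0_conv_Suc by blast
  define d where "d j = (if j = 0 then a + c M else c (j - 1))" for j
  have "poly (map_poly of_int (pCons a A)) \<omega> = of_int a + \<omega> * (\<Sum>j<N. of_int (c j) * \<omega> ^ j)"
    using c by (simp add: Polynomial.map_poly_pCons)
  also have "\<omega> * (\<Sum>j<N. of_int (c j) * \<omega> ^ j) = (\<Sum>j<M. of_int (c j) * \<omega> ^ Suc j) + of_int (c M) * \<omega> ^ N"
    unfolding N by (simp add: sum_distrib_left algebra_simps)
  also have "of_int a + \<dots> = (\<Sum>j<N. of_int (d j) * \<omega> ^ j)"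
    unfolding N sum.lessThan_Suc_shift using assms by (simp add: d_def N)
  finally show ?case by blast
qed

text \<open>The determinant trick: an inverse of \<open>p\<close> would act on the powers of
  \<omega> by an integer matrix \<open>C\<close>. Then \<open>1 - p * C\<close> kills the vector of
  these powers, although its determinant is 1 modulo \<open>p\<close>. This is what keeps the ideal
  generated by \<open>p\<close> proper.\<close>

lemma not_unit_of_nat_root_of_unity_ring:
  fixes \<omega> :: complex
  assumes \<omega>: "\<omega> ^ N = 1" "N > 0" and p: "p > 1"
  shows "of_nat p * poly (map_poly of_int A) \<omega> \<noteq> 1"
proof
  assume eq: "of_nat p * poly (map_poly of_int A) \<omega> = 1"
  have "\<exists>c :: nat \<Rightarrow> int. poly (map_poly of_int A) \<omega> * \<omega> ^ i = (\<Sum>j<N. of_int (c j) * \<omega> ^ j)" for i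
  proof -
    have "poly (map_poly of_int (A * Polynomial.monom 1 i)) \<omega> = poly (map_poly of_int A) \<omega> * \<omega> ^ i"
      by (simp add: of_int_poly_hom.hom_mult map_poly_monom poly_monom)
    then show ?thesis using root_of_unity_int_span[OF \<omega>, of "A * Polynomial.monom 1 i"] by simp
  qed
  then obtain C :: "nat \<Rightarrow> nat \<Rightarrow> int"
    where C: "\<And>i. poly (map_poly of_int A) \<omega> * \<omega> ^ i = (\<Sum>j<N. of_int (C i j) * \<omega> ^ j)" by metis
  define M where "M = mat N N (\<lambda>(i, j). (if i = j then 1 else 0) - int p * C i j)"
  define v where "v = vec N (\<lambda>j. \<omega> ^ j)"
  have M: "M \<in> carrier_mat N N" by (simp add: M_def)
  have "[Determinant.det M = Determinant.det (1\<^sub>m N)] (mod int p)"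
    by (rule det_cong_mod[OF M]) (auto simp: M_def cong_iff_dvd_diff)
  then have "Determinant.det M \<noteq> 0" using p by (auto simp: cong_def)
  moreover have "map_mat complex_of_int M *\<^sub>v v = 0\<^sub>v N"
  proof (rule eq_vecI)
    fix i assume i: "i < dim_vec (0\<^sub>v N)"
    then have "(map_mat complex_of_int M *\<^sub>v v) $ i
        = (\<Sum>j<N. of_int ((if i = j then 1 else 0) - int p * C i j) * \<omega> ^ j)"
      by (simp add: M_def v_def scalar_prod_def lessThan_atLeast0)
    also have "\<dots> = (\<Sum>j<N. (if i = j then \<omega> ^ j else 0)) - of_nat p * (\<Sum>j<N. of_int (C i j) * \<omega> ^ j)"
      unfolding sum_distrib_left sum_subtractf[symmetric] by (intro sum.cong) (auto simp: algebra_simps)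
    also have "\<dots> = \<omega> ^ i - of_nat p * (poly (map_poly of_int A) \<omega> * \<omega> ^ i)"
      using i by (simp add: C)
    also have "\<dots> = 0" using eq by (simp add: mult.assoc[symmetric])
    finally show "(map_mat complex_of_int M *\<^sub>v v) $ i = 0\<^sub>v N $ i" using i by simp
  qed (simp add: M_def)
  moreover have "v \<noteq> 0\<^sub>v N"
  proof
    assume "v = 0\<^sub>v N"
    then have "v $ 0 = 0\<^sub>v N $ 0" by simp
    then show False using \<omega> by (simp add: v_def)
  qed
  moreover have "v \<in> carrier_vec N" by (simp add: v_def)
  ultimately show False
    using det_0_iff_vec_prod_zero[of "map_mat complex_of_int M" N] M by (auto simp: of_int_hom.hom_det)
qed

lemma maximal_ideal_exists:
  fixes J :: "'r :: comm_ring_1 set"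
  assumes "ring_ideal J" "1 \<notin> J"
  shows "\<exists>I. ring_ideal I \<and> J \<subseteq> I \<and> 1 \<notin> I \<and> (\<forall>x. x \<notin> I \<longrightarrow> (\<exists>y. y * x - 1 \<in> I))"
proof -
  let ?A = "{I. ring_ideal I \<and> J \<subseteq> I \<and> 1 \<notin> I}"
  have "\<exists>M\<in>?A. \<forall>X\<in>?A. M \<subseteq> X \<longrightarrow> X = M"
  proof (rule subset_Zorn_nonempty)
    show "?A \<noteq> {}" using assms by blast
    fix C assume C: "C \<noteq> {}" "subset.chain ?A C"
    then have CA: "\<And>I. I \<in> C \<Longrightarrow> I \<in> ?A" unfolding subset.chain_def by blast
    have "ring_ideal (\<Union>C)"
    proof
      obtain I where "I \<in> C" using C by blast
      then show "0 \<in> \<Union>C" using CA[of I] ring_ideal.I_zero[of I] by auto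
    next
      fix x y assume "x \<in> \<Union>C"
      then obtain I where I: "I \<in> C" "x \<in> I" by blast
      then have "y * x \<in> I" using CA[OF I(1)] ring_ideal.I_mult[of I x y] by simp
      then show "y * x \<in> \<Union>C" using I by blast
    next
      fix x y assume "x \<in> \<Union>C" "y \<in> \<Union>C"
      then obtain I1 I2 where I: "I1 \<in> C" "I2 \<in> C" "x \<in> I1" "y \<in> I2" by blast
      then consider "I1 \<subseteq> I2" | "I2 \<subseteq> I1" using C(2) unfolding subset.chain_def by blast
      then obtain L where L: "L \<in> C" "x \<in> L" "y \<in> L" using I by cases auto
      then have "x + y \<in> L" using CA[OF L(1)] ring_ideal.I_add[of L x y] by simp
      then show "x + y \<in> \<Union>C" using L by blast
    qed
    moreover have "J \<subseteq> \<Union>C" "1 \<notin> \<Union>C" using C(1) CA by auto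
    ultimately show "\<Union>C \<in> ?A" by blast
  qed
  then obtain I where "I \<in> ?A" and max': "\<forall>X\<in>?A. I \<subseteq> X \<longrightarrow> X = I" by (elim bexE)
  then have I: "ring_ideal I" "J \<subseteq> I" "1 \<notin> I" by simp_all
  have max: "X = I" if "ring_ideal X" "J \<subseteq> X" "1 \<notin> X" "I \<subseteq> X" for X
    using bspec[OF max', of X] that by simp
  interpret ring_ideal I by fact
  have "\<exists>y. y * x - 1 \<in> I" if x: "x \<notin> I" for x
  proof -
    define X where "X = {i + y * x | i y. i \<in> I}"
    have XI: "i + y * x \<in> X" if "i \<in> I" for i y unfolding X_def using that by blast
    have IX: "I \<subseteq> X" using XI[of _ 0] by auto
    have xX: "x \<in> X" using XI[OF I_zero, of 1] by simp
    have "ring_ideal X"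
    proof
      show "0 \<in> X" using IX I_zero by blast
    next
      fix u v assume "u \<in> X" "v \<in> X"
      then obtain i y j z where "u = i + y * x" "v = j + z * x" "i \<in> I" "j \<in> I" by (auto simp: X_def)
      then have "u + v = (i + j) + (y + z) * x" "i + j \<in> I" by (auto simp: algebra_simps I_add)
      then show "u + v \<in> X" unfolding X_def by blast
    next
      fix u v assume "u \<in> X"
      then obtain i y where "u = i + y * x" "i \<in> I" by (auto simp: X_def)
      then have "v * u = v * i + (v * y) * x" "v * i \<in> I" by (simp_all add: distrib_left mult.assoc I_mult)
      then show "v * u \<in> X" unfolding X_def by blast
    qed
    then have "1 \<in> X" using max[of X] IX xX x I(2) by auto
    then obtain i y where "1 = i + y * x" "i \<in> I" by (auto simp: X_def)
    then have "y * x - 1 = - i" by (simp add: algebra_simps)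
    then have "y * x - 1 \<in> I" using I_uminus[OF \<open>i \<in> I\<close>] by simp
    then show ?thesis by blast
  qed
  then show ?thesis using I by blast
qed

lemma int_fermat_power: "prime p \<Longrightarrow> [c ^ (p ^ e) = c] (mod int p)"
proof (induction e)
  case (Suc e)
  define m where "m = nat (c mod int p)"
  have "p > 0" using Suc prime_gt_0_nat by blast
  then have m: "[c = int m] (mod int p)" by (simp add: m_def cong_def)
  have "[m ^ p = m] (mod p)"
  proof (cases "p dvd m")
    case True
    then have "p dvd m ^ p" using \<open>p > 0\<close> by (simp add: dvd_power_same dvd_trans dvd_power)
    then show ?thesis using True by (simp add: cong_def)
  next
    case False
    have "m ^ p = m ^ (p - 1) * m" using \<open>p > 0\<close> by (metis Suc_diff_1 power_Suc2)
    then show ?thesis using cong_mult[OF fermat_theorem[OF Suc.prems False] cong_refl[of m]] by simp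
  qed
  then have "[int m ^ p = int m] (mod int p)" by (simp flip: of_nat_power add: cong_int_iff)
  then have "[c ^ p = c] (mod int p)" using cong_trans[OF cong_pow[OF m] cong_trans[OF _ cong_sym[OF m]]]
    by blast
  moreover have "[(c ^ p ^ e) ^ p = c ^ p] (mod int p)" using Suc by (intro cong_pow) auto
  moreover have "c ^ p ^ Suc e = (c ^ p ^ e) ^ p" by (subst power_mult[symmetric]) (simp add: mult.commute)
  ultimately show ?case using cong_trans by simp
qed auto

lemma prod_roots_unity_poly:
  fixes N :: nat
  assumes "N > 0"
  defines "\<omega> \<equiv> cis (2 * pi / real N)"
  shows "(\<Prod>i<N. [:- (\<omega> ^ i), 1:]) = Polynomial.monom 1 N - 1"
proof -
  have pw: "\<omega> ^ i = cis (2 * pi * real i / real N)" for i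
    by (simp add: \<omega>_def Complex.DeMoivre mult_ac)
  have bij: "bij_betw (\<lambda>i. \<omega> ^ i) {..<N} {z. z ^ N = 1}"
    using Complex.bij_betw_roots_unity[OF assms(1)] by (simp add: pw)
  have card: "card {z :: complex. z ^ N = 1} = N" using assms by (simp add: Complex.card_roots_unity_eq)
  have deg: "degree (\<Prod>i<N. [:- (\<omega> ^ i), 1:]) = N"
    by (subst degree_prod_eq_sum_degree) auto
  have lead: "Polynomial.coeff (\<Prod>i<N. [:- (\<omega> ^ i), 1:]) N = 1"
    using lead_coeff_prod[of "\<lambda>i. [:- (\<omega> ^ i), 1:]" "{..<N}"] deg by simp
  show ?thesis
  proof (rule poly_eqI_degree_lead_coeff[where n = N and A = "{z. z ^ N = 1}"])
    show "degree (Polynomial.monom 1 N - 1 :: complex poly) \<le> N"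
      by (intro degree_diff_le) (auto simp: degree_monom_le)
    fix z assume "z \<in> {z :: complex. z ^ N = 1}"
    moreover from this obtain i where "i < N" "z = \<omega> ^ i"
      using bij by (auto simp: bij_betw_def image_iff set_eq_iff)
    ultimately show "poly (\<Prod>i<N. [:- (\<omega> ^ i), 1:]) z = poly (Polynomial.monom 1 N - 1) z"
      by (auto simp: poly_prod poly_monom prod_zero_iff)
  qed (use assms card deg lead in auto)
qed

text \<open>The derivative of the polynomial \<open>X ^ N - 1\<close> at 1. In the residue field the
  value \<open>N\<close> is -1, so no factor \<open>1 - X ^ i\<close> with \<open>0 < i < N\<close>
  can vanish there; this makes the powers of \<open>X\<close> distinct.\<close>

lemma prod_one_minus_roots_unity:
  fixes N :: nat
  assumes "N > 0"
  defines "\<omega> \<equiv> cis (2 * pi / real N)"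
  shows "(\<Prod>i\<in>{1..<N}. 1 - \<omega> ^ i) = of_nat N"
proof -
  have "{..<N} = insert 0 {1..<N}" using assms by auto
  then have "Polynomial.monom 1 N - 1 = [:- 1, 1:] * (\<Prod>i\<in>{1..<N}. [:- (\<omega> ^ i), 1:])"
    using prod_roots_unity_poly[OF assms(1)] by (simp add: \<omega>_def)
  then have "poly (pderiv (Polynomial.monom 1 N - 1)) 1
      = poly (pderiv ([:- 1, 1:] * (\<Prod>i\<in>{1..<N}. [:- (\<omega> ^ i), 1:]))) 1"
    by simp
  then show ?thesis
    by (simp add: pderiv_diff pderiv_monom poly_monom pderiv_mult pderiv_pCons poly_prod)
qed

text \<open>The ideal is a maximal one containing \<open>p\<close> and the kernel of evaluation at a primitive \<open>N\<close>-th root of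
  unity. As \<open>N\<close> is prime to \<open>p\<close>, the powers of that root stay distinct in the quotient.\<close>
theorem residue_field_prime_power:
  assumes p: "prime p" and f: "f > 0" and N: "N = p ^ f - 1"
  shows "\<exists>I :: int poly set. residue_field I (insert 0 ((^) [:0, 1:] ` {..<N}))
    \<and> of_nat p \<in> I \<and> [:0, 1:] ^ N - 1 \<in> I"
proof -
  define X :: "int poly" where "X = [:0, 1:]"
  have p1: "p > 1" using p prime_gt_1_nat by blast
  have "p ^ f > 1" using one_less_power[OF p1 f] .
  then have N0: "N > 0" and pfN: "p ^ f = Suc N" using N by auto
  define \<omega> where "\<omega> = cis (2 * pi / real N)"
  have \<omega>: "\<omega> ^ N = 1" using N0 by (simp add: \<omega>_def Complex.DeMoivre)
  define ev :: "int poly \<Rightarrow> complex" where "ev A = poly (map_poly of_int A) \<omega>" for A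
  interpret ev: comm_ring_hom ev
    by standard (auto simp: ev_def of_int_poly_hom.hom_add of_int_poly_hom.hom_mult)
  have evX: "ev X = \<omega>" by (simp add: ev_def X_def Polynomial.map_poly_pCons)
  \<comment> \<open>The preimage of \<open>p\<close> times the ring generated by \<omega>; it
    contains both \<open>p\<close> and the kernel of \<open>ev\<close>.\<close>
  define J where "J = {A. \<exists>B. ev A = of_nat p * ev B}"
  have "ring_ideal J"
  proof
    show "0 \<in> J" by (auto simp: J_def intro: exI[of _ 0])
  next
    fix x y assume "x \<in> J" "y \<in> J"
    then obtain A B where "ev x = of_nat p * ev A" "ev y = of_nat p * ev B" by (auto simp: J_def)
    then have "ev (x + y) = of_nat p * ev (A + B)" by (simp add: ev.hom_add distrib_left)
    then show "x + y \<in> J" unfolding J_def by blast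
  next
    fix x y assume "x \<in> J"
    then obtain A where "ev x = of_nat p * ev A" by (auto simp: J_def)
    then have "ev (y * x) = of_nat p * ev (y * A)" by (simp add: ev.hom_mult)
    then show "y * x \<in> J" unfolding J_def by blast
  qed
  moreover have "1 \<notin> J"
  proof
    assume "1 \<in> J"
    then obtain B where "1 = of_nat p * ev B" by (auto simp: J_def)
    then show False using not_unit_of_nat_root_of_unity_ring[OF \<omega> N0 p1, of B] by (simp add: ev_def)
  qed
  ultimately obtain I where I: "ring_ideal I" "J \<subseteq> I" "1 \<notin> I" "\<And>x. x \<notin> I \<Longrightarrow> \<exists>y. y * x - 1 \<in> I"
    using maximal_ideal_exists by blast
  interpret ring_ideal I by fact
  have kerI: "A \<in> I" if "ev A = 0" for A
  proof -
    have "A \<in> J" using that unfolding J_def by (auto intro!: exI[of _ 0])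
    then show ?thesis using I(2) by blast
  qed
  have prime: "x \<in> I \<or> y \<in> I" if "x * y \<in> I" for x y
  proof (rule ccontr)
    assume xy: "\<not> (x \<in> I \<or> y \<in> I)"
    then obtain z where z: "z * x - 1 \<in> I" using I(4) by auto
    have "z * (x * y) - y * (z * x - 1) \<in> I"
      using I_diff[OF I_mult[OF that] I_mult[OF z]] by blast
    then show False using xy by (simp add: algebra_simps)
  qed
  have primeprod: "(\<exists>i\<in>A. g i \<in> I)" if "finite A" "prod g A \<in> I" for g :: "nat \<Rightarrow> int poly" and A
    using that
  proof (induction A rule: finite_induct)
    case (insert i A)
    then show ?case using prime[of "g i" "prod g A"] by auto
  qed (use I(3) in auto)
  have pI: "of_nat p \<in> I"
  proof -
    have "of_nat p \<in> J" unfolding J_def by (auto intro!: exI[of _ 1] simp: ev.hom_of_nat)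
    then show ?thesis using I(2) by blast
  qed
  have XN: "X ^ N - 1 \<in> I" by (rule kerI) (simp add: ev.hom_minus ev.hom_power evX \<omega>)
  have NI: "of_nat N \<notin> I"
  proof
    assume "of_nat N \<in> I"
    then have "of_nat p ^ (f - 1) * of_nat p - of_nat N \<in> I" using I_diff[OF I_mult[OF pI]] by blast
    moreover have "(of_nat p :: int poly) ^ (f - 1) * of_nat p = of_nat (p ^ f)"
      using power_minus_mult[OF f, of "of_nat p :: int poly"] by simp
    ultimately show False using I(3) by (simp add: pfN)
  qed
  have XI: "X ^ i \<notin> I" for i
  proof
    assume "X ^ i \<in> I"
    then have "X \<in> I"
    proof (induction i)
      case (Suc i)
      then show ?case using prime[of X "X ^ i"] by auto
    qed (use I(3) in auto)
    then have "X ^ (N - 1) * X - (X ^ N - 1) \<in> I" using I_diff[OF I_mult XN] by blast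
    moreover have "X ^ (N - 1) * X = X ^ N" using N0 by (rule power_minus_mult)
    ultimately show False using I(3) by simp
  qed
  have oneX: "1 - X ^ i \<notin> I" if i: "i \<in> {1..<N}" for i
  proof
    assume a: "1 - X ^ i \<in> I"
    have "(\<Prod>i\<in>{1..<N}. 1 - X ^ i) = (\<Prod>i\<in>{1..<N} - {i}. 1 - X ^ i) * (1 - X ^ i)"
      using i by (subst prod.remove[of _ i]) (auto simp: mult.commute)
    then have 1: "(\<Prod>i\<in>{1..<N}. 1 - X ^ i) \<in> I" using a I_mult by simp
    have 2: "(\<Prod>i\<in>{1..<N}. 1 - X ^ i) - of_nat N \<in> I"
      using prod_one_minus_roots_unity[OF N0]
      by (intro kerI) (simp add: ev.hom_minus ev.hom_prod ev.hom_power evX \<omega>_def ev.hom_of_nat)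
    show False using I_diff[OF 1 2] NI by simp
  qed
  have dist: "i = j" if "i < N" "j < N" "X ^ i - X ^ j \<in> I" for i j
    using that
  proof (induction i j rule: linorder_wlog)
    case (le i j)
    show ?case
    proof (rule ccontr)
      assume "i \<noteq> j"
      have "X ^ j = X ^ i * X ^ (j - i)" using le by (simp flip: power_add)
      then have "X ^ i * (1 - X ^ (j - i)) \<in> I" using le by (simp add: algebra_simps)
      then have "1 - X ^ (j - i) \<in> I" using prime[of "X ^ i" "1 - X ^ (j - i)"] XI by blast
      moreover have "j - i \<in> {1..<N}" using le \<open>i \<noteq> j\<close> by auto
      ultimately show False using oneX by blast
    qed
  next
    case (sym i j)
    then show ?case using I_uminus[of "X ^ i - X ^ j"] by simp
  qed
  \<comment> \<open>Raising to the power \<open>p ^ f\<close> is additive modulo \<open>p\<close>,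
    so it suffices to look at the integer coefficients, where Fermat's theorem applies, and at
    \<open>X\<close>, where \<open>X ^ N\<close> is 1.\<close>
  have frob: "y ^ (p ^ f) - y \<in> I" for y
  proof (induction y)
    case 0
    then show ?case using p1 I_zero by (simp add: pfN)
  next
    case (pCons c y)
    have split: "pCons c y = of_int c + X * y" by (simp add: X_def of_int_poly)
    have "int p dvd c ^ (p ^ f) - c" using int_fermat_power[OF p] by (simp add: cong_iff_dvd_diff)
    then obtain d where "c ^ (p ^ f) - c = int p * d" by blast
    then have "(of_int (c ^ (p ^ f) - c) :: int poly) = of_int (int p * d)" by (rule arg_cong)
    then have "of_int c ^ (p ^ f) - of_int c = of_int d * (of_nat p :: int poly)"
      by (simp only: of_int_power of_int_diff of_int_of_nat_eq of_int_mult mult.commute)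
    then have 1: "of_int c ^ (p ^ f) - (of_int c :: int poly) \<in> I" using pI I_mult by simp
    have 2: "X ^ (p ^ f) * (y ^ (p ^ f) - y) \<in> I" using pCons by (intro I_mult)
    have 3: "(X * y) * (X ^ N - 1) \<in> I" using XN by (intro I_mult)
    have 4: "(of_int c + X * y) ^ (p ^ f) - (of_int c ^ (p ^ f) + (X * y) ^ (p ^ f)) \<in> I"
      by (rule frobenius_add[OF p pI])
    have "((of_int c + X * y) ^ (p ^ f) - (of_int c ^ (p ^ f) + (X * y) ^ (p ^ f)))
       + (of_int c ^ (p ^ f) - of_int c) + X ^ (p ^ f) * (y ^ (p ^ f) - y) + (X * y) * (X ^ N - 1) \<in> I"
      by (intro I_add 1 2 3 4)
    also have "((of_int c + X * y) ^ (p ^ f) - (of_int c ^ (p ^ f) + (X * y) ^ (p ^ f)))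
       + (of_int c ^ (p ^ f) - of_int c) + X ^ (p ^ f) * (y ^ (p ^ f) - y) + (X * y) * (X ^ N - 1)
       = (of_int c + X * y) ^ (p ^ f) - (of_int c + X * y)"
      by (simp add: algebra_simps power_mult_distrib pfN)
    finally show ?case by (simp only: split)
  qed
  \<comment> \<open>The factorisation of \<open>Y ^ N - 1\<close> is known over the complex numbers.
    The coefficients of the defect \<open>G\<close> therefore lie in the kernel of
    \<open>ev\<close>, hence in the ideal, and every unit, being a root of \<open>Y ^ N - 1\<close>,
    is congruent to a power of \<open>X\<close>.\<close>
  define G :: "int poly poly" where "G = (\<Prod>i<N. [:- (X ^ i), 1:]) - (Polynomial.monom 1 N - 1)"
  have evG: "ev (Polynomial.coeff G k) = 0" for k
  proof -
    interpret evp: map_poly_comm_ring_hom ev ..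
    have "map_poly ev G = (\<Prod>i<N. [:- (\<omega> ^ i), 1:]) - (Polynomial.monom 1 N - 1)"
      by (simp add: G_def evp.hom_minus evp.hom_prod map_poly_monom Polynomial.map_poly_pCons ev.hom_uminus
          ev.hom_power evX)
    also have "\<dots> = 0" using prod_roots_unity_poly[OF N0] by (simp add: \<omega>_def)
    finally show ?thesis by (metis coeff_0 coeff_map_poly ev.hom_zero)
  qed
  have ex: "\<exists>i<N. y - X ^ i \<in> I" if y: "y \<notin> I" for y
  proof -
    have "poly G y = (\<Sum>k\<le>degree G. y ^ k * Polynomial.coeff G k)" by (simp add: poly_altdef mult.commute)
    also have "\<dots> \<in> I" by (intro I_sum I_mult kerI evG)
    finally have "(\<Prod>i<N. y - X ^ i) - (y ^ N - 1) \<in> I"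
      by (simp add: G_def poly_prod poly_monom)
    moreover have "y * (y ^ N - 1) \<in> I" using frob[of y] by (simp add: pfN algebra_simps)
    then have "y ^ N - 1 \<in> I" using prime[of y "y ^ N - 1"] y by blast
    ultimately have "(\<Prod>i<N. y - X ^ i) - (y ^ N - 1) + (y ^ N - 1) \<in> I" by (rule I_add)
    then have "(\<Prod>i<N. y - X ^ i) \<in> I" by simp
    then show ?thesis using primeprod[of "{..<N}"] by auto
  qed
  have "residue_field I (insert 0 ((^) X ` {..<N}))"
  proof
    fix x
    show "\<exists>!y. y \<in> insert 0 ((^) X ` {..<N}) \<and> x - y \<in> I"
    proof (cases "x \<in> I")
      case True
      have "y = 0" if "y \<in> insert 0 ((^) X ` {..<N})" "x - y \<in> I" for y
      proof -
        have "y \<in> I" using I_diff[OF True that(2)] by simp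
        then show ?thesis using that(1) XI by auto
      qed
      then show ?thesis using True by (intro ex1I[of _ 0]) auto
    next
      case False
      then obtain i where i: "i < N" "x - X ^ i \<in> I" using ex by blast
      show ?thesis
      proof (rule ex1I[of _ "X ^ i"])
        fix y assume y: "y \<in> insert 0 ((^) X ` {..<N}) \<and> x - y \<in> I"
        then obtain j where j: "j < N" "y = X ^ j" using False by auto
        have "x - X ^ j \<in> I" using y j by simp
        then have "(x - X ^ j) - (x - X ^ i) \<in> I" by (rule I_diff[OF _ i(2)])
        then show "y = X ^ i" using dist[of i j] i j by auto
      qed (use i in auto)
    qed
  qed (use I in auto)
  then show ?thesis using pI XN by (auto simp: X_def)
qed

section \<open>Projective norm graphs\<close>

text \<open>In terms of exponents this counts the field elements of prescribed norm: there is at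
  most one in each block of \<open>M\<close> consecutive exponents.\<close>

lemma card_residue_class_le:
  assumes "N = M * m" "M > 0"
  shows "card {i. i < N \<and> [i + c = d] (mod M)} \<le> (m :: nat)"
proof -
  have "inj_on (\<lambda>i. i div M) {i. i < N \<and> [i + c = d] (mod M)}"
  proof (rule inj_onI)
    fix i j assume ij: "i \<in> {i. i < N \<and> [i + c = d] (mod M)}" "j \<in> {i. i < N \<and> [i + c = d] (mod M)}"
      "i div M = j div M"
    then have "[i + c = j + c] (mod M)" using cong_trans cong_sym by blast
    then have "[i = j] (mod M)" by (simp only: cong_add_rcancel_nat)
    then have "i mod M = j mod M" by (simp add: cong_def)
    then show "i = j" using ij(3) by (metis div_mult_mod_eq)
  qed
  moreover have "(\<lambda>i. i div M) ` {i. i < N \<and> [i + c = d] (mod M)} \<subseteq> {..<m}"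
    using assms by (auto simp: less_mult_imp_div_less mult.commute)
  ultimately show ?thesis using card_inj_on_le[of _ _ "{..<m}"] by auto
qed

text \<open>\<open>X\<close> generates the multiplicative group of the field of order
  \<open>q ^ k\<close>. Its order factors as \<open>N = M * m\<close>, where \<open>M\<close> is the
  number of units of the subfield of order \<open>q\<close> and \<open>m\<close> is the exponent of
  the norm map.\<close>

locale norm_field = residue_field I Rep for I Rep :: "'r :: comm_ring_1 set" +
  fixes X :: 'r and p e k q N M m :: nat
  assumes p: "prime p" and q: "q = p ^ e" and e: "e > 0" and k: "k > 0" and N: "N = q ^ k - 1"
    and M: "M = q - 1" and m: "m = (\<Sum>j<k. q ^ j)"
    and Rep: "Rep = insert 0 ((^) X ` {..<N})" and X_inj: "inj_on ((^) X) {..<N}"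
    and X_nz: "\<And>i. X ^ i \<noteq> 0" and X_ord: "X ^ N - 1 \<in> I" and p_I: "of_nat p \<in> I"
begin

lemma q_ge_2: "q \<ge> 2"
  using one_less_power[OF prime_gt_1_nat[OF p] e] q by simp

lemma M_pos: "M > 0" using q_ge_2 M by simp

lemma N_eq: "N = M * m"
proof -
  have "(\<Sum>j<k. int q ^ j) * (int q - 1) = int q ^ k - 1"
    by (simp add: power_diff_1_eq mult.commute)
  then have "int (M * m) = int N"
    using q_ge_2 by (simp add: M m N of_nat_diff mult.commute)
  then show ?thesis by (metis of_nat_eq_iff)
qed

lemma qk: "q ^ k = Suc N" using q_ge_2 by (simp add: N)

lemma N_pos: "N > 0"
  using N one_less_power[of q k] q_ge_2 k by simp

lemma card_Rep: "card Rep = q ^ k"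
proof -
  have "0 \<notin> (^) X ` {..<N}" using X_nz by force
  then show ?thesis unfolding Rep qk using X_inj by (simp add: card_image)
qed

lemma X_notin: "X ^ i \<notin> I"
proof -
  have "X \<notin> I"
  proof
    assume "X \<in> I"
    then have "X ^ (N - 1) * X - (X ^ N - 1) \<in> I" using I_diff[OF I_mult X_ord] by blast
    then show False using power_minus_mult[OF N_pos, of X] I_proper by simp
  qed
  then show ?thesis
  proof (induction i)
    case (Suc i)
    then show ?case using I_prime[of X "X ^ i"] by auto
  qed (simp add: I_proper)
qed

lemma X_power_mod: "X ^ i - X ^ (i mod N) \<in> I"
proof -
  have "(X ^ N) ^ (i div N) - 1 ^ (i div N) \<in> I" by (rule I_power_diff[OF X_ord])
  then have "X ^ (i mod N) * ((X ^ N) ^ (i div N) - 1) \<in> I" by (simp add: I_mult)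
  also have "X ^ (i mod N) * ((X ^ N) ^ (i div N) - 1) = X ^ (i mod N + N * (i div N)) - X ^ (i mod N)"
    unfolding power_add power_mult by (simp add: algebra_simps)
  finally show ?thesis by simp
qed

lemma X_power_cong: "X ^ i - X ^ j \<in> I \<longleftrightarrow> [i = j] (mod N)"
proof
  assume a: "X ^ i - X ^ j \<in> I"
  have "(X ^ i - X ^ j) - (X ^ i - X ^ (i mod N)) + (X ^ j - X ^ (j mod N)) \<in> I"
    using I_add[OF I_diff[OF a X_power_mod] X_power_mod] .
  then have "X ^ (i mod N) - X ^ (j mod N) \<in> I" by simp
  then have "X ^ (i mod N) = X ^ (j mod N)" using N_pos by (intro Rep_unique) (auto simp: Rep)
  then show "[i = j] (mod N)" using N_pos inj_onD[OF X_inj, of "i mod N" "j mod N"] by (simp add: cong_def)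
next
  assume "[i = j] (mod N)"
  then have "i mod N = j mod N" by (simp add: cong_def)
  moreover have "(X ^ i - X ^ (i mod N)) - (X ^ j - X ^ (j mod N)) \<in> I"
    by (rule I_diff[OF X_power_mod X_power_mod])
  ultimately show "X ^ i - X ^ j \<in> I" by simp
qed

definition ind :: "'r \<Rightarrow> nat" where "ind y = (SOME i. i < N \<and> y - X ^ i \<in> I)"

lemma ind: assumes "y \<notin> I" shows "ind y < N" "y - X ^ ind y \<in> I"
proof -
  have "rep y \<noteq> 0" using rep[of y] assms by auto
  then have "\<exists>i<N. y - X ^ i \<in> I" using rep[of y] by (auto simp: Rep)
  then show "ind y < N" "y - X ^ ind y \<in> I" unfolding ind_def by (metis (mono_tags, lifting) someI_ex)+
qed

lemma ind_unique: assumes "y - X ^ i \<in> I" shows "y \<notin> I" "[ind y = i] (mod N)"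
proof -
  show y: "y \<notin> I" using I_diff[of y "y - X ^ i"] assms X_notin by auto
  have "(y - X ^ i) - (y - X ^ ind y) \<in> I" by (rule I_diff[OF assms ind(2)[OF y]])
  then have "X ^ ind y - X ^ i \<in> I" by simp
  then show "[ind y = i] (mod N)" by (simp add: X_power_cong)
qed

lemma I_cong_mult: "x - x' \<in> I \<Longrightarrow> y - y' \<in> I \<Longrightarrow> x * y - x' * y' \<in> I"
  using I_add[OF I_mult[of "x - x'" y] I_mult[of "y - y'" x']] by (simp add: algebra_simps)

lemma I_cong_trans: "x - y \<in> I \<Longrightarrow> y - z \<in> I \<Longrightarrow> x - z \<in> I"
  using I_add[of "x - y" "y - z"] by simp

lemma I_cong_sym: "x - y \<in> I \<Longrightarrow> y - x \<in> I"
  using I_uminus[of "x - y"] by simp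

lemma notin_cong: "x - y \<in> I \<Longrightarrow> x \<notin> I \<Longrightarrow> y \<notin> I"
  using I_add[of "x - y" y] by auto

lemma notin_mult: "x \<notin> I \<Longrightarrow> y \<notin> I \<Longrightarrow> x * y \<notin> I"
  using I_prime by blast

lemma ind_mult: "x \<notin> I \<Longrightarrow> y \<notin> I \<Longrightarrow> [ind (x * y) = ind x + ind y] (mod M)"
proof -
  assume "x \<notin> I" "y \<notin> I"
  then have "x * y - X ^ ind x * X ^ ind y \<in> I" by (intro I_cong_mult ind)
  then have "[ind (x * y) = ind x + ind y] (mod N)" by (intro ind_unique) (simp add: power_add)
  then show ?thesis by (rule cong_dvd_modulus_nat) (simp add: N_eq)
qed

lemma ind_cong: "x \<notin> I \<Longrightarrow> x - y \<in> I \<Longrightarrow> [ind x = ind y] (mod M)"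
proof -
  assume "x \<notin> I" "x - y \<in> I"
  then have "x - X ^ ind y \<in> I" using I_cong_trans ind(2) notin_cong by blast
  then have "[ind x = ind y] (mod N)" by (rule ind_unique)
  then show ?thesis by (rule cong_dvd_modulus_nat) (simp add: N_eq)
qed

text \<open>The exponent \<open>m\<close> is that of the norm to the subfield of order \<open>q\<close>, so \<open>ind\<close> modulo \<open>q - 1\<close>
  is the discrete logarithm of the norm.\<close>
lemma norm_power:
  assumes "x \<notin> I" "[ind x = d] (mod M)"
  shows "x ^ m - X ^ (m * d) \<in> I"
proof -
  have "x ^ m - (X ^ ind x) ^ m \<in> I" by (rule I_power_diff[OF ind(2)[OF assms(1)]])
  moreover have "[ind x * m = d * m] (mod (M * m))"
    using assms(2) by (simp add: cong_def mod_mult_mult2 mult.commute)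
  then have "X ^ (ind x * m) - X ^ (m * d) \<in> I" by (simp add: X_power_cong N_eq mult.commute)
  ultimately show ?thesis using I_cong_trans by (simp add: power_mult)
qed

lemma power_qk: "y ^ (q ^ k) - y \<in> I"
proof (cases "y \<in> I")
  case True
  have "y ^ (q ^ k) - 0 ^ (q ^ k) \<in> I" by (rule I_power_diff) (use True in simp)
  then show ?thesis using True I_diff q_ge_2 k by (simp add: qk)
next
  case False
  have "y ^ N - (X ^ ind y) ^ N \<in> I" by (rule I_power_diff[OF ind(2)[OF False]])
  moreover have "(X ^ ind y) ^ N - 1 \<in> I"
    using X_power_cong[of "ind y * N" 0] by (simp add: power_mult cong_def)
  ultimately have "y ^ N - 1 \<in> I" by (rule I_cong_trans)
  then have "y * (y ^ N - 1) \<in> I" by (rule I_mult)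
  then show ?thesis by (simp add: qk algebra_simps)
qed

text \<open>The further power \<open>q ^ (k - j)\<close> completes the map to the identity
  \<open>power_qk\<close>.\<close>

lemma frobenius_inj: "x ^ (q ^ j) - y ^ (q ^ j) \<in> I \<Longrightarrow> j \<le> k \<Longrightarrow> x - y \<in> I"
proof -
  assume a: "x ^ (q ^ j) - y ^ (q ^ j) \<in> I" "j \<le> k"
  have "(x ^ (q ^ j)) ^ (q ^ (k - j)) - (y ^ (q ^ j)) ^ (q ^ (k - j)) \<in> I"
    by (rule I_power_diff[OF a(1)])
  moreover have "q ^ j * q ^ (k - j) = q ^ k" using a(2) by (simp flip: power_add)
  ultimately have "x ^ (q ^ k) - y ^ (q ^ k) \<in> I" by (simp flip: power_mult)
  then show ?thesis using I_cong_trans[OF I_cong_trans[OF I_cong_sym[OF power_qk]] power_qk] by blast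
qed

text \<open>The norm is the product of the \<open>k\<close> conjugates, and conjugation is
  additive.\<close>

lemma norm_prod: "(x + c) ^ m - (\<Prod>j<k. x ^ (q ^ j) + c ^ (q ^ j)) \<in> I"
  unfolding m power_sum
proof (induction k)
  case (Suc k)
  have "(x + c) ^ (q ^ k) - (x ^ (q ^ k) + c ^ (q ^ k)) \<in> I"
    using frobenius_add[OF p p_I, of x c "e * k"] by (simp add: q power_mult)
  then show ?case using I_cong_mult[OF Suc] by simp
qed (simp add: I_zero)

text \<open>The conjugates \<open>x ^ (q ^ j)\<close> serve as the functions
  \<open>\<phi> j\<close>. Each norm equation is then a product of linear forms, and the constants
  of a column stay distinct because conjugation is injective.\<close>

lemma card_norm_system:
  assumes "\<And>i i'. i < k \<Longrightarrow> i' < k \<Longrightarrow> i \<noteq> i' \<Longrightarrow> c i - c i' \<notin> I"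
    and "S \<subseteq> Rep" "\<And>i s. i < k \<Longrightarrow> s \<in> S \<Longrightarrow> s + c i \<notin> I \<and> [ind (s + c i) = d i] (mod M)"
  shows "card S \<le> fact k"
proof (rule card_product_system_solutions[where \<phi> = "\<lambda>j x. x ^ (q ^ j)" and a = "\<lambda>i j. - (c i ^ (q ^ j))"
      and b = "\<lambda>i. X ^ (m * d i)"])
  fix i i' j assume "i < k" "i' < k" "i \<noteq> i'" "j < k"
  then show "- (c i ^ q ^ j) - - (c i' ^ q ^ j) \<notin> I"
    using frobenius_inj[of "c i'" j "c i"] assms(1)[of i' i] by auto
next
  fix i s assume "i < k" "s \<in> S"
  then have "(s + c i) ^ m - X ^ (m * d i) \<in> I" using assms(3) by (intro norm_power) auto
  then show "(\<Prod>j<k. s ^ q ^ j - - (c i ^ q ^ j)) - X ^ (m * d i) \<in> I"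
    using I_cong_trans[OF I_cong_sym[OF norm_prod]] by simp
qed (use k assms(2) in auto)

definition V :: "('r \<times> nat) set" where "V = Rep \<times> {..<M}"

text \<open>The classical rule \<open>norm (A + B) = a * b\<close>, with the second coordinates
  written as exponents so that the product becomes a sum modulo \<open>M\<close>. Loops can occur
  and are included in the degrees below.\<close>

definition adj :: "'r \<times> nat \<Rightarrow> 'r \<times> nat \<Rightarrow> bool" where
  "adj u v \<longleftrightarrow> fst u + fst v \<notin> I \<and> [ind (fst u + fst v) = snd u + snd v] (mod M)"

lemma finite_V: "finite V" using finite_Rep by (simp add: V_def)

lemma card_V: "card V = q ^ k * (q - 1)" unfolding V_def by (simp add: card_cartesian_product card_Rep M)

lemma adj_sym: "adj u v \<longleftrightarrow> adj v u" by (simp add: adj_def add.commute)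

lemma adj_snd_unique:
  assumes "adj u v" "adj u w" "fst v = fst w" "snd v < M" "snd w < M"
  shows "v = w"
proof -
  have "[snd u + snd v = snd u + snd w] (mod M)"
    using assms unfolding adj_def by (metis cong_sym cong_trans)
  then have "snd v = snd w" using assms by (simp add: cong_add_lcancel_nat cong_less_modulus_unique_nat)
  then show ?thesis using assms(3) by (simp add: prod_eq_iff)
qed

lemma inj_on_fst_nbrs: "inj_on fst {v \<in> V. adj u v}"
  using adj_snd_unique[of u] by (auto simp: inj_on_def V_def)

text \<open>Every first coordinate except the negative of \<open>fst u\<close> admits exactly one
  second coordinate.\<close>

lemma degree_eq: "u \<in> V \<Longrightarrow> card {v \<in> V. adj u v} = q ^ k - 1"
proof -
  assume "u \<in> V"
  have "fst ` {v \<in> V. adj u v} = Rep - {rep (- fst u)}"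
  proof (intro equalityI subsetI)
    fix B assume "B \<in> fst ` {v \<in> V. adj u v}"
    then have B: "B \<in> Rep" "fst u + B \<notin> I" by (auto simp: V_def adj_def)
    have "B \<noteq> rep (- fst u)"
    proof
      assume "B = rep (- fst u)"
      then have "- (- fst u - B) \<in> I" using rep(2)[of "- fst u"] by (intro I_uminus) simp
      then show False using B by (simp add: add.commute)
    qed
    then show "B \<in> Rep - {rep (- fst u)}" using B by simp
  next
    fix B assume B: "B \<in> Rep - {rep (- fst u)}"
    have nI: "fst u + B \<notin> I"
    proof
      assume "fst u + B \<in> I"
      then have "(- fst u - rep (- fst u)) + (fst u + B) \<in> I" by (rule I_add[OF rep(2)])
      then have "B - rep (- fst u) \<in> I" by simp
      then show False using B rep(1) Rep_unique by blast
    qed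
    define y where "y = (ind (fst u + B) + (M - snd u mod M)) mod M"
    have "[snd u + (ind (fst u + B) + (M - snd u mod M)) = ind (fst u + B)] (mod M)"
    proof -
      have "snd u + (M - snd u mod M) = M * (snd u div M) + M"
        using M_pos mod_less_divisor[of M "snd u"] mult_div_mod_eq[of M "snd u"] by linarith
      then have "[snd u + (M - snd u mod M) = 0] (mod M)" by (simp add: cong_def)
      then have "[ind (fst u + B) + (snd u + (M - snd u mod M)) = ind (fst u + B) + 0] (mod M)"
        by (intro cong_add) auto
      then show ?thesis by (simp add: add_ac)
    qed
    then have "[ind (fst u + B) = snd u + y] (mod M)"
      unfolding y_def by (simp add: cong_def mod_add_right_eq)
    then have "adj u (B, y)" "(B, y) \<in> V" using nI B M_pos by (auto simp: adj_def V_def y_def)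
    then show "B \<in> fst ` {v \<in> V. adj u v}" by force
  qed
  then have "card {v \<in> V. adj u v} = card (Rep - {rep (- fst u)})"
    using card_image[OF inj_on_fst_nbrs[of u]] by simp
  then show ?thesis using rep(1) card_Rep finite_Rep by simp
qed

definition inv_el :: "'r \<Rightarrow> 'r" where "inv_el x = (SOME y. y * x - 1 \<in> I)"

lemma inv_el: assumes "x \<notin> I" shows "inv_el x * x - 1 \<in> I" "inv_el x \<notin> I"
proof -
  show 1: "inv_el x * x - 1 \<in> I" unfolding inv_el_def using someI_ex[OF I_inverse[OF assms]] .
  show "inv_el x \<notin> I" using I_diff[OF I_mult[of "inv_el x" x] 1] I_proper by (auto simp: mult.commute)
qed

text \<open>The quotient of the two sums is an injective Moebius function of the unknown first
  coordinate, and its norm is prescribed by the second coordinates of \<open>u\<close> and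
  \<open>u'\<close>.\<close>

lemma codegree_le:
  assumes u: "u \<in> V" "u' \<in> V" "u \<noteq> u'"
  shows "card {v \<in> V. adj u v \<and> adj u' v} \<le> m"
proof (cases "fst u = fst u'")
  case True
  have "\<not> (adj u v \<and> adj u' v)" for v
    using adj_snd_unique[of v u u'] adj_sym True u by (auto simp: V_def)
  then have "{v \<in> V. adj u v \<and> adj u' v} = {}" by blast
  then show ?thesis by (simp only: card.empty)
next
  case False
  then have ne: "fst u - fst u' \<notin> I" using u Rep_unique by (auto simp: V_def)
  define Z where "Z v = (fst u + fst v) * inv_el (fst u' + fst v)" for v :: "'r \<times> nat"
  let ?C = "{v \<in> V. adj u v \<and> adj u' v}"
  have Z: "Z v \<notin> I" "Z v * (fst u' + fst v) - (fst u + fst v) \<in> I" if "v \<in> ?C" for v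
  proof -
    have nI: "fst u + fst v \<notin> I" "fst u' + fst v \<notin> I" using that by (auto simp: adj_def)
    then show "Z v \<notin> I" unfolding Z_def using inv_el by (intro notin_mult) auto
    show "Z v * (fst u' + fst v) - (fst u + fst v) \<in> I"
      using I_mult[OF inv_el(1)[OF nI(2)], of "fst u + fst v"] by (simp add: Z_def algebra_simps)
  qed
  have "inj_on (\<lambda>v. ind (Z v)) ?C"
  proof (rule inj_onI)
    fix v w assume vw: "v \<in> ?C" "w \<in> ?C" "ind (Z v) = ind (Z w)"
    have ZZ: "Z v - Z w \<in> I"
      using I_cong_trans[OF ind(2)[OF Z(1)[OF vw(1)]] I_cong_sym[OF ind(2)[OF Z(1)[OF vw(2)], folded vw(3)]]] .
    define U U' x y where defs: "U = fst u" "U' = fst u'" "x = fst v" "y = fst w"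
    note Zv = Z(2)[OF vw(1), folded defs] and Zw = Z(2)[OF vw(2), folded defs]
    have "((U' + x) * (Z w * (U' + y) - (U + y)) - (U' + y) * (Z v * (U' + x) - (U + x)))
        + ((U' + x) * (U' + y)) * (Z v - Z w) \<in> I"
      by (rule I_add[OF I_diff[OF I_mult[OF Zw] I_mult[OF Zv]] I_mult[OF ZZ]])
    also have "((U' + x) * (Z w * (U' + y) - (U + y)) - (U' + y) * (Z v * (U' + x) - (U + x)))
        + ((U' + x) * (U' + y)) * (Z v - Z w) = (U - U') * (y - x)"
      by (simp add: algebra_simps)
    finally have "y - x \<in> I" using I_prime ne unfolding defs by blast
    then have "y = x" using vw(1,2) unfolding defs by (intro Rep_unique) (auto simp: V_def)
    then show "v = w" using adj_snd_unique[of u v w] vw unfolding defs by (auto simp: V_def)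
  qed
  moreover have "(\<lambda>v. ind (Z v)) ` ?C \<subseteq> {i. i < N \<and> [i + snd u' = snd u] (mod M)}"
  proof clarify
    fix B y assume v: "(B, y) \<in> V" "adj u (B, y)" "adj u' (B, y)"
    define v where "v = (B, y)"
    have v: "v \<in> ?C" using v by (simp add: v_def)
    have nI: "fst u' + fst v \<notin> I" using v by (auto simp: adj_def)
    have "[ind (Z v) + ind (fst u' + fst v) = ind (Z v * (fst u' + fst v))] (mod M)"
      using ind_mult[OF Z(1)[OF v] nI] cong_sym by blast
    also have "[ind (Z v * (fst u' + fst v)) = ind (fst u + fst v)] (mod M)"
      by (intro ind_cong Z(2) v notin_mult Z(1) nI)
    also have "[ind (fst u + fst v) = snd u + snd v] (mod M)" using v by (simp add: adj_def)
    finally have "[ind (Z v) + ind (fst u' + fst v) = snd u + snd v] (mod M)" .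
    moreover have "[ind (Z v) + ind (fst u' + fst v) = ind (Z v) + (snd u' + snd v)] (mod M)"
      using v by (intro cong_add) (auto simp: adj_def)
    ultimately have "[ind (Z v) + (snd u' + snd v) = snd u + snd v] (mod M)"
      using cong_trans[OF cong_sym] by blast
    then have "[(ind (Z v) + snd u') + snd v = snd u + snd v] (mod M)" by (simp only: add.assoc)
    then have "[ind (Z v) + snd u' = snd u] (mod M)" by (simp add: cong_add_rcancel_nat)
    then show "ind (Z (B, y)) < N \<and> [ind (Z (B, y)) + snd u' = snd u] (mod M)"
      using ind(1)[OF Z(1)[OF v]] by (simp add: v_def)
  qed
  ultimately have "card ?C \<le> card {i. i < N \<and> [i + snd u' = snd u] (mod M)}"
    by (intro card_inj_on_le) auto
  then show ?thesis using card_residue_class_le[OF N_eq M_pos, of "snd u'" "snd u"] by linarith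
qed

text \<open>The equation of each other vertex is divided by that of \<open>u 0\<close>. With
  \<open>h\<close> the inverse of the sum for \<open>u 0\<close>, the quotient of the sums is the
  difference of the first coordinates times \<open>h + c i\<close>, where \<open>c i\<close> is the
  inverse of that difference. This leaves \<open>k\<close> equations prescribing the norm of
  \<open>h + c i\<close>.\<close>

lemma common_nbrs_le:
  assumes A: "A \<subseteq> V" "card A = Suc k"
  shows "card {v \<in> V. \<forall>u\<in>A. adj u v} \<le> fact k"
proof (cases "{v \<in> V. \<forall>u\<in>A. adj u v} = {}")
  case True
  then show ?thesis by (simp only: card.empty)
next
  case False
  let ?C = "{v \<in> V. \<forall>u\<in>A. adj u v}"
  have fA: "finite A" using A finite_V finite_subset by blast
  obtain v0 where v0: "v0 \<in> ?C" using False by blast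
  \<comment> \<open>A common neighbour forces distinct first coordinates, which is why the case of
    no common neighbour was split off.\<close>
  have injA: "u = u'" if "u \<in> A" "u' \<in> A" "fst u = fst u'" for u u'
  proof (rule adj_snd_unique[of v0])
    show "adj v0 u" "adj v0 u'" using that v0 adj_sym by blast+
    show "snd u < M" "snd u' < M" using that A(1) by (auto simp: V_def)
  qed fact
  obtain u where u: "bij_betw u {..<Suc k} A"
    using ex_bij_betw_nat_finite[OF fA] A(2) by (metis lessThan_atLeast0)
  have uA: "u i \<in> A" if "i \<le> k" for i using u that by (auto simp: bij_betw_def)
  have diff: "fst (u i) - fst (u j) \<notin> I" if "i \<le> k" "j \<le> k" "i \<noteq> j" for i j
  proof
    assume "fst (u i) - fst (u j) \<in> I"
    then have "fst (u i) = fst (u j)" using uA[OF that(1)] uA[OF that(2)] A(1)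
      by (intro Rep_unique) (auto simp: V_def)
    then have "u i = u j" using injA uA that by blast
    then show False using u that by (auto simp: bij_betw_def inj_on_def)
  qed
  define c where "c i = inv_el (fst (u (Suc i)) - fst (u 0))" for i
  define E where "E i = ind (fst (u (Suc i)) - fst (u 0)) + snd (u 0)" for i
  \<comment> \<open>Adding \<open>(M - 1) * E i\<close> subtracts \<open>E i\<close> modulo
    \<open>M\<close> within the naturals.\<close>
  define d where "d i = snd (u (Suc i)) + (M - 1) * E i" for i
  define h where "h v = rep (inv_el (fst (u 0) + fst v))" for v :: "'r \<times> nat"
  have c: "c i * (fst (u (Suc i)) - fst (u 0)) - 1 \<in> I" if "i < k" for i
    unfolding c_def using that by (intro inv_el diff) auto
  have h: "h v * (fst (u 0) + fst v) - 1 \<in> I" if "v \<in> ?C" for v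
  proof -
    have nI: "fst (u 0) + fst v \<notin> I" using that uA[of 0] by (auto simp: adj_def)
    have "h v * (fst (u 0) + fst v) - inv_el (fst (u 0) + fst v) * (fst (u 0) + fst v) \<in> I"
      unfolding h_def by (intro I_cong_mult I_cong_sym[OF rep(2)]) (simp add: I_zero)
    then show ?thesis using inv_el(1)[OF nI] by (rule I_cong_trans)
  qed
  have "inj_on h ?C"
  proof (rule inj_onI)
    fix v w assume vw: "v \<in> ?C" "w \<in> ?C" "h v = h w"
    define a x y where defs: "a = fst (u 0)" "x = fst v" "y = fst w"
    have "(a + y) * (h v * (a + x) - 1) - (a + x) * (h w * (a + y) - 1) \<in> I"
      using h[OF vw(1)] h[OF vw(2)] unfolding defs by (rule I_diff[OF I_mult I_mult])
    then have "x - y \<in> I" using vw(3) by (simp add: algebra_simps)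
    then have "x = y" using vw unfolding defs by (intro Rep_unique) (auto simp: V_def)
    then show "v = w" using adj_snd_unique[of "u 0" v w] vw uA[of 0] unfolding defs by (auto simp: V_def)
  qed
  then have "card ?C = card (h ` ?C)" by (rule card_image[symmetric])
  also have "\<dots> \<le> fact k"
  proof (rule card_norm_system[of c _ d])
    fix i i' assume i: "i < k" "i' < k" "i \<noteq> i'"
    define a a' where defs: "a = fst (u (Suc i)) - fst (u 0)" "a' = fst (u (Suc i')) - fst (u 0)"
    show "c i - c i' \<notin> I"
    proof
      assume cc: "c i - c i' \<in> I"
      have "a * (c i' * a' - 1) - a' * (c i * a - 1) + (a * a') * (c i - c i') \<in> I"
        using c[OF i(1)] c[OF i(2)] cc unfolding defs by (intro I_add[OF I_diff[OF I_mult I_mult] I_mult])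
      then have "a' - a \<in> I" by (simp add: algebra_simps)
      then show False using diff[of "Suc i'" "Suc i"] i by (simp add: defs)
    qed
  next
    show "h ` ?C \<subseteq> Rep" by (auto simp: h_def rep)
  next
    fix i s assume i: "i < k" and "s \<in> h ` ?C"
    then obtain v where v: "v \<in> ?C" "s = h v" by blast
    define a0 a1 x where defs: "a0 = fst (u 0)" "a1 = fst (u (Suc i))" "x = fst v"
    have nI: "a0 + x \<notin> I" "a1 + x \<notin> I" "a1 - a0 \<notin> I"
      using v uA[of 0] uA[of "Suc i"] i diff[of "Suc i" 0] unfolding defs by (auto simp: adj_def)
    have "(a1 - a0) * (s * (a0 + x) - 1) + (a0 + x) * (c i * (a1 - a0) - 1) \<in> I"
      using h[OF v(1)] c[OF i] unfolding defs v(2) by (intro I_add I_mult)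
    also have "(a1 - a0) * (s * (a0 + x) - 1) + (a0 + x) * (c i * (a1 - a0) - 1)
       = (s + c i) * ((a1 - a0) * (a0 + x)) - (a1 + x)" by (simp add: algebra_simps)
    finally have eq: "(s + c i) * ((a1 - a0) * (a0 + x)) - (a1 + x) \<in> I" .
    then have nI2: "(s + c i) * ((a1 - a0) * (a0 + x)) \<notin> I" using notin_cong[OF I_cong_sym] nI(2) by blast
    then have nI3: "s + c i \<notin> I" using I_mult[of "s + c i" "(a1 - a0) * (a0 + x)"]
      by (auto simp: mult.commute)
    have "[ind (s + c i) + (ind (a1 - a0) + ind (a0 + x))
        = ind (s + c i) + ind ((a1 - a0) * (a0 + x))] (mod M)"
      using cong_sym[OF ind_mult[OF nI(3,1)]] by (intro cong_add) auto
    also have "[ind (s + c i) + ind ((a1 - a0) * (a0 + x))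
        = ind ((s + c i) * ((a1 - a0) * (a0 + x)))] (mod M)"
      using cong_sym[OF ind_mult[OF nI3 notin_mult[OF nI(3,1)]]] .
    also have "[ind ((s + c i) * ((a1 - a0) * (a0 + x))) = ind (a1 + x)] (mod M)"
      by (rule ind_cong[OF nI2 eq])
    also have "[ind (a1 + x) = snd (u (Suc i)) + snd v] (mod M)"
      using v uA[of "Suc i"] i by (auto simp: adj_def defs)
    finally have 1: "[ind (s + c i) + (ind (a1 - a0) + ind (a0 + x)) = snd (u (Suc i)) + snd v] (mod M)" .
    have "[ind (s + c i) + (ind (a1 - a0) + ind (a0 + x))
        = ind (s + c i) + (ind (a1 - a0) + (snd (u 0) + snd v))] (mod M)"
      using v uA[of 0] by (intro cong_add) (auto simp: adj_def defs)
    also have "ind (s + c i) + (ind (a1 - a0) + (snd (u 0) + snd v)) = (ind (s + c i) + E i) + snd v"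
      by (simp add: E_def defs add_ac)
    finally have "[(ind (s + c i) + E i) + snd v = snd (u (Suc i)) + snd v] (mod M)"
      using cong_trans[OF cong_sym 1] by blast
    then have "[ind (s + c i) + E i = snd (u (Suc i))] (mod M)" by (simp add: cong_add_rcancel_nat)
    then have "[(ind (s + c i) + E i) + (M - 1) * E i = d i] (mod M)" unfolding d_def
      by (intro cong_add) auto
    moreover have "(ind (s + c i) + E i) + (M - 1) * E i = ind (s + c i) + M * E i"
      using M_pos by (cases M) auto
    ultimately have "[ind (s + c i) + M * E i = d i] (mod M)" by (simp only:)
    then have "[ind (s + c i) = d i] (mod M)" by (simp add: cong_def)
    then show "s + c i \<notin> I \<and> [ind (s + c i) = d i] (mod M)" using nI3 by simp
  qed
  finally show ?thesis .
qed

end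

text \<open>The summary used from here on. With \<open>a = Suc k\<close> the last clause excludes
  K_{a,b} as soon as \<open>b > fact k\<close>; the codegree clause is multiplied out to avoid a
  division.\<close>

theorem projective_norm_graph:
  assumes "primepow q" "k > 0"
  shows "\<exists>(V :: (int poly \<times> nat) set) adj. finite V \<and> card V = q ^ k * (q - 1) \<and> (\<forall>u v. adj u v \<longrightarrow> adj v u)
    \<and> (\<forall>u\<in>V. card {v \<in> V. adj u v} = q ^ k - 1)
    \<and> (\<forall>u\<in>V. \<forall>u'\<in>V. u \<noteq> u' \<longrightarrow> (q - 1) * card {v \<in> V. adj u v \<and> adj u' v} \<le> q ^ k - 1)
    \<and> (\<forall>A\<subseteq>V. card A = Suc k \<longrightarrow> card {v \<in> V. \<forall>u\<in>A. adj u v} \<le> fact k)"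
proof -
  obtain p e where p: "prime p" "e > 0" "q = p ^ e" using assms(1) by (auto simp: primepow_def)
  define N where "N = q ^ k - 1"
  have "q ^ k = p ^ (e * k)" by (simp add: p power_mult)
  then obtain I :: "int poly set" where I: "residue_field I (insert 0 ((^) [:0, 1:] ` {..<N}))"
    "of_nat p \<in> I" "[:0, 1:] ^ N - 1 \<in> I"
    using residue_field_prime_power[of p "e * k" N] p assms(2) by (auto simp: N_def)
  have monom: "[:0, 1:] ^ i = (Polynomial.monom 1 i :: int poly)" for i by (simp add: monom_altdef)
  interpret norm_field I "insert 0 ((^) [:0, 1:] ` {..<N})" "[:0, 1:]" p e k q N "q - 1" "\<Sum>j<k. q ^ j"
  proof (intro norm_field.intro norm_field_axioms.intro)
    show "inj_on ((^) [:0, 1::int:]) {..<N}" unfolding inj_on_def monom by (simp add: monom_eq_iff')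
    show "[:0, 1::int:] ^ i \<noteq> 0" for i by simp
  qed (fact I p assms(2) N_def refl)+
  show ?thesis
  proof (intro exI[of _ V] exI[of _ adj] conjI ballI allI impI)
    fix u u' assume u: "u \<in> V" "u' \<in> V" "u \<noteq> u'"
    have "(q - 1) * card {v \<in> V. adj u v \<and> adj u' v} \<le> (q - 1) * (\<Sum>j<k. q ^ j)"
      using codegree_le[OF u] by simp
    then show "(q - 1) * card {v \<in> V. adj u v \<and> adj u' v} \<le> q ^ k - 1" unfolding N_eq[symmetric]
      by (simp only: N_def)
  next
    fix u v assume "adj u v"
    then show "adj v u" by (subst adj_sym)
  qed (fact finite_V card_V degree_eq common_nbrs_le | assumption | rule degree_eq common_nbrs_le)+
qed

section \<open>Cliques in pseudorandom graphs\<close>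

text \<open>Only distinct pairs are tested, so the loops of the norm graph do no harm;
  \<open>nbrs\<close> leaves out the vertex itself for the same reason.\<close>

definition cliques :: "('a \<Rightarrow> 'a \<Rightarrow> bool) \<Rightarrow> 'a set \<Rightarrow> nat \<Rightarrow> 'a set set" where
  "cliques R U r = {S. S \<subseteq> U \<and> finite S \<and> card S = r \<and> (\<forall>x\<in>S. \<forall>y\<in>S. x \<noteq> y \<longrightarrow> R x y)}"

definition nbrs :: "('a \<Rightarrow> 'a \<Rightarrow> bool) \<Rightarrow> 'a set \<Rightarrow> 'a \<Rightarrow> 'a set" where
  "nbrs R U v = {w \<in> U. R v w \<and> w \<noteq> v}"

lemma cliques_subset_Pow: "cliques R U r \<subseteq> Pow U" by (auto simp: cliques_def)

lemma finite_cliques: "finite U \<Longrightarrow> finite (cliques R U r)"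
  using cliques_subset_Pow finite_Pow_iff finite_subset by metis

lemma finite_nbrs: "finite U \<Longrightarrow> finite (nbrs R U v)" by (simp add: nbrs_def)

lemma sum_card_filter_swap:
  assumes "finite A" "finite B"
  shows "(\<Sum>x\<in>A. card {y \<in> B. P x y}) = (\<Sum>y\<in>B. card {x \<in> A. P x y})"
proof -
  have "(\<Sum>x\<in>A. card {y \<in> B. P x y}) = (\<Sum>x\<in>A. \<Sum>y\<in>B. if P x y then 1 else 0)"
    using assms by (simp add: sum.If_cases Int_def)
  also have "\<dots> = (\<Sum>y\<in>B. \<Sum>x\<in>A. if P x y then 1 else 0)" by (rule sum.swap)
  also have "\<dots> = (\<Sum>y\<in>B. card {x \<in> A. P x y})"
    using assms by (simp add: sum.If_cases Int_def)
  finally show ?thesis .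
qed

lemma card_cliques_containing:
  assumes "finite U" "symp R" "v \<in> U"
  shows "card {S \<in> cliques R U (Suc r). v \<in> S} = card (cliques R (nbrs R U v) r)"
proof (rule bij_betw_same_card[of "\<lambda>S. S - {v}"], rule bij_betw_byWitness[where f' = "insert v"])
  show "insert v ` cliques R (nbrs R U v) r \<subseteq> {S \<in> cliques R U (Suc r). v \<in> S}"
  proof clarify
    fix S assume S: "S \<in> cliques R (nbrs R U v) r"
    then have "v \<notin> S" by (auto simp: cliques_def nbrs_def)
    then show "insert v S \<in> cliques R U (Suc r) \<and> v \<in> insert v S"
      using S assms by (auto simp: cliques_def nbrs_def dest: sympD)
  qed
  show "(\<lambda>S. S - {v}) ` {S \<in> cliques R U (Suc r). v \<in> S} \<subseteq> cliques R (nbrs R U v) r"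
    by (auto simp: cliques_def nbrs_def)
qed (auto simp: cliques_def nbrs_def)

lemma clique_double_count:
  assumes "finite U" "symp R"
  shows "Suc r * card (cliques R U (Suc r)) = (\<Sum>v\<in>U. card (cliques R (nbrs R U v) r))"
proof -
  have "Suc r * card (cliques R U (Suc r)) = (\<Sum>S\<in>cliques R U (Suc r). card {v \<in> U. v \<in> S})"
  proof -
    have "card {v \<in> U. v \<in> S} = Suc r" if "S \<in> cliques R U (Suc r)" for S
    proof -
      have "{v \<in> U. v \<in> S} = S" "card S = Suc r" using that by (auto simp: cliques_def)
      then show ?thesis by simp
    qed
    then show ?thesis by simp
  qed
  also have "\<dots> = (\<Sum>v\<in>U. card {S \<in> cliques R U (Suc r). v \<in> S})"
    using assms by (intro sum_card_filter_swap finite_cliques)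
  also have "\<dots> = (\<Sum>v\<in>U. card (cliques R (nbrs R U v) r))"
    using assms by (intro sum.cong card_cliques_containing) auto
  finally show ?thesis .
qed

text \<open>In the expanded square the diagonal contributes at most \<open>s * d\<close> (notation
  of the proof). Off the diagonal the excess of the codegree over its mean is
  \<open>d / (q - 1) - d ^ 2 / n = d / n\<close>, because \<open>n = (d + 1) * (q - 1)\<close>, and
  \<open>s ^ 2 * (d / n)\<close> is again at most \<open>s * d\<close>.\<close>

lemma second_moment_bound:
  fixes adj :: "'a \<Rightarrow> 'a \<Rightarrow> bool" and q k :: nat
  assumes V: "finite V" "card V = q ^ k * (q - 1)" and q: "q \<ge> 2" and k: "k > 0"
    and sym: "symp adj"
    and deg: "\<And>u. u \<in> V \<Longrightarrow> card {v \<in> V. adj u v} = q ^ k - 1"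
    and codeg: "\<And>u u'. u \<in> V \<Longrightarrow> u' \<in> V \<Longrightarrow> u \<noteq> u' \<Longrightarrow>
      (q - 1) * card {v \<in> V. adj u v \<and> adj u' v} \<le> q ^ k - 1"
    and U: "U \<subseteq> V"
  defines "\<mu> \<equiv> real (q ^ k - 1) / real (card V)"
  shows "(\<Sum>v\<in>V. (real (card {u \<in> U. adj u v}) - real (card U) * \<mu>)\<^sup>2)
      \<le> 2 * real (card U) * real (q ^ k - 1)"
proof -
  define d where "d = real (q ^ k - 1)"
  define n where "n = real (card V)"
  define s where "s = real (card U)"
  let ?e = "\<lambda>v. real (card {u \<in> U. adj u v})"
  have fU: "finite U" using U V finite_subset by blast
  have qk: "q ^ k > 1" using one_less_power[of q k] q k by linarith
  have q1: "real (q - 1) = real q - 1" using q by (simp add: of_nat_diff)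
  have d: "d = real q ^ k - 1" using qk by (simp add: d_def of_nat_diff)
  have n: "n = real q ^ k * (real q - 1)" by (simp only: n_def V of_nat_mult of_nat_power q1)
  have npos: "n > 0" using q by (simp add: n)
  have d0: "d \<ge> 0" by (simp add: d_def)
  have e1: "(\<Sum>v\<in>V. ?e v) = s * d"
  proof -
    have "(\<Sum>v\<in>V. card {u \<in> U. adj u v}) = (\<Sum>u\<in>U. card {v \<in> V. adj u v})"
      by (rule sum_card_filter_swap[OF V(1) fU])
    also have "\<dots> = card U * (q ^ k - 1)" using U deg by (subst sum.cong[OF refl deg]) auto
    finally have "real (\<Sum>v\<in>V. card {u \<in> U. adj u v}) = real (card U * (q ^ k - 1))" by (rule arg_cong)
    then show ?thesis by (simp add: s_def d_def)
  qed
  have cod: "real (card {v \<in> V. adj u v \<and> adj u' v}) \<le> (if u = u' then d else 0) + d / (real q - 1)"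
    if "u \<in> U" "u' \<in> U" for u u'
  proof (cases "u = u'")
    case True
    have "d / (real q - 1) \<ge> 0" using d0 q by simp
    then show ?thesis using deg[of u] that U True by (auto simp: d_def)
  next
    case False
    then have "real ((q - 1) * card {v \<in> V. adj u v \<and> adj u' v}) \<le> d"
      using codeg[of u u'] that U by (auto simp: d_def simp del: of_nat_mult)
    then show ?thesis using False q by (simp add: q1 field_simps)
  qed
  have e2: "(\<Sum>v\<in>V. (?e v)\<^sup>2) \<le> s * d + s\<^sup>2 * (d / (real q - 1))"
  proof -
    have "(\<Sum>v\<in>V. (?e v)\<^sup>2) = (\<Sum>v\<in>V. \<Sum>u\<in>U. \<Sum>u'\<in>U. if adj u v \<and> adj u' v then 1 else 0)"
    proof (rule sum.cong[OF refl])
      fix v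
      have "?e v = (\<Sum>u\<in>U. if adj u v then 1 else 0)"
        using fU by (simp add: sum.If_cases Int_def)
      then have "(?e v)\<^sup>2 = (\<Sum>u\<in>U. \<Sum>u'\<in>U. (if adj u v then 1 else 0) * (if adj u' v then 1 else 0))"
        by (simp add: power2_eq_square sum_product)
      also have "\<dots> = (\<Sum>u\<in>U. \<Sum>u'\<in>U. if adj u v \<and> adj u' v then 1 else 0)"
        by (intro sum.cong) auto
      finally show "(?e v)\<^sup>2 = (\<Sum>u\<in>U. \<Sum>u'\<in>U. if adj u v \<and> adj u' v then 1 else 0)" .
    qed
    also have "\<dots> = (\<Sum>u\<in>U. \<Sum>v\<in>V. \<Sum>u'\<in>U. if adj u v \<and> adj u' v then 1 else 0)" by (rule sum.swap)
    also have "\<dots> = (\<Sum>u\<in>U. \<Sum>u'\<in>U. \<Sum>v\<in>V. if adj u v \<and> adj u' v then 1 else 0)"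
      by (intro sum.cong refl sum.swap)
    also have "\<dots> = (\<Sum>u\<in>U. \<Sum>u'\<in>U. real (card {v \<in> V. adj u v \<and> adj u' v}))"
      using V by (simp add: sum.If_cases Int_def)
    also have "\<dots> \<le> (\<Sum>u\<in>U. \<Sum>u'\<in>U. (if u = u' then d else 0) + d / (real q - 1))"
      using cod by (intro sum_mono) auto
    also have "\<dots> = s * d + s\<^sup>2 * (d / (real q - 1))"
      using fU by (simp add: sum.distrib s_def power2_eq_square distrib_left)
    finally show ?thesis .
  qed
  have "(\<Sum>v\<in>V. (?e v - s * \<mu>)\<^sup>2) = (\<Sum>v\<in>V. (?e v)\<^sup>2 - 2 * s * \<mu> * ?e v + (s * \<mu>)\<^sup>2)"
    by (intro sum.cong) (auto simp: power2_eq_square algebra_simps)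
  also have "\<dots> = (\<Sum>v\<in>V. (?e v)\<^sup>2) - 2 * s * \<mu> * (\<Sum>v\<in>V. ?e v) + n * (s * \<mu>)\<^sup>2"
    by (simp add: sum.distrib sum_subtractf sum_distrib_left n_def)
  also have "\<dots> \<le> s * d + s\<^sup>2 * (d / (real q - 1)) - 2 * s * \<mu> * (s * d) + n * (s * \<mu>)\<^sup>2"
    using e2 e1 by simp
  also have "\<dots> = s * d + s\<^sup>2 * (d / n)"
  proof -
    have \<mu>: "\<mu> = d / n" by (simp add: \<mu>_def d_def n_def)
    have "d / (real q - 1) - d\<^sup>2 / n = d / n"
    proof -
      have "d / (real q - 1) = d * real q ^ k / n" using q by (simp add: n field_simps)
      then have "d / (real q - 1) - d\<^sup>2 / n = d * (real q ^ k - d) / n"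
        by (simp add: power2_eq_square right_diff_distrib diff_divide_distrib)
      then show ?thesis by (simp add: d)
    qed
    then have "s\<^sup>2 * (d / (real q - 1)) - s\<^sup>2 * (d\<^sup>2 / n) = s\<^sup>2 * (d / n)"
      by (metis right_diff_distrib)
    moreover have "n * (s * (d / n))\<^sup>2 = s\<^sup>2 * (d\<^sup>2 / n)" "2 * s * (d / n) * (s * d)
        = 2 * (s\<^sup>2 * (d\<^sup>2 / n))"
      using npos by (auto simp: power2_eq_square)
    ultimately show ?thesis unfolding \<mu> by linarith
  qed
  also have "s\<^sup>2 * (d / n) \<le> s * d"
  proof -
    have "s \<le> n" using card_mono[OF V(1) U] unfolding s_def n_def by simp
    then have "s * (s * d) \<le> n * (s * d)" using d0 by (intro mult_right_mono) (auto simp: s_def)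
    then show ?thesis using npos by (simp add: power2_eq_square field_simps)
  qed
  finally show ?thesis by (simp add: s_def d_def mult_ac)
qed


text \<open>Almost every vertex of \<open>U\<close> has about \<open>card U / q\<close> neighbours
  in \<open>U\<close>, so the induction passes to neighbourhoods. These keep at least
  \<open>card U / (2 * q)\<close> vertices, and the factor \<open>4 ^ r * q ^ (2 * r)\<close> of the
  threshold pays for the square of this loss at every level.\<close>

lemma clique_count_lower:
  fixes adj :: "'a \<Rightarrow> 'a \<Rightarrow> bool" and q k :: nat and \<epsilon> :: real
  assumes V: "finite V" "card V = q ^ k * (q - 1)" and q: "q \<ge> 2" and k: "k > 0"
    and sym: "symp adj"
    and deg: "\<And>u. u \<in> V \<Longrightarrow> card {v \<in> V. adj u v} = q ^ k - 1"
    and codeg: "\<And>u u'. u \<in> V \<Longrightarrow> u' \<in> V \<Longrightarrow> u \<noteq> u' \<Longrightarrow>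
      (q - 1) * card {v \<in> V. adj u v \<and> adj u' v} \<le> q ^ k - 1"
    and \<epsilon>: "0 < \<epsilon>" "\<epsilon> \<le> 1 / 2"
    and U: "U \<subseteq> V" "r \<ge> 1" "8 * 4 ^ r * real q ^ (k + 2 * r) \<le> (real (card U))\<^sup>2 * \<epsilon> ^ 3 * (real q)\<^sup>2"
  shows "(1 - \<epsilon>) ^ (r\<^sup>2) * real (card U) ^ r
      \<le> fact r * real (card (cliques adj U r)) * real q ^ (r choose 2)"
  using U(2,1,3)
proof (induction r arbitrary: U rule: nat_induct_at_least)
  case base
  have fU: "finite U" using base V finite_subset by blast
  have "cliques adj U 1 = (\<lambda>x. {x}) ` U"
    by (auto simp: cliques_def card_1_singleton_iff)
  then have "card (cliques adj U 1) = card U" by (simp add: card_image)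
  then show ?case using \<epsilon> by (simp add: mult_left_le_one_le binomial_eq_0)
next
  case (Suc r)
  define s where "s = real (card U)"
  define d where "d = real (q ^ k - 1)"
  define \<mu> where "\<mu> = d / real (card V)"
  have fU: "finite U" using Suc V finite_subset by blast
  have q0: "real q > 0" using q by simp
  have qk: "q ^ k > 1" using one_less_power[of q k] q k by linarith
  have d: "d = real q ^ k - 1" using qk by (simp add: d_def of_nat_diff)
  have thr: "8 * 4 ^ Suc r * real q ^ (k + 2 * r) \<le> s\<^sup>2 * \<epsilon> ^ 3"
  proof -
    have "(8 * 4 ^ Suc r * real q ^ (k + 2 * r)) * (real q)\<^sup>2 \<le> (s\<^sup>2 * \<epsilon> ^ 3) * (real q)\<^sup>2"
      using Suc.prems by (simp add: s_def power_add mult_ac power2_eq_square)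
    then show ?thesis using q0 by simp
  qed
  have thr2: "32 * real q ^ (k + 2) \<le> s\<^sup>2 * \<epsilon> ^ 3"
  proof -
    have "real q ^ (k + 2) \<le> real q ^ (k + 2 * r)" using q Suc.hyps by (intro power_increasing) auto
    moreover have "(1 :: real) \<le> 4 ^ r" by simp
    ultimately have "1 * real q ^ (k + 2) \<le> 4 ^ r * real q ^ (k + 2 * r)" by (intro mult_mono) auto
    then show ?thesis using thr by simp
  qed
  have s0: "s > 0"
  proof (rule ccontr)
    assume "\<not> s > 0"
    then have "s = 0" by (simp add: s_def)
    then have "32 * real q ^ (k + 2) \<le> 0" using thr2 by simp
    moreover have "real q ^ (k + 2) > 0" using q0 by simp
    ultimately show False by linarith
  qed
  have \<mu>: "\<mu> \<ge> 1 / real q"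
  proof -
    have "real q ^ k * (real q - 1) \<le> d * real q" using q k self_le_power[of "real q" k]
      by (simp add: d algebra_simps)
    moreover have "real q ^ k * (real q - 1) > 0" using q by simp
    ultimately show ?thesis using q q0 by (simp add: \<mu>_def V field_simps of_nat_diff)
  qed
  define Bad where "Bad = {v \<in> U. real (card (nbrs adj U v)) < (1 - \<epsilon>) * s / real q}"
  \<comment> \<open>This pays for a possible loop: the count by \<open>adj\<close> exceeds
    \<open>nbrs\<close> by at most 1, which is at most half of the permitted defect
    \<open>\<epsilon> * s / q\<close>.\<close>
  have sq: "2 * real q \<le> \<epsilon> * s"
  proof (rule power2_le_imp_le)
    have "(2 * real q)\<^sup>2 \<le> 32 * real q ^ (k + 2)"
    proof -
      have "1 * (real q)\<^sup>2 \<le> real q ^ k * (real q)\<^sup>2" using q by (intro mult_right_mono) auto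
      then have "4 * (real q)\<^sup>2 \<le> 32 * (real q ^ k * (real q)\<^sup>2)"
        using zero_le_power2[of "real q"] by linarith
      then show ?thesis by (simp add: power_mult_distrib power2_eq_square mult_ac)
    qed
    also note thr2
    also have "s\<^sup>2 * \<epsilon> ^ 3 \<le> s\<^sup>2 * \<epsilon> ^ 2" using \<epsilon> by (intro mult_left_mono power_decreasing) auto
    finally show "(2 * real q)\<^sup>2 \<le> (\<epsilon> * s)\<^sup>2" by (simp add: power_mult_distrib mult.commute)
  qed (use \<epsilon> s0 in auto)
  have bad1: "(\<epsilon> / 2 * s * \<mu>)\<^sup>2 \<le> (real (card {u \<in> U. adj u v}) - s * \<mu>)\<^sup>2" if "v \<in> Bad" for v
  proof -
    have "{u \<in> U. adj u v} \<subseteq> insert v (nbrs adj U v)" using sym by (auto simp: nbrs_def dest: sympD)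
    then have "card {u \<in> U. adj u v} \<le> card (insert v (nbrs adj U v))"
      using fU by (intro card_mono) (auto simp: nbrs_def)
    also have "\<dots> \<le> Suc (card (nbrs adj U v))" by (rule card_insert_le_m1) simp_all
    finally have "real (card {u \<in> U. adj u v}) \<le> real (card (nbrs adj U v)) + 1" by simp
    also have "\<dots> \<le> (1 - \<epsilon>) * s / real q + 1" using that by (simp add: Bad_def)
    also have "\<dots> \<le> (1 - \<epsilon>) * s / real q + \<epsilon> / 2 * s * (1 / real q)" using sq q0 by (simp add: field_simps)
    also have "(1 - \<epsilon>) * s / real q + \<epsilon> / 2 * s * (1 / real q) = (1 - \<epsilon> / 2) * s * (1 / real q)"
      by (simp add: algebra_simps diff_divide_distrib)
    also have "\<dots> \<le> (1 - \<epsilon> / 2) * s * \<mu>" using \<epsilon> s0 \<mu> by (intro mult_left_mono) auto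
    finally have "\<epsilon> / 2 * s * \<mu> \<le> s * \<mu> - real (card {u \<in> U. adj u v})" by (simp add: algebra_simps)
    moreover have "0 \<le> \<epsilon> / 2 * s * \<mu>" using \<epsilon> s0 \<mu> q0
      by (intro mult_nonneg_nonneg) (auto intro: order.trans[of 0 "1 / real q"])
    ultimately show ?thesis by (metis power2_commute power_mono)
  qed
  have "real (card Bad) * (\<epsilon> / 2 * s * \<mu>)\<^sup>2 = (\<Sum>v\<in>Bad. (\<epsilon> / 2 * s * \<mu>)\<^sup>2)" by simp
  also have "\<dots> \<le> (\<Sum>v\<in>Bad. (real (card {u \<in> U. adj u v}) - s * \<mu>)\<^sup>2)"
    by (intro sum_mono bad1)
  also have "\<dots> \<le> (\<Sum>v\<in>V. (real (card {u \<in> U. adj u v}) - s * \<mu>)\<^sup>2)"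
    using V Suc.prems by (intro sum_mono2) (auto simp: Bad_def)
  also have "\<dots> \<le> 2 * s * d"
    using second_moment_bound[OF V q k sym deg codeg Suc.prems(1)] by (simp add: s_def d_def \<mu>_def)
  finally have bad2: "real (card Bad) * (\<epsilon> / 2 * s * \<mu>)\<^sup>2 \<le> 2 * s * d" .
  \<comment> \<open>Chebyshev's inequality. Of the three factors \<epsilon> in the threshold, two
    belong to the deviation and one to the proportion of bad vertices.\<close>
  have bad: "real (card Bad) \<le> \<epsilon> * s"
  proof -
    have "(\<epsilon> / 2 * s / real q)\<^sup>2 \<le> (\<epsilon> / 2 * s * \<mu>)\<^sup>2"
      using \<epsilon> s0 \<mu> q0 by (intro power_mono) (auto simp: divide_simps mult_left_mono)
    then have "real (card Bad) * (\<epsilon> / 2 * s / real q)\<^sup>2 \<le> real (card Bad) * (\<epsilon> / 2 * s * \<mu>)\<^sup>2"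
      by (intro mult_left_mono) auto
    also have "\<dots> \<le> 2 * s * real q ^ k" using bad2 s0 d by (simp add: algebra_simps)
    finally have "real (card Bad) * \<epsilon>\<^sup>2 * s\<^sup>2 \<le> (8 * real q ^ (k + 2)) * s"
      using q0 by (simp add: power_mult_distrib power_divide divide_simps power2_eq_square mult_ac)
    also have "\<dots> \<le> (s\<^sup>2 * \<epsilon> ^ 3) * s"
    proof (rule mult_right_mono)
      have "0 \<le> real q ^ (k + 2)" by simp
      then show "8 * real q ^ (k + 2) \<le> s\<^sup>2 * \<epsilon> ^ 3" using thr2 by linarith
    qed (use s0 in simp)
    also have "\<dots> = (\<epsilon> * s) * \<epsilon>\<^sup>2 * s\<^sup>2" by (simp add: power2_eq_square power3_eq_cube)
    finally show ?thesis using \<epsilon> s0 by simp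
  qed
  have good: "(1 - \<epsilon>) ^ (r\<^sup>2 + r) * (s / real q) ^ r
      \<le> fact r * real (card (cliques adj (nbrs adj U v) r)) * real q ^ (r choose 2)" if v: "v \<in> U -
        Bad" for v
  proof -
    have c: "(1 - \<epsilon>) * s / real q \<le> real (card (nbrs adj U v))" using v by (auto simp: Bad_def)
    have c0: "0 \<le> (1 - \<epsilon>) * s / real q" using \<epsilon> s0 q0 by simp
    have "(s / (2 * real q))\<^sup>2 \<le> (real (card (nbrs adj U v)))\<^sup>2"
    proof (rule power_mono[OF order.trans[OF _ c]])
      have "1 / 2 * s / real q \<le> (1 - \<epsilon>) * s / real q"
        using \<epsilon> s0 q0 by (intro divide_right_mono mult_right_mono) auto
      then show "s / (2 * real q) \<le> (1 - \<epsilon>) * s / real q" by simp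
    qed (use s0 q0 in auto)
    then have "(s / (2 * real q))\<^sup>2 * \<epsilon> ^ 3 * (real q)\<^sup>2
        \<le> (real (card (nbrs adj U v)))\<^sup>2 * \<epsilon> ^ 3 * (real q)\<^sup>2"
      using \<epsilon> q0 by (intro mult_right_mono) auto
    moreover have "8 * 4 ^ r * real q ^ (k + 2 * r) \<le> (s / (2 * real q))\<^sup>2 * \<epsilon> ^ 3 * (real q)\<^sup>2"
      using thr q0 by (simp add: power_divide power_mult_distrib field_simps)
    ultimately have "(1 - \<epsilon>) ^ r\<^sup>2 * real (card (nbrs adj U v)) ^ r
       \<le> fact r * real (card (cliques adj (nbrs adj U v) r)) * real q ^ (r choose 2)"
      using Suc.prems by (intro Suc.IH) (auto simp: nbrs_def)
    moreover have "(1 - \<epsilon>) ^ r\<^sup>2 * ((1 - \<epsilon>) * s / real q) ^ r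
        \<le> (1 - \<epsilon>) ^ r\<^sup>2 * real (card (nbrs adj U v)) ^ r"
      using \<epsilon> by (intro mult_left_mono power_mono c c0) auto
    moreover have "(1 - \<epsilon>) ^ r\<^sup>2 * ((1 - \<epsilon>) * s / real q) ^ r = (1 - \<epsilon>) ^ (r\<^sup>2 + r) * (s / real q) ^ r"
      by (simp add: power_add power_mult_distrib power_divide)
    ultimately show ?thesis by linarith
  qed
  have "(1 - \<epsilon>) * s \<le> real (card (U - Bad))"
  proof -
    have "real (card (U - Bad)) = s - real (card Bad)"
      using fU card_mono[of U Bad] by (subst card_Diff_subset) (auto simp: Bad_def s_def of_nat_diff)
    then show ?thesis using bad by (simp add: algebra_simps)
  qed
  then have "(1 - \<epsilon>) * s * ((1 - \<epsilon>) ^ (r\<^sup>2 + r) * (s / real q) ^ r)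
      \<le> real (card (U - Bad)) * ((1 - \<epsilon>) ^ (r\<^sup>2 + r) * (s / real q) ^ r)"
    using \<epsilon> s0 q0 by (intro mult_right_mono) auto
  also have "\<dots> = (\<Sum>v\<in>U - Bad. (1 - \<epsilon>) ^ (r\<^sup>2 + r) * (s / real q) ^ r)" by simp
  also have "\<dots> \<le> (\<Sum>v\<in>U - Bad. fact r * real (card (cliques adj (nbrs adj U v) r)) * real q ^ (r choose 2))"
    by (intro sum_mono good)
  also have "\<dots> \<le> (\<Sum>v\<in>U. fact r * real (card (cliques adj (nbrs adj U v) r)) * real q ^ (r choose 2))"
    using fU by (intro sum_mono2) auto
  also have "\<dots> = fact r * real (\<Sum>v\<in>U. card (cliques adj (nbrs adj U v) r)) * real q ^ (r choose 2)"
    by (simp add: sum_distrib_left sum_distrib_right)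
  also have "(\<Sum>v\<in>U. card (cliques adj (nbrs adj U v) r)) = Suc r * card (cliques adj U (Suc r))"
    using clique_double_count[OF fU sym] by simp
  also have "fact r * real (Suc r * card (cliques adj U (Suc r))) * real q ^ (r choose 2)
    = fact (Suc r) * real (card (cliques adj U (Suc r))) * real q ^
      (r choose 2)" by (simp add: algebra_simps)
  finally have main: "(1 - \<epsilon>) * s * ((1 - \<epsilon>) ^ (r\<^sup>2 + r) * (s / real q) ^ r)
    \<le> fact (Suc r) * real (card (cliques adj U (Suc r))) * real q ^ (r choose 2)" .
  \<comment> \<open>The losses are one factor for the bad vertices, \<open>r\<close> for the size of
    the neighbourhood and \<open>r ^ 2\<close> from the induction hypothesis; their number is at
    most \<open>(r + 1) ^ 2\<close>.\<close>
  have "(1 - \<epsilon>) ^ (Suc r)\<^sup>2 * s ^ Suc r \<le> (1 - \<epsilon>) ^ Suc (r\<^sup>2 + r) * s ^ Suc r"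
    using \<epsilon> s0 by (intro mult_right_mono power_decreasing) (auto simp: power2_eq_square)
  also have "\<dots> = ((1 - \<epsilon>) * s * ((1 - \<epsilon>) ^ (r\<^sup>2 + r) * (s / real q) ^ r)) * real q ^ r"
    using q0 by (simp add: power_divide)
  also have "\<dots> \<le> (fact (Suc r) * real (card (cliques adj U (Suc r))) * real q ^ (r choose 2)) * real q ^ r"
    using main q0 by (intro mult_right_mono) auto
  also have "\<dots> = fact (Suc r) * real (card (cliques adj U (Suc r))) * real q ^ (Suc r choose 2)"
    by (simp add: numeral_2_eq_2 power_add mult_ac)
  finally show ?case by (simp add: s_def)
qed

section \<open>Cliques in graphs without large bicliques\<close>

text \<open>Jensen's inequality for the concave power \<theta>: Young's inequality supplies the
  tangent at the mean value \<open>T\<close>.\<close>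

lemma sum_powr_le:
  fixes f :: "'a \<Rightarrow> real"
  assumes "finite V" "\<And>v. v \<in> V \<Longrightarrow> f v \<ge> 0" "0 < \<theta>" "\<theta> \<le> 1"
  shows "(\<Sum>v\<in>V. f v powr \<theta>) \<le> real (card V) powr (1 - \<theta>) * (\<Sum>v\<in>V. f v) powr \<theta>"
proof (cases "(\<Sum>v\<in>V. f v) = 0")
  case True
  then have "f v = 0" if "v \<in> V" for v using sum_nonneg_eq_0_iff[of V f] assms that by auto
  then show ?thesis using True by simp
next
  case False
  define S where "S = (\<Sum>v\<in>V. f v)"
  define n where "n = real (card V)"
  have S: "S > 0" using False sum_nonneg[of V f] assms by (auto simp: S_def less_le)
  have "V \<noteq> {}" using False by auto
  then have n: "n > 0" using assms by (auto simp: n_def card_gt_0_iff)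
  define T where "T = S / n"
  have T: "T > 0" using S n by (simp add: T_def)
  have "f v powr \<theta> \<le> T powr \<theta> * (1 - \<theta> + \<theta> * (f v / T))" if "v \<in> V" for v
  proof (cases "f v = 0")
    case True
    then show ?thesis using assms T by (simp add: powr_def)
  next
    case False
    then have fv: "f v > 0" using assms that by (auto simp: less_le)
    have "(f v / T) powr \<theta> * 1 powr (1 - \<theta>) \<le> \<theta> * (f v / T) + (1 - \<theta>) * 1"
      using fv T assms by (intro Youngs_inequality_0) auto
    then have "T powr \<theta> * (f v / T) powr \<theta> \<le> T powr \<theta> * (1 - \<theta> + \<theta> * (f v / T))"
      by (intro mult_left_mono) auto
    moreover have "T powr \<theta> * (f v / T) powr \<theta> = f v powr \<theta>"
      using fv T by (simp flip: powr_mult)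
    ultimately show ?thesis by simp
  qed
  then have "(\<Sum>v\<in>V. f v powr \<theta>) \<le> (\<Sum>v\<in>V. T powr \<theta> * (1 - \<theta> + \<theta> * (f v / T)))" by (rule sum_mono)
  also have "\<dots> = T powr \<theta> * (n * (1 - \<theta>) + \<theta> * (S / T))"
    by (simp add: sum_distrib_left[symmetric] sum.distrib n_def S_def sum_divide_distrib[symmetric])
  also have "S / T = n" using S n by (simp add: T_def)
  also have "T powr \<theta> * (n * (1 - \<theta>) + \<theta> * n) = n powr (1 - \<theta>) * S powr \<theta>"
  proof -
    have "n powr (1 - \<theta>) = n / n powr \<theta>" using n by (simp add: powr_diff)
    moreover have "T powr \<theta> = S powr \<theta> / n powr \<theta>" using S n by (simp add: T_def powr_divide)
    ultimately show ?thesis by (simp add: algebra_simps)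
  qed
  finally show ?thesis by (simp add: n_def S_def)
qed

text \<open>For an irreflexive relation the counted vertices lie outside \<open>A\<close>, so this
  is the absence of K_{a,b} as a subgraph.\<close>

definition biclique_free :: "('a \<Rightarrow> 'a \<Rightarrow> bool) \<Rightarrow> 'a set \<Rightarrow> nat \<Rightarrow> nat \<Rightarrow> bool" where
  "biclique_free R V a b \<longleftrightarrow> (\<forall>A\<subseteq>V. card A = a \<longrightarrow> card {v \<in> V. \<forall>u\<in>A. R u v} < b)"

lemma biclique_free_nbrs:
  assumes "biclique_free R V (Suc a) b" "finite V" "v \<in> V"
  shows "biclique_free R (nbrs R V v) a b"
  unfolding biclique_free_def
proof (intro allI impI)
  fix A assume A: "A \<subseteq> nbrs R V v" "card A = a"
  have "finite A" using A assms finite_nbrs finite_subset by metis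
  moreover have "v \<notin> A" using A by (auto simp: nbrs_def)
  ultimately have "card (insert v A) = Suc a" using A by simp
  moreover have "insert v A \<subseteq> V" using A assms by (auto simp: nbrs_def)
  ultimately have "card {w \<in> V. \<forall>u\<in>insert v A. R u w} < b" using assms(1) unfolding biclique_free_def
    by blast
  moreover have "card {w \<in> nbrs R V v. \<forall>u\<in>A. R u w} \<le> card {w \<in> V. \<forall>u\<in>insert v A. R u w}"
    using assms by (intro card_mono) (auto simp: nbrs_def)
  ultimately show "card {w \<in> nbrs R V v. \<forall>u\<in>A. R u w} < b" by linarith
qed

text \<open>Stars with \<open>a\<close> leaves, counted by their centre and then by their set of
  leaves.\<close>

lemma sum_degree_choose_le:
  assumes "biclique_free R V a b" "finite V" "symp R"
  shows "(\<Sum>v\<in>V. card (nbrs R V v) choose a) \<le> (b - 1) * (card V choose a)"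
proof -
  let ?P = "{A. A \<subseteq> V \<and> card A = a}"
  have fP: "finite ?P" using assms by simp
  have "(\<Sum>v\<in>V. card (nbrs R V v) choose a) = (\<Sum>v\<in>V. card {A \<in> ?P. A \<subseteq> nbrs R V v})"
  proof (rule sum.cong[OF refl])
    fix v
    have "{A \<in> ?P. A \<subseteq> nbrs R V v} = {A. A \<subseteq> nbrs R V v \<and> card A = a}" by (auto simp: nbrs_def)
    then show "card (nbrs R V v) choose a = card {A \<in> ?P. A \<subseteq> nbrs R V v}"
      using n_subsets[of "nbrs R V v" a] assms finite_nbrs by metis
  qed
  also have "\<dots> = (\<Sum>A\<in>?P. card {v \<in> V. A \<subseteq> nbrs R V v})"
    using assms fP by (intro sum_card_filter_swap)
  also have "\<dots> \<le> (\<Sum>A\<in>?P. b - 1)"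
  proof (rule sum_mono)
    fix A assume A: "A \<in> ?P"
    have "card {v \<in> V. A \<subseteq> nbrs R V v} \<le> card {v \<in> V. \<forall>u\<in>A. R u v}"
      using assms by (intro card_mono) (auto simp: nbrs_def dest: sympD)
    also have "\<dots> < b" using A assms by (auto simp: biclique_free_def)
    finally show "card {v \<in> V. A \<subseteq> nbrs R V v} \<le> b - 1" by linarith
  qed
  also have "\<dots> = (b - 1) * (card V choose a)" using n_subsets[OF assms(2)] by simp
  finally show ?thesis .
qed

text \<open>Translates the binomials of the double count into the powers that Jensen's inequality
  requires; \<open>C\<close> covers the small degrees.\<close>

lemma power_le_choose:
  fixes \<delta> :: real
  assumes "\<delta> > 0"
  shows "\<exists>C\<ge>0. \<forall>d. real d ^ a \<le> (1 + \<delta>) * (fact a * real (d choose a)) + C"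
proof -
  have lim: "((\<lambda>d :: nat. (real d / (real d - real a)) ^ a) \<longlongrightarrow> 1 ^ a) at_top"
    by (intro tendsto_power) real_asymp
  then have "eventually (\<lambda>d :: nat. (real d / (real d - real a)) ^ a < 1 + \<delta>) at_top"
    using assms by (intro order_tendstoD(2)[OF lim]) auto
  then have "eventually (\<lambda>d :: nat. (real d / (real d - real a)) ^ a < 1 + \<delta> \<and> d > a) at_top"
    using eventually_gt_at_top[of a] by eventually_elim auto
  then obtain d0 where d0: "\<And>d. d \<ge> d0 \<Longrightarrow> (real d / (real d - real a)) ^ a < 1 + \<delta> \<and> d > a"
    by (auto simp: eventually_at_top_linorder)
  show ?thesis
  proof (intro exI[of _ "real d0 ^ a"] conjI allI)
    fix d :: nat
    show "real d ^ a \<le> (1 + \<delta>) * (fact a * real (d choose a)) + real d0 ^ a"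
    proof (cases "d \<ge> d0")
      case True
      then have d: "(real d / (real d - real a)) ^ a < 1 + \<delta>" "d > a" using d0 by auto
      have "(real d - real a) ^ a \<le> fact a * real (d choose a)"
      proof -
        have "(real d - real a) ^ a = (\<Prod>i<a. real d - real a)" by simp
        also have "\<dots> \<le> (\<Prod>i<a. real d - real i)" using d by (intro prod_mono) auto
        also have "\<dots> = fact a * real (d choose a)"
          by (simp add: binomial_gbinomial gbinomial_mult_fact lessThan_atLeast0)
        finally show ?thesis .
      qed
      moreover have "real d ^ a \<le> (1 + \<delta>) * (real d - real a) ^ a"
        using d by (simp add: power_divide divide_simps split: if_splits)
      ultimately have "real d ^ a \<le> (1 + \<delta>) * (fact a * real (d choose a))"
        using assms by (meson add_nonneg_nonneg less_imp_le mult_left_mono order_trans zero_le_one)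
      moreover have "real d0 ^ a \<ge> 0" by simp
      ultimately show ?thesis by linarith
    next
      case False
      then have "real d ^ a \<le> real d0 ^ a" by (intro power_mono) auto
      moreover have "0 \<le> (1 + \<delta>) * (fact a * real (d choose a))" using assms by simp
      ultimately show ?thesis by linarith
    qed
  qed simp
qed

definition clique_exponent :: "nat \<Rightarrow> nat \<Rightarrow> real" where
  "clique_exponent r a = real r * (real r - 1) / (2 * real a)"

text \<open>One induction step uses Jensen's inequality with exponent
  \<open>\<beta> / Suc a\<close>. This gives \<open>n\<close> the exponent
  \<open>1 + \<beta> - \<beta> / Suc a\<close> and \<open>b - 1\<close> an additional
  \<open>\<beta> / Suc a\<close>; that both keep their shape is the origin of
  \<open>clique_exponent\<close>.\<close>

lemma clique_exponent_step:
  fixes r a :: nat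
  assumes "a \<ge> 1"
  defines "\<beta> \<equiv> real r - clique_exponent r a"
  shows "1 + \<beta> - \<beta> / real (Suc a) = real (Suc r) - clique_exponent (Suc r) (Suc a)"
    and "clique_exponent r a + \<beta> / real (Suc a) = clique_exponent (Suc r) (Suc a)"
proof -
  have "real a > 0" using assms(1) by simp
  then show "1 + \<beta> - \<beta> / real (Suc a) = real (Suc r) - clique_exponent (Suc r) (Suc a)"
    "clique_exponent r a + \<beta> / real (Suc a) = clique_exponent (Suc r) (Suc a)"
    unfolding \<beta>_def clique_exponent_def of_nat_Suc
    by (simp add: divide_simps, simp add: algebra_simps)+
qed

lemma power_powr_divide: "x > 0 \<Longrightarrow> a > 0 \<Longrightarrow> (x ^ a) powr (\<beta> / real a) = x powr \<beta>"
  by (simp add: powr_powr flip: powr_realpow)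

text \<open>The additive \<open>C\<close>, uniform in \<open>V\<close> and \<open>R\<close>, makes
  the bound valid for vertex sets of every size: the induction applies it to all neighbourhoods,
  however small. The parameter \<open>a\<close> decreases together with \<open>r\<close>, so
  \<open>r \<le> a\<close> persists.\<close>

lemma cliques_count_upper:
  assumes "r \<ge> 1" "a \<ge> r" "b \<ge> 2" "\<epsilon> > (0 :: real)"
  shows "\<exists>C\<ge>0. \<forall>(V :: 'a set) R. finite V \<longrightarrow> symp R \<longrightarrow> biclique_free R V a b \<longrightarrow>
    real (card (cliques R V r)) \<le> (1 + \<epsilon>) / fact r * (real b - 1) powr clique_exponent r a
      * real (card V) powr (real r - clique_exponent r a) + C"
  using assms
proof (induction r arbitrary: a \<epsilon> rule: nat_induct_at_least)
  case base
  show ?case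
  proof (intro exI[of _ 0] conjI allI impI)
    fix V :: "'a set" and R assume V: "finite V"
    have "cliques R V 1 = (\<lambda>x. {x}) ` V"
      by (auto simp: cliques_def card_1_singleton_iff)
    then have "card (cliques R V 1) = card V" by (simp add: card_image)
    then show "real (card (cliques R V 1)) \<le> (1 + \<epsilon>) / fact 1 * (real b - 1) powr clique_exponent 1 a
      * real (card V) powr (real 1 - clique_exponent 1 a) + 0"
      using base by (simp add: clique_exponent_def powr_def mult_right_mono algebra_simps)
  qed simp
next
  case (Suc r)
  \<comment> \<open>For \<delta> at most 1 the final product
    \<open>(1 + \<delta>) * (1 + 3 * \<delta>)\<close> is at most
    \<open>1 + 7 * \<delta>\<close>.\<close>
  define \<delta> where "\<delta> = min 1 (\<epsilon> / 7)"
  have \<delta>: "\<delta> > 0" "\<delta> \<le> 1" "7 * \<delta> \<le> \<epsilon>" using Suc.prems by (auto simp: \<delta>_def)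
  obtain a' where a: "a = Suc a'" using Suc.prems by (cases a) auto
  have a': "a' \<ge> r" "a' \<ge> 1" using Suc a by auto
  define \<beta> where "\<beta> = real r - clique_exponent r a'"
  define \<gamma> where "\<gamma> = clique_exponent r a'"
  define E where "E = real (Suc r) - clique_exponent (Suc r) a"
  have ex: "1 + \<beta> - \<beta> / real a = E" "\<gamma> + \<beta> / real a = clique_exponent (Suc r) a"
    using clique_exponent_step[OF a'(2), of r] unfolding a \<beta>_def \<gamma>_def E_def by simp_all
  have \<gamma>: "\<gamma> \<ge> 0" "\<gamma> \<le> real r / 2"
  proof -
    show "\<gamma> \<ge> 0" using Suc.hyps by (simp add: \<gamma>_def clique_exponent_def)
    have "real r * (real r - 1) \<le> real r * real a'" using a' by (intro mult_left_mono) auto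
    then show "\<gamma> \<le> real r / 2" using a' by (simp add: \<gamma>_def clique_exponent_def field_simps)
  qed
  have \<beta>: "\<beta> > 0" "\<beta> \<le> real r" using \<gamma> Suc.hyps by (auto simp: \<beta>_def \<gamma>_def)
  define \<theta> where "\<theta> = \<beta> / real a"
  have \<theta>: "0 < \<theta>" "\<theta> \<le> 1" using \<beta> a' a by (auto simp: \<theta>_def divide_simps)
  have b: "real b - 1 \<ge> 1" using Suc.prems by simp
  have E1: "E > 1"
  proof -
    have "\<beta> / real a < \<beta>" using \<beta> a a' by (simp add: divide_simps)
    then show ?thesis using ex(1) by linarith
  qed
  obtain C1 where C1: "C1 \<ge> 0" "\<And>(V :: 'a set) R. finite V \<Longrightarrow> symp R \<Longrightarrow> biclique_free R V a' b \<Longrightarrow>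
    real (card (cliques R V r)) \<le> (1 + \<delta>) / fact r * (real b - 1) powr \<gamma> * real (card V) powr \<beta> + C1"
    using Suc.IH[OF a'(1) Suc.prems(2) \<delta>(1)] unfolding \<beta>_def \<gamma>_def by blast
  obtain C2 where C2: "C2 \<ge> 0" "\<And>d. real d ^ a \<le> (1 + \<delta>) * (fact a * real (d choose a)) + C2"
    using power_le_choose[OF \<delta>(1)] by blast
  define c1 where "c1 = (1 + \<delta>) / fact r * (real b - 1) powr \<gamma>"
  have c1: "c1 > 0" using \<delta> b by (simp add: c1_def)
  \<comment> \<open>From \<open>n0\<close> on, the additive constants summed over all vertices are
    \<delta>-fractions of the main terms. For \<open>n * C1\<close> this uses
    \<open>E > 1\<close>.\<close>
  have "filterlim (\<lambda>n :: nat. real n powr (E - 1)) at_top at_top"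
    using E1 by real_asymp
  then have "eventually (\<lambda>n :: nat. C1 / (\<delta> * c1) \<le> real n powr (E - 1)) at_top"
    by (auto simp: filterlim_at_top)
  moreover have "eventually (\<lambda>n :: nat. C2 / \<delta> \<le> real n) at_top"
    using filterlim_real_sequentially by (auto simp: filterlim_at_top)
  ultimately have "eventually (\<lambda>n :: nat. C1 / (\<delta> * c1) \<le> real n powr (E - 1) \<and> C2 / \<delta> \<le> real n
      \<and> n > 0) at_top"
    using eventually_gt_at_top[of 0] by eventually_elim auto
  then obtain n0 where n0: "\<And>n. n \<ge> n0 \<Longrightarrow> C1 / (\<delta> * c1) \<le> real n powr (E - 1) \<and> C2 / \<delta> \<le> real n \<and> n > 0"
    by (auto simp: eventually_at_top_linorder)
  show ?case
  \<comment> \<open>Below \<open>n0\<close> vertices the number of all subsets is a sufficient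
    bound.\<close>
  proof (intro exI[of _ "2 ^ n0"] conjI allI impI)
    fix V :: "'a set" and R assume V: "finite V" "symp R" "biclique_free R V a b"
    let ?bound = "(1 + \<epsilon>) / fact (Suc r) * (real b - 1) powr clique_exponent (Suc r) a
      * real (card V) powr (real (Suc r) - clique_exponent (Suc r) a)"
    define n where "n = real (card V)"
    have bound0: "?bound \<ge> 0" using Suc.prems by simp
    show "real (card (cliques R V (Suc r))) \<le> ?bound + 2 ^ n0"
    proof (cases "card V \<ge> n0")
      case False
      have "card (cliques R V (Suc r)) \<le> card (Pow V)"
        using V by (intro card_mono cliques_subset_Pow) auto
      also have "\<dots> \<le> 2 ^ n0" using False V by (simp add: card_Pow)
      finally have "real (card (cliques R V (Suc r))) \<le> 2 ^ n0"
        by (metis of_nat_le_iff of_nat_numeral of_nat_power)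
      then show ?thesis using bound0 by linarith
    next
      case True
      have n: "C1 / (\<delta> * c1) \<le> n powr (E - 1)" "C2 / \<delta> \<le> n" "n > 0"
        using n0[OF True] by (auto simp: n_def)
      define D where "D v = real (card (nbrs R V v))" for v
      have n1: "n \<ge> 1" using n(3) by (simp add: n_def)
      have "(\<Sum>v\<in>V. D v ^ a) \<le> (\<Sum>v\<in>V. (1 + \<delta>) * (fact a * real (card (nbrs R V v) choose a)) + C2)"
        unfolding D_def by (intro sum_mono C2)
      also have "\<dots> = (1 + \<delta>) * (fact a * real (\<Sum>v\<in>V. card (nbrs R V v) choose a)) + n * C2"
        by (simp add: sum.distrib sum_distrib_left n_def)
      also have "real (\<Sum>v\<in>V. card (nbrs R V v) choose a) \<le> real ((b - 1) * (card V choose a))"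
        using sum_degree_choose_le[OF V(3,1,2)] by (rule of_nat_mono)
      also have "fact a * real ((b - 1) * (card V choose a))
          = (real b - 1) * real ((card V choose a) * fact a)"
        using Suc.prems by (simp add: of_nat_diff)
      also have "real ((card V choose a) * fact a) \<le> real (card V ^ a)"
        by (rule of_nat_mono[OF binomial_fact_pow])
      finally have "(\<Sum>v\<in>V. D v ^ a) \<le> (1 + \<delta>) * ((real b - 1) * n ^ a) + n * C2"
        using \<delta> b by (simp add: n_def mult_left_mono)
      also have "n * C2 \<le> \<delta> * ((real b - 1) * n ^ a)"
      proof -
        have "n * C2 \<le> n * (\<delta> * n)" using n \<delta> by (intro mult_left_mono) (auto simp: field_simps)
        also have "\<dots> = \<delta> * n ^ 2" by (simp add: power2_eq_square)
        also have "\<dots> \<le> \<delta> * n ^ a" using n1 \<delta> a a' by (intro mult_left_mono power_increasing) auto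
        also have "\<dots> \<le> \<delta> * ((real b - 1) * n ^ a)" using b \<delta> n by (simp add: mult_left_mono)
        finally show ?thesis .
      qed
      finally have S: "(\<Sum>v\<in>V. D v ^ a) \<le> (1 + 2 * \<delta>) * ((real b - 1) * n ^ a)" by (simp add: algebra_simps)
      have "(\<Sum>v\<in>V. D v powr \<beta>) = (\<Sum>v\<in>V. (D v ^ a) powr \<theta>)"
      proof (rule sum.cong[OF refl])
        fix v
        show "D v powr \<beta> = (D v ^ a) powr \<theta>"
        proof (cases "D v = 0")
          case False
          then have "D v > 0" by (simp add: D_def)
          then show ?thesis using a unfolding \<theta>_def by (intro power_powr_divide[symmetric]) auto
        qed (simp add: a)
      qed
      also have "\<dots> \<le> n powr (1 - \<theta>) * (\<Sum>v\<in>V. D v ^ a) powr \<theta>"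
        unfolding n_def using V \<theta> by (intro sum_powr_le) (auto simp: D_def)
      also have "\<dots> \<le> n powr (1 - \<theta>) * ((1 + 2 * \<delta>) * ((real b - 1) * n ^ a)) powr \<theta>"
        using S \<theta> by (intro mult_left_mono powr_mono2) (auto simp: D_def intro: sum_nonneg)
      also have "\<dots> = n powr (1 - \<theta>) * ((1 + 2 * \<delta>) powr \<theta> * ((real b - 1) powr \<theta> * (n ^ a) powr \<theta>))"
        using \<delta> b n by (simp add: powr_mult)
      also have "(n ^ a) powr \<theta> = n powr \<beta>"
        using n a unfolding \<theta>_def by (intro power_powr_divide) auto
      also have "n powr (1 - \<theta>) * ((1 + 2 * \<delta>) powr \<theta> * ((real b - 1) powr \<theta> * n powr \<beta>))
        = (1 + 2 * \<delta>) powr \<theta> * (real b - 1) powr \<theta> * n powr E"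
        unfolding ex(1)[symmetric] using n by (simp add: powr_add powr_diff \<theta>_def)
      also have "\<dots> \<le> (1 + 2 * \<delta>) * (real b - 1) powr \<theta> * n powr E"
        using \<delta> \<theta> powr_mono[of \<theta> 1 "1 + 2 * \<delta>"] by (intro mult_right_mono) auto
      finally have DB: "(\<Sum>v\<in>V. D v powr \<beta>) \<le> (1 + 2 * \<delta>) * (real b - 1) powr \<theta> * n powr E" .
      have "real (Suc r) * real (card (cliques R V (Suc r)))
          = (\<Sum>v\<in>V. real (card (cliques R (nbrs R V v) r)))"
        using clique_double_count[OF V(1,2), of r] by (metis of_nat_mult of_nat_sum)
      also have "\<dots> \<le> (\<Sum>v\<in>V. c1 * D v powr \<beta> + C1)"
        unfolding c1_def D_def using V biclique_free_nbrs[of R V a' b] finite_nbrs[of V R] a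
        by (intro sum_mono C1) auto
      also have "\<dots> = c1 * (\<Sum>v\<in>V. D v powr \<beta>) + n * C1"
        by (simp add: sum.distrib sum_distrib_left n_def)
      also have "\<dots> \<le> c1 * ((1 + 2 * \<delta>) * (real b - 1) powr \<theta> * n powr E) + \<delta> * c1 * n powr E"
      proof (intro add_mono mult_left_mono DB)
        have "C1 \<le> \<delta> * c1 * n powr (E - 1)" using n(1) \<delta> c1 by (simp add: field_simps)
        then have "n * C1 \<le> n * (\<delta> * c1 * n powr (E - 1))" using n by (intro mult_left_mono) auto
        also have "\<dots> = \<delta> * c1 * n powr E" using n by (simp add: powr_diff)
        finally show "n * C1 \<le> \<delta> * c1 * n powr E" .
      qed (use c1 in auto)
      also have "\<delta> * c1 * n powr E \<le> \<delta> * c1 * ((real b - 1) powr \<theta> * n powr E)"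
        using \<delta> c1 b \<theta> ge_one_powr_ge_zero[of "real b - 1" \<theta>]
          by (intro mult_left_mono) (auto simp: mult_le_cancel_right1)
      finally have "real (Suc r) * real (card (cliques R V (Suc r)))
          \<le> c1 * (1 + 3 * \<delta>) * ((real b - 1) powr \<theta> * n powr E)"
        by (simp add: algebra_simps)
      also have "\<dots> = ((1 + \<delta>) * (1 + 3 * \<delta>)) * ((real b - 1) powr (\<gamma> + \<theta>) * n powr E / fact r)"
        using b by (simp add: c1_def powr_add)
      also have "\<dots> \<le> (1 + \<epsilon>) * ((real b - 1) powr (\<gamma> + \<theta>) * n powr E / fact r)"
      proof (rule mult_right_mono)
        have "\<delta> * \<delta> \<le> \<delta>" using \<delta> by (simp add: mult_left_le)
        moreover have "(1 + \<delta>) * (1 + 3 * \<delta>) = 1 + 4 * \<delta> + 3 * (\<delta> * \<delta>)" by (simp add: algebra_simps)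
        ultimately show "(1 + \<delta>) * (1 + 3 * \<delta>) \<le> 1 + \<epsilon>" using \<delta> by linarith
      qed (use b in auto)
      finally have "real (Suc r) * real (card (cliques R V (Suc r)))
         \<le> (1 + \<epsilon>) * ((real b - 1) powr (\<gamma> + \<theta>) * n powr E / fact r)" .
      then have "real (card (cliques R V (Suc r)))
          \<le> (1 + \<epsilon>) * ((real b - 1) powr (\<gamma> + \<theta>) * n powr E / fact r) / real (Suc r)"
        by (subst pos_le_divide_eq) (simp_all only: of_nat_0_less_iff zero_less_Suc mult.commute)
      also have "\<dots> = ?bound" unfolding \<theta>_def ex(2) by (simp add: E_def n_def mult_ac)
      finally show ?thesis using zero_le_power[of "2 :: real" n0] by linarith
    qed
  qed simp
qed

section \<open>The zeta function on the line of real part one\<close>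

lemma norm_of_nat_powr: "cmod (of_nat n powr s) = real n powr Re s"
  by (subst norm_powr_real_powr) auto

lemma summable_of_nat_powr: "Re s > 1 \<Longrightarrow> summable (\<lambda>n. cmod (of_nat n powr (- s)))"
  by (simp add: norm_of_nat_powr summable_real_powr_iff)

lemma summable_ln_powr: "\<sigma> > 1 \<Longrightarrow> summable (\<lambda>n. ln (real n) * real n powr (- \<sigma>))"
proof (rule summable_comparison_test')
  assume \<sigma>: "\<sigma> > 1"
  let ?a = "(\<sigma> - 1) / 2"
  show "summable (\<lambda>n. (1 / ?a) * real n powr (- (\<sigma> + 1) / 2))"
    using \<sigma> by (intro summable_mult) (simp add: summable_real_powr_iff field_simps)
  fix n :: nat assume n: "n \<ge> 1"
  have "ln (real n) \<le> real n powr ?a / ?a" using n \<sigma> by (intro ln_powr_bound) auto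
  then have "ln (real n) * real n powr (- \<sigma>) \<le> real n powr ?a / ?a * real n powr (- \<sigma>)"
    by (intro mult_right_mono) auto
  also have "\<dots> = (1 / ?a) * (real n powr ?a * real n powr (- \<sigma>))" by simp
  also have "real n powr ?a * real n powr (- \<sigma>) = real n powr (?a - \<sigma>)" by (simp flip: powr_add)
  also have "?a - \<sigma> = - (\<sigma> + 1) / 2" by (simp add: field_simps)
  finally show "norm (ln (real n) * real n powr (- \<sigma>)) \<le> (1 / ?a) * real n powr (- (\<sigma> + 1) / 2)"
    using n by simp
qed

lemma summable_mangoldt_powr:
  assumes "\<sigma> > 1"
  shows "summable (\<lambda>n. mangoldt n * real n powr (- \<sigma>))"
proof (rule summable_comparison_test'[OF summable_ln_powr[OF assms]])
  fix n :: nat assume n: "n \<ge> 1"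
  have "mangoldt n \<le> ln (real n)" using mangoldt_le[of n] n by simp
  then show "norm (mangoldt n * real n powr (- \<sigma>)) \<le> ln (real n) * real n powr (- \<sigma>)"
    by (simp add: mult_right_mono mangoldt_nonneg)
qed

text \<open>The term at 0 vanishes because \<open>0 powr z = 0\<close>.\<close>

definition zeta_sum :: "complex \<Rightarrow> complex" where
  "zeta_sum s = (\<Sum>n. of_nat n powr (- s))"

definition mangoldt_sum :: "complex \<Rightarrow> complex" where
  "mangoldt_sum s = (\<Sum>n. mangoldt n * of_nat n powr (- s))"

lemma summable_norm_mangoldt_powr:
  "Re s > 1 \<Longrightarrow> summable (\<lambda>n. cmod (mangoldt n * of_nat n powr (- s)))"
  using summable_mangoldt_powr[of "Re s"] by (simp add: norm_mult norm_of_nat_powr)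

lemma deriv_zeta_sum:
  assumes s: "Re s > 1"
  shows "(\<lambda>n. - (of_real (ln (real n)) * of_nat n powr (- s))) sums deriv zeta_sum s"
    and "zeta_sum field_differentiable at s"
proof -
  define c where "c = (Re s + 1) / 2"
  have c: "c > 1" "c < Re s" using s by (auto simp: c_def)
  let ?A = "{z. Re z > c}"
  have opn: "open ?A" by (rule open_halfspace_Re_gt)
  have ul: "uniform_limit ?A (\<lambda>n z. \<Sum>i<n. of_nat i powr (- z)) (\<lambda>z. \<Sum>i. of_nat i powr (- z)) sequentially"
  proof (rule Weierstrass_m_test)
    show "summable (\<lambda>n. real n powr (- c))" using c by (simp add: summable_real_powr_iff)
    fix n :: nat and z assume "z \<in> ?A"
    then show "cmod (of_nat n powr (- z)) \<le> real n powr (- c)"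
      by (cases "n = 0") (auto simp: norm_of_nat_powr intro!: powr_mono)
  qed
  have hd: "((\<lambda>z. of_nat i powr (- z)) has_field_derivative
      - (of_real (ln (real i)) * of_nat i powr (- z))) (at z)"
    for i :: nat and z :: complex
  proof (cases "i = 0")
    case False
    then have "((\<lambda>z. of_nat i powr z) has_field_derivative Ln (of_nat i) * of_nat i powr (- z)) (at (- z))"
      by (intro has_field_derivative_powr_right) simp
    from DERIV_chain2[OF this DERIV_minus[OF DERIV_ident]] show ?thesis
      using False by (simp add: Ln_of_nat)
  qed simp
  have hd': "((\<lambda>z. \<Sum>i<n. of_nat i powr (- z)) has_field_derivative (\<Sum>i<n.
      - (of_real (ln (real i)) * of_nat i powr (- z)))) (at z)"
    for n :: nat and z :: complex
    by (intro DERIV_sum hd)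
  then have hol: "(\<lambda>z. \<Sum>i<n. of_nat i powr (- z)) holomorphic_on ?A" for n :: nat
    unfolding holomorphic_on_open[OF opn] by blast
  have "(\<lambda>n. deriv (\<lambda>z. \<Sum>i<n. of_nat i powr (- z)) s) \<longlonglongrightarrow> deriv (\<lambda>z. \<Sum>i. of_nat i powr (- z)) s"
    using hol opn c by (intro deriv_complex_uniform_limit[OF ul]) auto
  then show "(\<lambda>n. - (of_real (ln (real n)) * of_nat n powr (- s))) sums deriv zeta_sum s"
    unfolding sums_def zeta_sum_def[abs_def] using DERIV_imp_deriv[OF hd'] by simp
  have "(\<lambda>z. \<Sum>i. of_nat i powr (- z)) holomorphic_on ?A"
  proof (rule holomorphic_uniform_sequence[OF opn hol])
    fix x assume "x \<in> ?A"
    then obtain d where "d > 0" "cball x d \<subseteq> ?A" using opn open_contains_cball by blast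
    then show "\<exists>d>0. cball x d \<subseteq> ?A
        \<and> uniform_limit (cball x d) (\<lambda>n z. \<Sum>i<n. of_nat i powr (- z)) (\<lambda>z. \<Sum>i. of_nat i powr (- z))
        sequentially"
      using uniform_limit_on_subset[OF ul] by blast
  qed
  then show "zeta_sum field_differentiable at s"
    unfolding zeta_sum_def[abs_def] using opn c by (auto intro: holomorphic_on_imp_differentiable_at)
qed

text \<open>The Dirichlet convolution of \<open>mangoldt\<close> with 1 is the logarithm. The
  absolutely convergent double series over \<open>(d, m)\<close> is regrouped by
  \<open>n = d * m\<close> and compared with the termwise derivative.\<close>

lemma zeta_mult_mangoldt:
  assumes s: "Re s > 1"
  shows "zeta_sum s * mangoldt_sum s = - deriv zeta_sum s"
proof -
  let ?g = "\<lambda>n. of_nat n powr (- s) :: complex"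
  let ?f = "\<lambda>n. mangoldt n * ?g n"
  have f: "(?f has_sum mangoldt_sum s) UNIV"
    unfolding mangoldt_sum_def using summable_norm_mangoldt_powr[OF s]
    by (intro norm_summable_imp_has_sum) (auto intro: summable_sums summable_norm_cancel)
  have g: "(?g has_sum zeta_sum s) UNIV"
    unfolding zeta_sum_def using summable_of_nat_powr[OF s]
    by (intro norm_summable_imp_has_sum) (auto intro: summable_sums summable_norm_cancel)
  have f1: "(?f has_sum mangoldt_sum s) {0<..}" and g1: "(?g has_sum zeta_sum s) {0<..}"
    using f g by (auto elim!: has_sum_cong_neutral[THEN iffD1, rotated -1])
  have fa: "(\<lambda>n. norm (?f n)) summable_on {0<..}"
    using summable_norm_mangoldt_powr[OF s] summable_on_subset_banach[of "\<lambda>n. norm (?f n)" UNIV "{0<..}"]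
    by (auto simp: summable_on_UNIV_nonneg_real_iff)
  have ga: "(\<lambda>n. norm (?g n)) summable_on {0<..}"
    using summable_of_nat_powr[OF s] summable_on_subset_banach[of "\<lambda>n. norm (?g n)" UNIV "{0<..}"]
    by (auto simp: summable_on_UNIV_nonneg_real_iff)
  have prod: "((\<lambda>(d, m). ?f d * ?g m) has_sum (mangoldt_sum s * zeta_sum s)) ({0<..} \<times> {0<..})"
  proof -
    have "(\<lambda>(d, m). ?f d * ?g m) summable_on ({0<..} \<times> {0<..})"
    proof (rule Infinite_Sum.abs_summable_summable, subst Infinite_Sum.abs_summable_on_Sigma_iff, intro
      conjI ballI)
      show "(\<lambda>y. norm (case (x, y) of (d, m) \<Rightarrow> ?f d * ?g m)) summable_on {0<..}" for x
        using summable_on_cmult_right[OF ga, of "norm (?f x)"] by (simp add: norm_mult)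
      have "(\<Sum>\<^sub>\<infinity>y\<in>{0<..}. norm (case (x, y) of (d, m) \<Rightarrow> ?f d * ?g m))
          = norm (?f x) * (\<Sum>\<^sub>\<infinity>y\<in>{0<..}. norm (?g y))" for x
        by (simp add: norm_mult infsum_cmult_right[OF ga] del: norm_mangoldt flip: mult.assoc)
      moreover have "0 \<le> (\<Sum>\<^sub>\<infinity>y\<in>{0<..}. norm (?g y))" by (rule infsum_nonneg) simp
      ultimately show "(\<lambda>x. norm (\<Sum>\<^sub>\<infinity>y\<in>{0<..}. norm (case (x, y) of (d, m) \<Rightarrow> ?f d * ?g m))) summable_on {0<..}"
        using summable_on_cmult_left[OF fa] by simp
    qed
    then obtain S where S: "((\<lambda>(d, m). ?f d * ?g m) has_sum S) ({0<..} \<times> {0<..})"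
      by (auto simp: summable_on_def)
    have "((\<lambda>d. ?f d * zeta_sum s) has_sum S) {0<..}"
      by (rule has_sum_SigmaD[OF S]) (simp add: has_sum_cmult_right[OF g1])
    moreover have "((\<lambda>d. ?f d * zeta_sum s) has_sum (mangoldt_sum s * zeta_sum s)) {0<..}"
      by (rule has_sum_cmult_left[OF f1])
    ultimately have "S = mangoldt_sum s * zeta_sum s" by (rule has_sum_unique)
    then show ?thesis using S by simp
  qed
  have "((\<lambda>(n, d). mangoldt d * ?g n) has_sum (mangoldt_sum s * zeta_sum s)) (SIGMA n:{0<..}. {d. d dvd n})"
  proof (subst has_sum_reindex_bij_witness[where i = "\<lambda>(d, m). (d * m, d)" and j = "\<lambda>(n, d). (d, n div d)"
        and T = "{0<..} \<times> {0<..}" and h = "\<lambda>(d, m). ?f d * ?g m" and s' = "mangoldt_sum s * zeta_sum s"])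
    show "((\<lambda>(d, m). ?f d * ?g m) has_sum (mangoldt_sum s * zeta_sum s)) ({0<..} \<times> {0<..})" by fact
    show "(case case a of (n, d) \<Rightarrow> (d, n div d) of (d, m) \<Rightarrow> ?f d * ?g m)
        = (case a of (n, d) \<Rightarrow> mangoldt d * ?g n)"
      if aS: "a \<in> (SIGMA n:{0<..}. {d. d dvd n})" for a
    proof -
      obtain n d where a: "a = (n, d)" "d dvd n" "n > 0" using aS by auto
      then obtain k where "n = d * k" "d > 0" by (auto elim: dvdE)
      moreover have "?g (d * k) = ?g d * ?g k" by (simp add: powr_times_real)
      ultimately show ?thesis using a by simp
    qed
  qed (auto elim: dvdE)
  then have "((\<lambda>n. of_real (ln (real n)) * ?g n) has_sum (mangoldt_sum s * zeta_sum s)) {0<..}"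
  proof (rule has_sum_SigmaD)
    fix n :: nat assume "n \<in> {0<..}"
    then have n: "n > 0" by simp
    have "((\<lambda>d. mangoldt d * ?g n) has_sum (\<Sum>d | d dvd n. mangoldt d * ?g n)) {d. d dvd n}"
      using n by (intro has_sum_finite) auto
    also have "(\<Sum>d | d dvd n. mangoldt d * ?g n) = of_real (ln (real n)) * ?g n"
      using n by (simp add: sum_distrib_right[symmetric] mangoldt_sum)
    finally show "((\<lambda>y. case (n, y) of (n, d) \<Rightarrow> mangoldt d * ?g n) has_sum of_real (ln (real n))
        * ?g n) {d. d dvd n}"
      by simp
  qed
  then have "((\<lambda>n. of_real (ln (real n)) * ?g n) has_sum (mangoldt_sum s * zeta_sum s)) UNIV"
    by (auto elim!: has_sum_cong_neutral[THEN iffD1, rotated -1])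
  then have "(\<lambda>n. of_real (ln (real n)) * ?g n) sums (mangoldt_sum s * zeta_sum s)"
    by (rule has_sum_imp_sums)
  then have "(\<lambda>n. - (of_real (ln (real n)) * ?g n)) sums (- (mangoldt_sum s * zeta_sum s))"
    by (rule sums_minus)
  then have "- (mangoldt_sum s * zeta_sum s) = deriv zeta_sum s"
    using deriv_zeta_sum(1)[OF s] by (rule sums_unique2)
  then show ?thesis by (simp add: minus_equation_iff mult.commute)
qed

section \<open>Continuation of the zeta function beyond its pole\<close>

definition zeta_term :: "nat \<Rightarrow> complex \<Rightarrow> complex" where
  "zeta_term n s = (s - 1) * of_nat (Suc n) powr (- s) - of_nat (Suc n) powr (1 - s)
     + of_nat (Suc (Suc n)) powr (1 - s)"

text \<open>The second-order Taylor remainder of \<open>x \<mapsto> x powr (1 - s)\<close>; summing it gives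
  \<open>(s - 1) * zeta_sum s - 1\<close>, which therefore continues to \<open>Re s > 0\<close>.\<close>
lemma norm_zeta_term_le:
  assumes s: "Re s > 0"
  shows "cmod (zeta_term n s) \<le> cmod s * cmod (s - 1) * real (Suc n) powr (- Re s - 1)"
proof -
  define f :: "nat \<Rightarrow> complex \<Rightarrow> complex" where
    "f i z = (if i = 0 then z powr (1 - s) else if i = 1 then (1 - s) * z powr (- s)
      else (1 - s) * (- s) * z powr (- s - 1))" for i z
  have f0: "f 0 = (\<lambda>z. z powr (1 - s))" and f1: "f 1 = (\<lambda>z. (1 - s) * z powr (- s))"
    and f2: "f 2 = (\<lambda>z. (1 - s) * (- s) * z powr (- s - 1))"
    by (auto simp: f_def)
  \<comment> \<open>A real ray away from the branch cut; along it the norm of the second derivative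
    is largest at the endpoint.\<close>
  let ?S = "{z. Im z = 0 \<and> real (Suc n) \<le> Re z}"
  have nz: "z \<notin> \<real>\<^sub>\<le>\<^sub>0" if "z \<in> ?S" for z
    using that by (auto simp: complex_nonpos_Reals_iff)
  have "cmod (f 0 (of_nat (Suc (Suc n)))
      - (\<Sum>i\<le>1. f i (of_nat (Suc n)) * (of_nat (Suc (Suc n)) - of_nat (Suc n)) ^ i / fact i))
     \<le> (cmod s * cmod (s - 1) * real (Suc n) powr (- Re s - 1)) * cmod
       (of_nat (Suc (Suc n)) - of_nat (Suc n)) ^ Suc 1 / fact 1"
  proof (rule complex_Taylor[where S = ?S and f = f and n = 1])
    show "convex ?S"
    proof (rule convexI, clarify)
      fix x y :: complex and u v :: real
      assume *: "0 \<le> u" "0 \<le> v" "u + v = 1" "Im x = 0" "real (Suc n) \<le> Re x" "Im y = 0" "real (Suc n)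
          \<le> Re y"
      have "u * real (Suc n) + v * real (Suc n) \<le> u * Re x + v * Re y"
        using * by (intro add_mono mult_left_mono) auto
      then have "real (Suc n) \<le> u * Re x + v * Re y" using *(3) by (metis distrib_right mult_1)
      then show "Im (u *\<^sub>R x + v *\<^sub>R y) = 0 \<and> real (Suc n) \<le> Re (u *\<^sub>R x + v *\<^sub>R y)" using * by simp
    qed
    have d0: "(f 0 has_field_derivative f 1 x) (at x within ?S)" if "x \<in> ?S" for x
    proof -
      have "((\<lambda>z. z powr (1 - s)) has_field_derivative (1 - s) * x powr (1 - s - 1)) (at x within ?S)"
        by (rule has_field_derivative_at_within[OF has_field_derivative_powr[OF nz[OF that]]])
      moreover have "1 - s - 1 = - s" by simp
      ultimately show ?thesis unfolding f0 f1 by (simp only:)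
    qed
    have d1: "(f 1 has_field_derivative f 2 x) (at x within ?S)" if "x \<in> ?S" for x
    proof -
      have "((\<lambda>z. z powr (- s)) has_field_derivative (- s) * x powr (- s - 1)) (at x within ?S)"
        by (rule has_field_derivative_at_within[OF has_field_derivative_powr[OF nz[OF that]]])
      then have "((\<lambda>z. (1 - s) * z powr (- s)) has_field_derivative (1 - s)
          * ((- s) * x powr (- s - 1))) (at x within ?S)"
        by (rule DERIV_cmult)
      then show ?thesis unfolding f1 f2 by (simp only: mult.assoc)
    qed
    show "(f i has_field_derivative f (Suc i) x) (at x within ?S)" if "x \<in> ?S" "i \<le> 1" for i x
    proof (cases "i = 0")
      case True
      then show ?thesis using d0[OF that(1)] by simp
    next
      case False
      then have "i = 1" using that by simp
      then show ?thesis using d1[OF that(1)] by (simp add: numeral_2_eq_2)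
    qed
    show "cmod (f (Suc 1) x) \<le> cmod s * cmod (s - 1) * real (Suc n) powr (- Re s - 1)" if x: "x \<in> ?S" for x
    proof -
      have "x \<in> \<real>" using x by (simp add: complex_is_Real_iff)
      then have "cmod (x powr (- s - 1)) = Re x powr (- Re s - 1)"
        using x by (subst norm_powr_real_powr) auto
      also have "\<dots> \<le> real (Suc n) powr (- Re s - 1)" using x s by (intro powr_mono2') auto
      finally have "cmod s * cmod (s - 1) * cmod (x powr (- s - 1))
          \<le> cmod s * cmod (s - 1) * real (Suc n) powr (- Re s - 1)"
        by (intro mult_left_mono) auto
      then show ?thesis by (simp add: f_def norm_mult norm_minus_commute mult_ac)
    qed
  qed auto
  then show ?thesis by (simp add: f_def zeta_term_def algebra_simps)
qed

definition zeta_reg :: "complex \<Rightarrow> complex" where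
  "zeta_reg s = 1 + (\<Sum>n. zeta_term n s)"

lemma summable_Suc_powr: "\<sigma> > 0 \<Longrightarrow> summable (\<lambda>n. real (Suc n) powr (- \<sigma> - 1))"
  by (subst summable_Suc_iff) (simp add: summable_real_powr_iff)

lemma zeta_reg_holomorphic: "zeta_reg holomorphic_on {s. Re s > 0}"
proof -
  let ?A = "{s. Re s > 0}"
  have opn: "open ?A" by (rule open_halfspace_Re_gt)
  have "(\<lambda>s. \<Sum>n. zeta_term n s) holomorphic_on ?A"
  proof (rule holomorphic_uniform_sequence[OF opn, where f = "\<lambda>n s. \<Sum>i<n. zeta_term i s"])
    have "zeta_term i holomorphic_on ?A" for i
      unfolding zeta_term_def[abs_def] by (intro holomorphic_intros)
    then show "(\<lambda>s. \<Sum>i<n. zeta_term i s) holomorphic_on ?A" for n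
      by (intro holomorphic_on_sum)
    fix x assume x: "x \<in> ?A"
    define d where "d = Re x / 2"
    have d: "d > 0" using x by (simp add: d_def)
    have Re: "Re s \<ge> d" if "s \<in> cball x d" for s
      using that abs_Re_le_cmod[of "x - s"] by (auto simp: dist_norm d_def abs_le_iff)
    define B where "B = cmod x + d"
    have B: "cmod s \<le> B" if "s \<in> cball x d" for s
      using that norm_triangle_ineq2[of s x] by (auto simp: B_def dist_norm norm_minus_commute)
    have "uniform_limit (cball x d) (\<lambda>n s. \<Sum>i<n. zeta_term i s) (\<lambda>s. \<Sum>n. zeta_term n s) sequentially"
    proof (rule Weierstrass_m_test)
      show "summable (\<lambda>n. B * (B + 1) * real (Suc n) powr (- d - 1))"
        using summable_Suc_powr[OF d] by (rule summable_mult)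
      fix n s assume s: "s \<in> cball x d"
      have "cmod (zeta_term n s) \<le> cmod s * cmod (s - 1) * real (Suc n) powr (- Re s - 1)"
        using Re[OF s] d by (intro norm_zeta_term_le) auto
      also have "\<dots> \<le> B * (B + 1) * real (Suc n) powr (- d - 1)"
      proof (intro mult_mono)
        show "cmod (s - 1) \<le> B + 1" using B[OF s] norm_triangle_ineq4[of s 1] by simp
        show "real (Suc n) powr (- Re s - 1) \<le> real (Suc n) powr (- d - 1)"
          using Re[OF s] by (intro powr_mono) auto
      qed (use B[OF s] d in \<open>auto simp: B_def\<close>)
      finally show "cmod (zeta_term n s) \<le> B * (B + 1) * real (Suc n) powr (- d - 1)" .
    qed
    moreover have "cball x d \<subseteq> ?A" using Re d by force
    ultimately show "\<exists>d>0. cball x d \<subseteq> ?A \<and>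
        uniform_limit (cball x d) (\<lambda>n s. \<Sum>i<n. zeta_term i s) (\<lambda>s. \<Sum>n. zeta_term n s) sequentially"
      using d by blast
  qed
  then show ?thesis unfolding zeta_reg_def[abs_def] by (intro holomorphic_intros)
qed

lemma zeta_reg_eq:
  assumes s: "Re s > 1"
  shows "zeta_reg s = (s - 1) * zeta_sum s"
proof -
  have "(\<lambda>n. of_nat n powr (- s)) sums zeta_sum s"
    unfolding zeta_sum_def using summable_of_nat_powr[OF s]
      by (intro summable_sums) (rule summable_norm_cancel)
  then have "(\<lambda>n. of_nat (Suc n) powr (- s)) sums zeta_sum s"
    using sums_Suc_iff[of "\<lambda>n. of_nat n powr (- s)" "zeta_sum s"] by simp
  then have 1: "(\<lambda>n. (s - 1) * of_nat (Suc n) powr (- s)) sums ((s - 1) * zeta_sum s)" by (rule sums_mult)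
  have "(\<lambda>n. of_nat (Suc n) powr (1 - s)) \<longlonglongrightarrow> 0"
  proof (rule tendsto_norm_zero_cancel)
    have "(\<lambda>n. real (Suc n) powr (1 - Re s)) \<longlonglongrightarrow> 0"
      using s by (intro tendsto_neg_powr filterlim_compose[OF filterlim_real_sequentially filterlim_Suc])
        auto
    then show "(\<lambda>n. cmod (of_nat (Suc n) powr (1 - s))) \<longlonglongrightarrow> 0"
      by (simp add: norm_of_nat_powr del: of_nat_Suc)
  qed
  then have "(\<lambda>n. of_nat (Suc (Suc n)) powr (1 - s) - of_nat (Suc n) powr (1 - s)) sums (0
      - of_nat (Suc 0) powr (1 - s))"
    by (rule telescope_sums)
  from sums_add[OF 1 this] have "(\<lambda>n. zeta_term n s) sums ((s - 1) * zeta_sum s - 1)"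
    by (simp add: zeta_term_def algebra_simps)
  then show ?thesis by (simp add: zeta_reg_def sums_iff)
qed

text \<open>Every \<open>zeta_term\<close> vanishes at 1, which says that the residue of the zeta
  function is 1. The value also shows that \<open>zeta_reg\<close> is not identically 0, as needed
  for orders of zeros.\<close>

lemma zeta_reg_1: "zeta_reg 1 = 1"
  by (simp add: zeta_reg_def zeta_term_def del: of_nat_Suc)

lemma deriv_zeta_reg:
  assumes s: "Re s > 1"
  shows "deriv zeta_reg s = zeta_reg s * (1 / (s - 1) - mangoldt_sum s)"
proof -
  have s1: "s \<noteq> 1" using s by auto
  have "((\<lambda>s. (s - 1) * zeta_sum s) has_field_derivative (zeta_sum s + deriv zeta_sum s * (s - 1))) (at s)"
    using deriv_zeta_sum(2)[OF s]
      by (auto intro!: derivative_eq_intros simp: DERIV_deriv_iff_field_differentiable)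
  then have "(zeta_reg has_field_derivative (zeta_sum s + deriv zeta_sum s * (s - 1))) (at s)"
  proof (rule has_field_derivative_transform_within_open)
    show "open {z. Re z > 1}" by (rule open_halfspace_Re_gt)
  qed (use s zeta_reg_eq in auto)
  then have "deriv zeta_reg s = zeta_sum s - zeta_sum s * mangoldt_sum s * (s - 1)"
    using zeta_mult_mangoldt[OF s] by (simp add: DERIV_imp_deriv)
  moreover have "(s - 1) * zeta_sum s * (1 / (s - 1) - mangoldt_sum s)
      = (s - 1) * (1 / (s - 1)) * zeta_sum s - zeta_sum s * mangoldt_sum s * (s - 1)"
  proof -
    have "a * z * (x - m) = a * x * z - z * m * a" for a x z m :: complex by (simp add: algebra_simps)
    then show ?thesis by blast
  qed
  ultimately show ?thesis unfolding zeta_reg_eq[OF s] using s1 by simp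
qed

text \<open>The limit is the order of the zero at \<open>s0\<close>, read off from a factorisation
  \<open>(s - s0) ^ n * g s\<close>. It matters that this order is an integer.\<close>

lemma log_deriv_limit:
  assumes f: "f holomorphic_on S" "open S" "connected S" "s0 \<in> S" and nz: "z \<in> S" "f z \<noteq> 0"
  shows "\<exists>m :: nat. ((\<lambda>s. (s - s0) * deriv f s / f s) \<longlongrightarrow> of_nat m) (at s0) \<and> (m = 0 \<longleftrightarrow> f s0 \<noteq> 0)"
proof (cases "f s0 = 0")
  case False
  have "isCont f s0" "isCont (deriv f) s0"
    using holomorphic_on_imp_differentiable_at[OF f(1,2,4)]
      holomorphic_on_imp_differentiable_at[OF holomorphic_deriv[OF f(1,2)] f(2,4)]
    by (auto intro: field_differentiable_imp_continuous_at)
  then have "((\<lambda>s. (s - s0) * deriv f s / f s) \<longlongrightarrow> (s0 - s0) * deriv f s0 / f s0) (at s0)"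
    using False by (intro tendsto_intros) (auto simp: isCont_def)
  then show ?thesis using False by (intro exI[of _ 0]) simp
next
  case True
  have nc: "\<not> f constant_on S" using nz True f(4) unfolding constant_on_def by metis
  obtain g r n where g: "0 < n" "0 < r" "ball s0 r \<subseteq> S" "g holomorphic_on ball s0 r"
    "\<And>w. w \<in> ball s0 r \<Longrightarrow> f w = (w - s0) ^ n * g w" "\<And>w. w \<in> ball s0 r \<Longrightarrow> g w \<noteq> 0"
    by (rule holomorphic_factor_zero_nonconstant[OF f True nc], rule that)
  have s0: "s0 \<in> ball s0 r" using g by simp
  have "isCont g s0" "isCont (deriv g) s0"
    using holomorphic_on_imp_differentiable_at[OF g(4) open_ball s0]
      holomorphic_on_imp_differentiable_at[OF holomorphic_deriv[OF g(4) open_ball] open_ball s0]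
    by (auto intro: field_differentiable_imp_continuous_at)
  then have lim: "((\<lambda>s. of_nat n + (s - s0) * deriv g s / g s) \<longlongrightarrow> of_nat n + (s0 - s0)
      * deriv g s0 / g s0) (at s0)"
    using g(6)[OF s0] by (intro tendsto_intros) (auto simp: isCont_def)
  have "eventually (\<lambda>s. s \<in> ball s0 r \<and> s \<noteq> s0) (at s0)"
    using g(2) s0 by (auto simp: eventually_at_topological intro: exI[of _ "ball s0 r"])
  then have "eventually (\<lambda>s. of_nat n + (s - s0) * deriv g s / g s = (s - s0) * deriv f s / f s) (at s0)"
  proof eventually_elim
    case (elim s)
    have gd: "(g has_field_derivative deriv g s) (at s)"
      using g(4) elim by (auto intro: holomorphic_derivI[of g "ball s0 r"])
    have "((\<lambda>w. (w - s0) ^ n * g w) has_field_derivative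
       (of_nat n * (s - s0) ^ (n - 1) * g s + (s - s0) ^ n * deriv g s)) (at s)"
      using gd by (auto intro!: derivative_eq_intros)
    then have "(f has_field_derivative (of_nat n * (s - s0) ^ (n - 1) * g s + (s - s0) ^ n
        * deriv g s)) (at s)"
      by (rule has_field_derivative_transform_within_open[of _ _ _ "ball s0 r"]) (use elim g(5) in auto)
    then have d: "deriv f s = of_nat n * (s - s0) ^ (n - 1) * g s + (s - s0) ^ n * deriv g s"
      by (rule DERIV_imp_deriv)
    have "(s - s0) * (s - s0) ^ (n - 1) = (s - s0) ^ n" using g(1) by (metis power_minus_mult mult.commute)
    then have "(s - s0) * deriv f s = (s - s0) ^ n * (of_nat n * g s + (s - s0) * deriv g s)"
      unfolding d by (simp add: algebra_simps)
    then have "(s - s0) * deriv f s / f s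
        = ((s - s0) ^ n * (of_nat n * g s + (s - s0) * deriv g s)) / ((s - s0) ^ n * g s)"
      using elim g(5)[of s] by simp
    also have "\<dots> = of_nat n + (s - s0) * deriv g s / g s"
      using elim g(6)[of s] by (simp add: add_divide_distrib)
    finally show ?case by simp
  qed
  then have "((\<lambda>s. (s - s0) * deriv f s / f s) \<longlongrightarrow> of_nat n) (at s0)"
    using Lim_transform_eventually[OF lim] by simp
  then show ?thesis using True g(1) by (intro exI[of _ n]) simp
qed

lemma zeta_reg_log_deriv_limit:
  assumes "Re s0 > 0"
  shows "\<exists>m :: nat. ((\<lambda>s. (s - s0) * deriv zeta_reg s / zeta_reg s) \<longlongrightarrow> of_nat m) (at s0)
    \<and> (m = 0 \<longleftrightarrow> zeta_reg s0 \<noteq> 0)"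
  by (rule log_deriv_limit[OF zeta_reg_holomorphic, of _ 1])
     (use assms zeta_reg_1 in \<open>auto simp: open_halfspace_Re_gt convex_connected convex_halfspace_Re_gt\<close>)

lemma norm_mangoldt_sum_le:
  assumes "c > 1" "Re s \<ge> c"
  shows "cmod (mangoldt_sum s) \<le> (\<Sum>n. mangoldt n * real n powr (- c))"
proof -
  have s: "Re s > 1" using assms by simp
  have "cmod (mangoldt_sum s) \<le> (\<Sum>n. cmod (mangoldt n * of_nat n powr (- s)))"
    unfolding mangoldt_sum_def by (rule summable_norm[OF summable_norm_mangoldt_powr[OF s]])
  also have "\<dots> \<le> (\<Sum>n. mangoldt n * real n powr (- c))"
  proof (rule suminf_le[OF _ summable_norm_mangoldt_powr[OF s] summable_mangoldt_powr[OF assms(1)]])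
    fix n :: nat
    have "real n powr (- Re s) \<le> real n powr (- c)"
      using assms by (cases "n = 0") (auto intro!: powr_mono)
    then show "cmod (mangoldt n * of_nat n powr (- s)) \<le> mangoldt n * real n powr (- c)"
      by (simp add: norm_mult norm_of_nat_powr mult_left_mono mangoldt_nonneg)
  qed
  finally show ?thesis .
qed

text \<open>The logarithmic derivative is bounded near \<open>s0\<close> by convergent series, so
  its product with \<open>s - s0\<close> tends to 0 and the order of the zero is 0. At a zero itself
  the bound holds because division by 0 gives 0.\<close>

lemma zeta_reg_nonzero_gt_1:
  assumes s0: "Re s0 > 1"
  shows "zeta_reg s0 \<noteq> 0"
proof -
  obtain m :: nat where m: "((\<lambda>s. (s - s0) * deriv zeta_reg s / zeta_reg s) \<longlongrightarrow> of_nat m) (at s0)"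
    "m = 0 \<longleftrightarrow> zeta_reg s0 \<noteq> 0" using zeta_reg_log_deriv_limit[of s0] s0 by auto
  define c where "c = (Re s0 + 1) / 2"
  have c: "c > 1" "c < Re s0" using s0 by (auto simp: c_def)
  define B where "B = 1 / (c - 1) + (\<Sum>n. mangoldt n * real n powr (- c))"
  have "eventually (\<lambda>s. Re s > c) (at s0)"
    using c open_halfspace_Re_gt[of c]
      by (auto simp: eventually_at_topological intro: exI[of _ "{s. Re s > c}"])
  then have ev: "eventually (\<lambda>s. cmod ((s - s0) * deriv zeta_reg s / zeta_reg s)
      \<le> cmod (s - s0) * B) (at s0)"
  proof eventually_elim
    case (elim s)
    have "cmod (1 / (s - 1) - mangoldt_sum s) \<le> cmod (1 / (s - 1)) + cmod (mangoldt_sum s)"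
      by (rule norm_triangle_ineq4)
    also have "cmod (1 / (s - 1)) \<le> 1 / (c - 1)"
    proof -
      have "c - 1 \<le> cmod (s - 1)" using elim complex_Re_le_cmod[of "s - 1"] by simp
      then show ?thesis using c by (simp add: norm_divide frac_le)
    qed
    also have "cmod (mangoldt_sum s) \<le> (\<Sum>n. mangoldt n * real n powr (- c))"
      using c elim by (intro norm_mangoldt_sum_le) auto
    finally have B: "cmod (1 / (s - 1) - mangoldt_sum s) \<le> B" by (simp add: B_def)
    have "cmod (deriv zeta_reg s / zeta_reg s) \<le> B"
    proof (cases "zeta_reg s = 0")
      case True
      then show ?thesis using order.trans[OF norm_ge_zero B] by simp
    next
      case False
      then show ?thesis using B deriv_zeta_reg[of s] elim c by simp
    qed
    then have "cmod (s - s0) * cmod (deriv zeta_reg s / zeta_reg s) \<le> cmod (s - s0) * B"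
      by (intro mult_left_mono) auto
    then show ?case by (simp add: norm_mult norm_divide)
  qed
  have "((\<lambda>s. cmod (s - s0) * B) \<longlongrightarrow> cmod (s0 - s0) * B) (at s0)" by (intro tendsto_intros)
  then have "((\<lambda>s. cmod (s - s0) * B) \<longlongrightarrow> 0) (at s0)" by simp
  from LIM_unique[OF m(1) Lim_null_comparison[OF ev this]] have "m = 0" by simp
  then show ?thesis using m(2) by simp
qed

lemma Re_of_nat_powr: "Re (of_nat n powr (- (of_real \<sigma> + \<i> * of_real y)))
    = real n powr (- \<sigma>) * cos (y * ln (real n))"
proof (cases "n = 0")
  case False
  then have "(of_nat n :: complex) powr (- (of_real \<sigma> + \<i> * of_real y))
      = exp (- (of_real \<sigma> + \<i> * of_real y) * of_real (ln (real n)))"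
    by (simp add: powr_def Ln_of_nat)
  then show ?thesis using False by (simp add: Re_exp powr_def)
qed simp

lemma Re_mangoldt_sum:
  assumes "\<sigma> > 1"
  shows "(\<lambda>n. mangoldt n * real n powr (- \<sigma>)
      * cos (y * ln (real n))) sums Re (mangoldt_sum (of_real \<sigma> + \<i> * of_real y))"
proof -
  have "(\<lambda>n. mangoldt n * of_nat n powr (- (of_real \<sigma> + \<i> * of_real y))) sums mangoldt_sum (of_real \<sigma> + \<i>
      * of_real y)"
    unfolding mangoldt_sum_def using assms
    by (intro summable_sums summable_norm_cancel[OF summable_norm_mangoldt_powr]) auto
  then have "(\<lambda>n. Re (mangoldt n
      * of_nat n powr (- (of_real \<sigma> + \<i> * of_real y)))) sums Re (mangoldt_sum (of_real \<sigma> + \<i> * of_real y))"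
    by (rule sums_Re)
  moreover have "Re (mangoldt n * of_nat n powr (- (of_real \<sigma> + \<i> * of_real y)))
      = mangoldt n * real n powr (- \<sigma>) * cos (y * ln (real n))" for n
  proof -
    have "Re (mangoldt n * z) = mangoldt n * Re z" for z by simp
    then show ?thesis by (simp only: Re_of_nat_powr mult.assoc)
  qed
  ultimately show ?thesis by (simp only:)
qed

text \<open>Termwise \<open>3 + 4 * cos x + cos (2 * x) = 2 * (1 + cos x) ^ 2\<close>, and
  \<open>mangoldt\<close> is nonnegative.\<close>

lemma mangoldt_sum_341:
  assumes "\<sigma> > 1"
  shows "0 \<le> 3 * Re (mangoldt_sum (of_real \<sigma> + \<i> * of_real 0)) + 4
      * Re (mangoldt_sum (of_real \<sigma> + \<i> * of_real y))
    + Re (mangoldt_sum (of_real \<sigma> + \<i> * of_real (2 * y)))"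
proof -
  let ?a = "\<lambda>n. mangoldt n * real n powr (- \<sigma>)"
  have S: "(\<lambda>n. 3 * (?a n * cos (0 * ln (real n))) + 4 * (?a n * cos (y * ln (real n))) + ?a n
      * cos (2 * y * ln (real n)))
    sums (3 * Re (mangoldt_sum (of_real \<sigma> + \<i> * of_real 0)) + 4 * Re
      (mangoldt_sum (of_real \<sigma> + \<i> * of_real y))
    + Re (mangoldt_sum (of_real \<sigma> + \<i> * of_real (2 * y))))"
    by (intro sums_add sums_mult Re_mangoldt_sum assms)
  have nn: "0 \<le> 3 * (?a n * cos (0 * ln (real n))) + 4 * (?a n * cos (y * ln (real n))) + ?a n
      * cos (2 * y * ln (real n))" for n
  proof -
    have alg: "3 * A + 4 * (A * c) + A * (2 * c\<^sup>2 - 1) = A * (2 * (1 + c)\<^sup>2)" for A c :: real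
      by (simp add: power2_eq_square algebra_simps)
    have "cos (2 * y * ln (real n)) = 2 * (cos (y * ln (real n)))\<^sup>2 - 1"
      using cos_double_cos[of "y * ln (real n)"] by (simp add: mult.assoc)
    then have "3 * (?a n * cos (0 * ln (real n))) + 4 * (?a n * cos (y * ln (real n))) + ?a n
        * cos (2 * y * ln (real n))
      = ?a n * (2 * (1 + cos (y * ln (real n)))\<^sup>2)"
      using alg[of "?a n" "cos (y * ln (real n))"] by simp
    also have "\<dots> \<ge> 0" by (intro mult_nonneg_nonneg) (auto simp: mangoldt_nonneg)
    finally show ?thesis .
  qed
  show ?thesis by (rule sums_le[OF nn sums_zero S])
qed

text \<open>The residue on horizontal approach to the line: the pole at 1 contributes 1 and a zero
  of order \<open>m\<close> contributes \<open>- m\<close>.\<close>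

lemma mangoldt_sum_limit:
  "\<exists>m :: nat. ((\<lambda>u. of_real u * mangoldt_sum (of_real (1 + u) + \<i> * of_real y))
       \<longlongrightarrow> (if y = 0 then 1 else 0) - of_nat m) (at_right 0) \<and> (m = 0 \<longleftrightarrow> zeta_reg (1 + \<i> * of_real y) \<noteq> 0)"
proof -
  define s0 where "s0 = 1 + \<i> * complex_of_real y"
  obtain m :: nat where m: "((\<lambda>s. (s - s0) * deriv zeta_reg s / zeta_reg s) \<longlongrightarrow> of_nat m) (at s0)"
    "m = 0 \<longleftrightarrow> zeta_reg s0 \<noteq> 0" using zeta_reg_log_deriv_limit[of s0] by (auto simp: s0_def)
  define p where "p u = complex_of_real (1 + u) + \<i> * of_real y" for u
  have p: "p u - s0 = of_real u" for u by (simp add: p_def s0_def)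
  have "(p \<longlongrightarrow> of_real (1 + 0) + \<i> * of_real y) (at_right 0)" unfolding p_def by (intro tendsto_intros)
  moreover have "eventually (\<lambda>u. p u \<noteq> s0) (at_right 0)"
  proof -
    have "eventually (\<lambda>u :: real. u > 0) (at_right 0)" by (rule eventually_at_right_less)
    then show ?thesis
    proof eventually_elim
      case (elim u)
      then show ?case using p[of u] by auto
    qed
  qed
  ultimately have "filterlim p (at s0) (at_right 0)" by (simp add: filterlim_at s0_def)
  from filterlim_compose[OF m(1) this]
  have 1: "((\<lambda>u. of_real u * deriv zeta_reg (p u) / zeta_reg (p u)) \<longlongrightarrow> of_nat m) (at_right 0)"
    by (simp add: p)
  have 2: "((\<lambda>u. of_real u / (p u - 1)) \<longlongrightarrow> (if y = 0 then 1 else 0)) (at_right 0)"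
  proof (cases "y = 0")
    case True
    have "eventually (\<lambda>u :: real. complex_of_real u / (p u - 1) = 1) (at_right 0)"
      using eventually_at_right_less[of 0] by eventually_elim (simp add: p_def True)
    then show ?thesis using True by (simp add: tendsto_eventually)
  next
    case False
    have "((\<lambda>u. of_real u / (of_real (1 + u) + \<i> * of_real y - 1)) \<longlongrightarrow> of_real 0 / (of_real (1 + 0) + \<i>
        * of_real y - 1)) (at_right 0)"
      using False by (intro tendsto_intros) auto
    then show ?thesis using False by (simp add: p_def)
  qed
  have "eventually (\<lambda>u. of_real u / (p u - 1) - of_real u * deriv zeta_reg (p u) / zeta_reg (p u)
      = of_real u * mangoldt_sum (p u)) (at_right 0)"
    using eventually_at_right_less[of 0]
  proof eventually_elim
    case (elim u)
    then have "Re (p u) > 1" by (simp add: p_def)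
    then have "deriv zeta_reg (p u) / zeta_reg (p u) = 1 / (p u - 1) - mangoldt_sum (p u)"
      using zeta_reg_nonzero_gt_1 deriv_zeta_reg by simp
    then have "of_real u * (deriv zeta_reg (p u) / zeta_reg (p u))
        = of_real u * (1 / (p u - 1) - mangoldt_sum (p u))" by simp
    then show ?case by (simp add: right_diff_distrib)
  qed
  then have "((\<lambda>u. of_real u * mangoldt_sum (p u)) \<longlongrightarrow> (if y = 0 then 1 else 0) - of_nat m) (at_right 0)"
    by (rule Lim_transform_eventually[OF tendsto_diff[OF 2 1]])
  then show ?thesis using m(2) unfolding p_def s0_def by blast
qed

text \<open>The scaled inequality tends to \<open>3 - 4 * m1 - m2 \<ge> 0\<close>, where
  \<open>m1\<close> and \<open>m2\<close> are the orders of the zeros at the ordinates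
  \<open>y\<close> and \<open>2 * y\<close>. As a natural number, \<open>m1\<close> must be
  0.\<close>

lemma zeta_reg_nonzero_line: "zeta_reg (1 + \<i> * of_real y) \<noteq> 0"
proof (cases "y = 0")
  case True
  then show ?thesis by (simp add: zeta_reg_1)
next
  case False
  define f where "f u y = of_real u * mangoldt_sum (of_real (1 + u) + \<i> * of_real y)" for u y :: real
  obtain m0 :: nat where m0: "((\<lambda>u. f u 0) \<longlongrightarrow> 1 - of_nat m0) (at_right 0)" "m0 = 0"
    using mangoldt_sum_limit[of 0] zeta_reg_1 unfolding f_def by auto
  obtain m1 :: nat where m1: "((\<lambda>u. f u y) \<longlongrightarrow> - of_nat m1) (at_right 0)"
    "m1 = 0 \<longleftrightarrow> zeta_reg (1 + \<i> * of_real y) \<noteq> 0"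
    using mangoldt_sum_limit[of y] False unfolding f_def by auto
  obtain m2 :: nat where m2: "((\<lambda>u. f u (2 * y)) \<longlongrightarrow> - of_nat m2) (at_right 0)"
    using mangoldt_sum_limit[of "2 * y"] False unfolding f_def by auto
  have "((\<lambda>u. 3 * Re (f u 0) + 4 * Re (f u y) + Re (f u (2 * y))) \<longlongrightarrow>
     3 * Re (1 - of_nat m0) + 4 * Re (- of_nat m1) + Re (- of_nat m2)) (at_right 0)"
    by (intro tendsto_intros m0 m1 m2)
  moreover have "eventually (\<lambda>u. 0 \<le> 3 * Re (f u 0) + 4 * Re (f u y) + Re (f u (2 * y))) (at_right 0)"
    using eventually_at_right_less[of 0]
  proof eventually_elim
    case (elim u)
    then have "0 \<le> u * (3 * Re (mangoldt_sum (of_real (1 + u) + \<i> * of_real 0)) + 4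
        * Re (mangoldt_sum (of_real (1 + u) + \<i> * of_real y))
    + Re (mangoldt_sum (of_real (1 + u) + \<i> * of_real (2 * y))))"
      by (intro mult_nonneg_nonneg mangoldt_sum_341) auto
    then show ?case by (simp add: f_def algebra_simps)
  qed
  ultimately have "0 \<le> 3 * Re (1 - of_nat m0) + 4 * Re (- of_nat m1 :: complex) + Re (- of_nat m2)"
    by (intro tendsto_lowerbound) auto
  then have "4 * real m1 + real m2 \<le> 3" using m0 by simp
  then have "m1 = 0" by linarith
  then show ?thesis using m1 by simp
qed

lemma zeta_reg_nonzero: "Re s \<ge> 1 \<Longrightarrow> zeta_reg s \<noteq> 0"
  using zeta_reg_nonzero_gt_1[of s] zeta_reg_nonzero_line[of "Im s"] complex_eq[of s]
  by (cases "Re s = 1") auto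

text \<open>Both series have a simple pole with residue 1 at 1, and the difference has none.
  \<open>Q\<close> is the part of the zeta function left after removing \<open>1 / (s - 1)\<close>;
  as a difference quotient of \<open>zeta_reg\<close> it is holomorphic at 1 too.\<close>

theorem mangoldt_minus_one_continuation:
  "\<exists>H \<Omega>. open \<Omega> \<and> {s. Re s \<ge> 1} \<subseteq> \<Omega> \<and> H holomorphic_on \<Omega> \<and>
    (\<forall>s. Re s > 1 \<longrightarrow> (\<lambda>n. (mangoldt n - 1) * of_nat n powr (- s)) sums H s)"
proof -
  let ?A = "{s. Re s > 0}"
  define \<Omega> where "\<Omega> = {s \<in> ?A. zeta_reg s \<noteq> 0}"
  define Q where "Q z = (if z = 1 then deriv zeta_reg 1 else (zeta_reg z - zeta_reg 1) / (z - 1))" for z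
  define H where "H s = - Q s - deriv zeta_reg s / zeta_reg s" for s
  have opn: "open ?A" by (rule open_halfspace_Re_gt)
  have op\<Omega>: "open \<Omega>"
  proof -
    have "\<Omega> = ?A \<inter> zeta_reg -` (- {0})" by (auto simp: \<Omega>_def)
    then show ?thesis
      using continuous_open_preimage[OF holomorphic_on_imp_continuous_on[OF zeta_reg_holomorphic] opn, of
        "- {0}"] by auto
  qed
  have "{s. Re s \<ge> 1} \<subseteq> \<Omega>" using zeta_reg_nonzero by (auto simp: \<Omega>_def)
  moreover have "H holomorphic_on \<Omega>"
  proof -
    have "Q holomorphic_on ?A" unfolding Q_def by (rule pole_lemma_open[OF zeta_reg_holomorphic opn])
    moreover have "deriv zeta_reg holomorphic_on ?A"
      by (rule holomorphic_deriv[OF zeta_reg_holomorphic opn])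
    moreover have "\<Omega> \<subseteq> ?A" by (auto simp: \<Omega>_def)
    ultimately have "Q holomorphic_on \<Omega>" "deriv zeta_reg holomorphic_on \<Omega>" "zeta_reg holomorphic_on \<Omega>"
      using zeta_reg_holomorphic holomorphic_on_subset by blast+
    then show ?thesis unfolding H_def using op\<Omega> by (intro holomorphic_intros) (auto simp: \<Omega>_def)
  qed
  moreover have "(\<lambda>n. (mangoldt n - 1) * of_nat n powr (- s)) sums H s" if s: "Re s > 1" for s
  proof -
    have s1: "s \<noteq> 1" using s by auto
    have "(\<lambda>n. mangoldt n * of_nat n powr (- s)) sums mangoldt_sum s"
      unfolding mangoldt_sum_def
        by (intro summable_sums summable_norm_cancel[OF summable_norm_mangoldt_powr] s)
    moreover have "(\<lambda>n. of_nat n powr (- s)) sums zeta_sum s"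
      unfolding zeta_sum_def by (intro summable_sums summable_norm_cancel[OF summable_of_nat_powr] s)
    ultimately have "(\<lambda>n. mangoldt n * of_nat n powr (- s) - of_nat n powr (- s)) sums (mangoldt_sum s
        - zeta_sum s)"
      by (rule sums_diff)
    moreover have "mangoldt_sum s - zeta_sum s = H s"
    proof -
      have "deriv zeta_reg s / zeta_reg s = 1 / (s - 1) - mangoldt_sum s"
        using zeta_reg_nonzero_gt_1[OF s] deriv_zeta_reg[OF s] by simp
      moreover have "Q s = zeta_sum s - 1 / (s - 1)"
        using s1 by (simp add: Q_def zeta_reg_1 zeta_reg_eq[OF s] diff_divide_distrib)
      ultimately show ?thesis by (simp add: H_def)
    qed
    ultimately show ?thesis by (simp add: left_diff_distrib)
  qed
  ultimately show ?thesis using op\<Omega> by blast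
qed

section \<open>Prime powers in short multiplicative intervals\<close>

text \<open>The cosine transform of a triangle on \<open>{0..l}\<close>. The support bounds the
  segment of the line that is visited; the transform is nonnegative, of order \<open>l\<close> for
  \<open>u\<close> up to \<open>1 / l\<close>, and decays quadratically.\<close>

definition fejer :: "real \<Rightarrow> real \<Rightarrow> real" where
  "fejer l u = integral {0..l} (\<lambda>t. (1 - t / l) * cos (t * u))"

lemma fejer_integrable: "l > 0 \<Longrightarrow> (\<lambda>t. (1 - t / l) * cos (t * u)) integrable_on {0..l}" for l u :: real
  by (auto intro!: integrable_continuous_interval continuous_intros)

lemma fejer_eq:
  assumes "l > 0" "u \<noteq> 0"
  shows "fejer l u = (1 - cos (l * u)) / (l * u\<^sup>2)"
proof -
  define G where "G t = (1 - t / l) * sin (t * u) / u - cos (t * u) / (l * u\<^sup>2)" for t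
  have "(G has_vector_derivative (1 - t / l) * cos (t * u)) (at t within {0..l})" for t
    unfolding G_def has_real_derivative_iff_has_vector_derivative[symmetric] using assms
    by (auto intro!: derivative_eq_intros simp: field_simps power2_eq_square)
  then have "((\<lambda>t. (1 - t / l) * cos (t * u)) has_integral (G l - G 0)) {0..l}"
    using assms by (intro fundamental_theorem_of_calculus) auto
  then have "fejer l u = G l - G 0" unfolding fejer_def by (rule integral_unique)
  then show ?thesis using assms by (simp add: G_def diff_divide_distrib)
qed

lemma fejer_ge:
  assumes "l > 0" "\<bar>u\<bar> \<le> 1 / l"
  shows "fejer l u \<ge> l / 4"
proof -
  have "((\<lambda>t. t / 2 - t\<^sup>2 / (4 * l)) has_vector_derivative (1 - t / l) * (1 / 2)) (at t within {0..l})"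
    for t
    unfolding has_real_derivative_iff_has_vector_derivative[symmetric] using assms
    by (auto intro!: derivative_eq_intros simp: field_simps)
  then have "((\<lambda>t. (1 - t / l) * (1 / 2)) has_integral ((l / 2 - l\<^sup>2 / (4 * l))
      - (0 / 2 - 0\<^sup>2 / (4 * l)))) {0..l}"
    using assms by (intro fundamental_theorem_of_calculus) auto
  moreover have "(l / 2 - l\<^sup>2 / (4 * l)) - (0 / 2 - 0\<^sup>2 / (4 * l)) = l / 4"
    using assms by (simp add: power2_eq_square field_simps)
  ultimately have "((\<lambda>t. (1 - t / l) * (1 / 2)) has_integral (l / 4)) {0..l}" by (simp only:)
  moreover have "((\<lambda>t. (1 - t / l) * cos (t * u)) has_integral fejer l u) {0..l}"
    unfolding fejer_def by (rule integrable_integral[OF fejer_integrable[OF assms(1)]])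
  ultimately show ?thesis
  proof (rule has_integral_le)
    fix t assume t: "t \<in> {0..l}"
    have "\<bar>t * u\<bar> \<le> l * (1 / l)" unfolding abs_mult using t assms by (intro mult_mono) auto
    then have "\<bar>t * u\<bar> \<le> 1" using assms by simp
    moreover have "1 \<le> pi / 3" using pi_gt3 by simp
    ultimately have "cos (pi / 3) \<le> cos \<bar>t * u\<bar>" using pi_gt3 by (intro cos_monotone_0_pi_le) auto
    then have "1 / 2 \<le> cos (t * u)" by (simp add: cos_60)
    then show "(1 - t / l) * (1 / 2) \<le> (1 - t / l) * cos (t * u)"
      using t assms by (intro mult_left_mono) auto
  qed
qed

lemma fejer_nonneg: "l > 0 \<Longrightarrow> fejer l u \<ge> 0"
  using fejer_eq[of l u] fejer_ge[of l u] by (cases "u = 0") auto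

lemma fejer_le:
  assumes "l > 0" "u \<noteq> 0"
  shows "fejer l u \<le> 2 / (l * u\<^sup>2)"
  unfolding fejer_eq[OF assms] using assms cos_ge_minus_one[of "l * u"]
  by (intro divide_right_mono) auto

lemma fejer_le_l: "l > 0 \<Longrightarrow> fejer l u \<le> l"
proof -
  assume l: "l > 0"
  have "((\<lambda>t. 1) has_integral (1 * (l - 0))) {0..l}"
    using has_integral_const_real[of "1 :: real" 0 l] l by simp
  moreover have "((\<lambda>t. (1 - t / l) * cos (t * u)) has_integral fejer l u) {0..l}"
    unfolding fejer_def by (rule integrable_integral[OF fejer_integrable[OF l]])
  moreover have "(1 - t / l) * cos (t * u) \<le> 1" if "t \<in> {0..l}" for t
  proof -
    have "(1 - t / l) * cos (t * u) \<le> (1 - t / l) * 1" using that l by (intro mult_left_mono) auto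
    also have "\<dots> \<le> 1" using that l by simp
    finally show ?thesis .
  qed
  ultimately have "fejer l u \<le> 1 * (l - 0)" using has_integral_le by blast
  then show ?thesis by simp
qed

lemma fejer_1_le: "fejer 1 u \<le> 4 / (1 + u\<^sup>2)"
proof (cases "\<bar>u\<bar> \<ge> 1")
  case True
  then have u: "u\<^sup>2 \<ge> 1" by (simp add: abs_le_square_iff[of 1 u, simplified])
  have "fejer 1 u \<le> 2 / u\<^sup>2" using fejer_le[of 1 u] True by auto
  also have "\<dots> \<le> 4 / (1 + u\<^sup>2)" using u by (simp add: divide_simps)
  finally show ?thesis .
next
  case False
  then have "u\<^sup>2 \<le> 1" by (simp add: abs_square_le_1)
  then have "1 \<le> 4 / (1 + u\<^sup>2)" by (subst pos_le_divide_eq) (auto intro: add_pos_nonneg)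
  then show ?thesis using fejer_le_l[of 1 u] by simp
qed

text \<open>The factor \<open>1 / l\<close> is decisive: a large \<open>l\<close> makes everything
  at distance \<delta> from the centre negligible.\<close>

lemma fejer_le_away:
  assumes "l > 0" "\<delta> > 0" "\<bar>u\<bar> \<ge> \<delta>"
  shows "fejer l u \<le> 2 / l * (1 + 1 / \<delta>\<^sup>2) / (1 + u\<^sup>2)"
proof -
  have u: "u \<noteq> 0" "u\<^sup>2 > 0" using assms by auto
  have "\<delta>\<^sup>2 \<le> u\<^sup>2" using assms power_mono[of \<delta> "\<bar>u\<bar>" 2] by simp
  then have "1 / u\<^sup>2 \<le> 1 / \<delta>\<^sup>2" using assms by (intro divide_left_mono) auto
  then have "(1 + u\<^sup>2) * (1 / u\<^sup>2) \<le> 1 + 1 / \<delta>\<^sup>2" using u by (simp add: add_divide_distrib)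
  then have "1 / u\<^sup>2 \<le> (1 + 1 / \<delta>\<^sup>2) / (1 + u\<^sup>2)"
    by (subst pos_le_divide_eq) (auto simp: mult.commute add_pos_nonneg)
  then have "2 / l * (1 / u\<^sup>2) \<le> 2 / l * ((1 + 1 / \<delta>\<^sup>2) / (1 + u\<^sup>2))" using assms
    by (intro mult_left_mono) auto
  then show ?thesis using fejer_le[OF assms(1) u(1)] by simp
qed

section \<open>Sums over logarithmic windows\<close>

definition ln_window :: "nat \<Rightarrow> nat set" where
  "ln_window k = {n. n > 0 \<and> real k \<le> ln (real n) \<and> ln (real n) < real k + 1}"

lemma ln_window_subset: "ln_window k \<subseteq> {1..nat \<lfloor>exp (real k + 1)\<rfloor>}"
proof
  fix n assume n: "n \<in> ln_window k"
  then have "ln (real n) \<le> ln (exp (real k + 1))" by (simp add: ln_window_def)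
  then have "real n \<le> exp (real k + 1)" using n by (subst (asm) ln_le_cancel_iff) (auto simp: ln_window_def)
  then show "n \<in> {1..nat \<lfloor>exp (real k + 1)\<rfloor>}" using n by (auto simp: ln_window_def le_nat_floor)
qed

lemma finite_ln_window: "finite (ln_window k)"
  using finite_subset[OF ln_window_subset] by simp

lemma ln_window_sum_inverse: "(\<Sum>n\<in>ln_window k. 1 / real n) \<le> 3"
proof -
  have "(\<Sum>n\<in>ln_window k. 1 / real n) \<le> (\<Sum>n\<in>ln_window k. exp (- real k))"
  proof (rule sum_mono)
    fix n assume n: "n \<in> ln_window k"
    then have "exp (real k) \<le> real n" using ln_ge_iff[of "real n" "real k"] by (simp add: ln_window_def)
    then have "1 / real n \<le> 1 / exp (real k)"
      by (intro divide_left_mono) (use n in \<open>auto simp: ln_window_def\<close>)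
    then show "1 / real n \<le> exp (- real k)" by (simp add: exp_minus inverse_eq_divide)
  qed
  also have "\<dots> = real (card (ln_window k)) * exp (- real k)" by simp
  also have "\<dots> \<le> exp (real k + 1) * exp (- real k)"
  proof (rule mult_right_mono)
    have "card (ln_window k) \<le> nat \<lfloor>exp (real k + 1)\<rfloor>" using card_mono[OF _ ln_window_subset, of k] by simp
    then show "real (card (ln_window k)) \<le> exp (real k + 1)"
      by (meson exp_ge_zero of_nat_le_iff of_nat_floor order_trans)
  qed simp
  also have "\<dots> = exp 1" by (simp flip: exp_add)
  also have "\<dots> \<le> 3" by (rule exp_le)
  finally show ?thesis .
qed

text \<open>On either side of the integer part of \<open>T\<close> the distances from
  \<open>T\<close> dominate 0, 1, 2, and so on, so twice one convergent series serves for every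
  \<open>T\<close>.\<close>

lemma sum_inverse_squares_bound:
  "\<exists>C>0. \<forall>T\<ge>0. \<forall>K. (\<Sum>k<K. 1 / (1 + (T - real k)\<^sup>2)) \<le> C"
proof -
  let ?f = "\<lambda>i :: nat. 1 / (1 + (real i)\<^sup>2)"
  have sm: "summable ?f"
  proof (rule summable_comparison_test'[of "\<lambda>n. real n powr (- 2)" 1])
    show "summable (\<lambda>n. real n powr - 2)" by (simp add: summable_real_powr_iff)
    fix n :: nat assume n: "n \<ge> 1"
    then have "1 / (1 + (real n)\<^sup>2) \<le> 1 / (real n)\<^sup>2"
      by (intro divide_left_mono mult_pos_pos add_pos_nonneg) auto
    also have "\<dots> = real n powr - 2" using n by (simp add: powr_minus powr_numeral inverse_eq_divide)
    finally show "norm (1 / (1 + (real n)\<^sup>2)) \<le> real n powr - 2" by simp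
  qed
  define D where "D = suminf ?f"
  have fin: "sum ?f I \<le> D" if "finite I" for I
    unfolding D_def using that by (intro sum_le_suminf[OF sm]) auto
  have D: "D \<ge> 1" using fin[of "{0}"] by simp
  have "(\<Sum>k<K. 1 / (1 + (T - real k)\<^sup>2)) \<le> 2 * D" if T: "T \<ge> 0" for T K
  proof -
    define j where "j = nat \<lfloor>T\<rfloor>"
    have j: "real j \<le> T" "T < real j + 1" using T by (auto simp: j_def)
    have "(\<Sum>k<K. 1 / (1 + (T - real k)\<^sup>2)) = (\<Sum>k\<in>{k. k < K \<and> k \<le> j}. 1 / (1 + (T - real k)\<^sup>2))
      + (\<Sum>k\<in>{k. k < K \<and> j < k}. 1 / (1 + (T - real k)\<^sup>2))"
      by (subst sum.union_disjoint[symmetric]) (auto intro!: sum.cong)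
    also have "(\<Sum>k\<in>{k. k < K \<and> k \<le> j}. 1 / (1 + (T - real k)\<^sup>2)) \<le> (\<Sum>k\<in>{k. k < K \<and> k \<le> j}. ?f (j - k))"
    proof (rule sum_mono)
      fix k assume "k \<in> {k. k < K \<and> k \<le> j}"
      then have "(real (j - k))\<^sup>2 \<le> (T - real k)\<^sup>2" using j by (intro power_mono) (auto simp: of_nat_diff)
      then show "1 / (1 + (T - real k)\<^sup>2) \<le> ?f (j - k)"
        by (intro divide_left_mono mult_pos_pos add_pos_nonneg) auto
    qed
    also have "\<dots> = sum ?f ((\<lambda>k. j - k) ` {k. k < K \<and> k \<le> j})"
      by (subst sum.reindex) (auto simp: inj_on_def)
    also have "\<dots> \<le> D" by (rule fin) auto
    also have "(\<Sum>k\<in>{k. k < K \<and> j < k}. 1 / (1 + (T - real k)\<^sup>2)) \<le> (\<Sum>k\<in>{k. k < K \<and> j < k}. ?f (k - Suc j))"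
    proof (rule sum_mono)
      fix k assume "k \<in> {k. k < K \<and> j < k}"
      then have "(real (k - Suc j))\<^sup>2 \<le> (real k - T)\<^sup>2" using j
        by (intro power_mono) (auto simp: of_nat_diff)
      then show "1 / (1 + (T - real k)\<^sup>2) \<le> ?f (k - Suc j)"
        unfolding power2_commute[of T] by (intro divide_left_mono mult_pos_pos add_pos_nonneg) auto
    qed
    also have "\<dots> = sum ?f ((\<lambda>k. k - Suc j) ` {k. k < K \<and> j < k})"
      by (subst sum.reindex) (auto simp: inj_on_def)
    also have "\<dots> \<le> D" by (rule fin) auto
    finally show ?thesis by simp
  qed
  then show ?thesis using D by (intro exI[of _ "2 * D"]) auto
qed

text \<open>A mass that is bounded on each unit window of \<open>ln n\<close> stays bounded against
  a quadratically decaying weight, uniformly in its centre \<open>T\<close>. Replacing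
  \<open>ln n\<close> by the left end of its window costs a factor 3.\<close>

lemma window_sum_bound:
  "\<exists>C>0. \<forall>a A T S. (\<forall>n. a n \<ge> 0) \<longrightarrow> (\<forall>k. (\<Sum>n\<in>ln_window k. a n) \<le> A) \<longrightarrow> T \<ge> 0 \<longrightarrow> finite S \<longrightarrow> 0 \<notin> S \<longrightarrow>
     (\<Sum>n\<in>S. a n / (1 + (T - ln (real n))\<^sup>2)) \<le> C * (A :: real)"
proof -
  obtain C where C: "C > 0" "\<And>T K. T \<ge> 0 \<Longrightarrow> (\<Sum>k<K. 1 / (1 + (T - real k)\<^sup>2)) \<le> C"
    using sum_inverse_squares_bound by blast
  show ?thesis
  proof (intro exI[of _ "3 * C"] conjI allI impI)
    fix a :: "nat \<Rightarrow> real" and A T :: real and S :: "nat set"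
    assume a: "\<forall>n. a n \<ge> 0" "\<forall>k. (\<Sum>n\<in>ln_window k. a n) \<le> A" and T: "T \<ge> 0" and S: "finite S" "0 \<notin> S"
    have A: "A \<ge> 0" using a sum_nonneg[of "ln_window 0" a] by (meson order_trans)
    define w where "w n = nat \<lfloor>ln (real n)\<rfloor>" for n
    have w: "n \<in> ln_window (w n)" if "n \<in> S" for n
    proof -
      have "n > 0" using that S by (cases n) auto
      then have "ln (real n) \<ge> 0" by simp
      then show ?thesis using \<open>n > 0\<close> by (auto simp: ln_window_def w_def)
    qed
    obtain K where K: "w ` S \<subseteq> {..<K}" using S by (meson finite_imageI finite_nat_iff_bounded)
    have "(\<Sum>n\<in>S. a n / (1 + (T - ln (real n))\<^sup>2))
        = (\<Sum>k<K. \<Sum>n\<in>{n \<in> S. w n = k}. a n / (1 + (T - ln (real n))\<^sup>2))"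
      using S K by (intro sum.group[symmetric]) auto
    also have "\<dots> \<le> (\<Sum>k<K. 3 / (1 + (T - real k)\<^sup>2) * A)"
    proof (rule sum_mono)
      fix k
      have "(\<Sum>n\<in>{n \<in> S. w n = k}. a n / (1 + (T - ln (real n))\<^sup>2))
          \<le> (\<Sum>n\<in>{n \<in> S. w n = k}. 3 / (1 + (T - real k)\<^sup>2) * a n)"
      proof (rule sum_mono)
        fix n assume n: "n \<in> {n \<in> S. w n = k}"
        then have "n \<in> ln_window k" using w by auto
        then have nk: "\<bar>ln (real n) - real k\<bar> \<le> 1" by (auto simp: ln_window_def)
        define x y where "x = T - ln (real n)" and "y = ln (real n) - real k"
        have "y\<^sup>2 \<le> 1" using nk by (simp add: y_def abs_square_le_1)
        moreover have "0 \<le> (x - y)\<^sup>2" by simp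
        then have "2 * (x * y) \<le> x\<^sup>2 + y\<^sup>2" by (simp add: power2_diff)
        moreover have "(x + y)\<^sup>2 = x\<^sup>2 + y\<^sup>2 + 2 * (x * y)" by (simp add: power2_sum)
        ultimately have "1 + (x + y)\<^sup>2 \<le> 3 * (1 + x\<^sup>2)" using zero_le_power2[of x] by argo
        then have le: "1 + (T - real k)\<^sup>2 \<le> 3 * (1 + (T - ln (real n))\<^sup>2)" by (simp add: x_def y_def)
        have pos: "0 < 1 + (T - real k)\<^sup>2" "0 < 1 + (T - ln (real n))\<^sup>2" by (auto intro: add_pos_nonneg)
        have "1 / (1 + (T - ln (real n))\<^sup>2) \<le> 3 / (1 + (T - real k)\<^sup>2)"
          using le pos by (simp add: divide_simps)
        then have "a n * (1 / (1 + (T - ln (real n))\<^sup>2)) \<le> a n * (3 / (1 + (T - real k)\<^sup>2))"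
          using a by (intro mult_left_mono) auto
        then show "a n / (1 + (T - ln (real n))\<^sup>2) \<le> 3 / (1 + (T - real k)\<^sup>2) * a n"
          by (simp add: mult.commute)
      qed
      also have "\<dots> = 3 / (1 + (T - real k)\<^sup>2) * (\<Sum>n\<in>{n \<in> S. w n = k}. a n)"
        by (rule sum_distrib_left[symmetric])
      also have "\<dots> \<le> 3 / (1 + (T - real k)\<^sup>2) * A"
      proof (rule mult_left_mono)
        have "(\<Sum>n\<in>{n \<in> S. w n = k}. a n) \<le> (\<Sum>n\<in>ln_window k. a n)"
          using a w finite_ln_window by (intro sum_mono2) auto
        then show "(\<Sum>n\<in>{n \<in> S. w n = k}. a n) \<le> A" using a(2) order.trans by blast
      qed (auto intro: add_nonneg_nonneg)
      finally show "(\<Sum>n\<in>{n \<in> S. w n = k}. a n / (1 + (T - ln (real n))\<^sup>2)) \<le> 3 / (1 + (T - real k)\<^sup>2) * A" .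
    qed
    also have "\<dots> = 3 * A * (\<Sum>k<K. 1 / (1 + (T - real k)\<^sup>2))" by (simp add: sum_distrib_left)
    also have "\<dots> \<le> 3 * A * C" using C(2)[OF T] A by (intro mult_left_mono) auto
    finally show "(\<Sum>n\<in>S. a n / (1 + (T - ln (real n))\<^sup>2)) \<le> 3 * C * A" by (simp add: mult_ac)
  qed (use C in simp)
qed

text \<open>Counting the integers between \<open>x\<close> and \<open>y\<close>, each with weight at
  least \<open>1 / y\<close>, gives at least \<open>1 - exp (- 2 / l) - exp (- T)\<close>.\<close>

lemma sum_inverse_near_ge:
  assumes l: "l \<ge> 2" and T: "T \<ge> 0" "exp (- T) \<le> 1 / (2 * l)"
  shows "\<exists>S. finite S \<and> (\<forall>n\<in>S. n > 0 \<and> \<bar>T - ln (real n)\<bar> \<le> 1 / l) \<and> (\<Sum>n\<in>S. 1 / real n) \<ge> 1 / (2 * l)"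
proof -
  define x y where "x = exp (T - 1 / l)" and "y = exp (T + 1 / l)"
  have xy: "0 < x" "x \<le> y" using l by (auto simp: x_def y_def)
  define S where "S = {nat \<lceil>x\<rceil>..nat \<lfloor>y\<rfloor>}"
  have S: "x \<le> real n" "real n \<le> y" "n > 0" if "n \<in> S" for n
  proof -
    show 1: "x \<le> real n" using that by (simp add: S_def nat_le_iff ceiling_le_iff)
    show "real n \<le> y" using that xy unfolding S_def atLeastAtMost_iff by linarith
    show "n > 0" using 1 xy by (cases n) auto
  qed
  have "\<bar>T - ln (real n)\<bar> \<le> 1 / l" if "n \<in> S" for n
  proof -
    have "ln x \<le> ln (real n)" "ln (real n) \<le> ln y" using S[OF that] xy by auto
    then show ?thesis by (simp add: x_def y_def abs_le_iff)
  qed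
  moreover have "1 / (2 * l) \<le> (\<Sum>n\<in>S. 1 / real n)"
  proof -
    have "y - x - 1 \<le> real (card S)"
    proof -
      have "real (card S) \<ge> real (nat \<lfloor>y\<rfloor>) + 1 - real (nat \<lceil>x\<rceil>)" by (simp add: S_def)
      moreover have "real (nat \<lfloor>y\<rfloor>) > y - 1" using xy by linarith
      moreover have "real (nat \<lceil>x\<rceil>) < x + 1" using xy by linarith
      ultimately show ?thesis by linarith
    qed
    then have "(y - x - 1) * (1 / y) \<le> real (card S) * (1 / y)" using xy by (intro mult_right_mono) auto
    also have "\<dots> = (\<Sum>n\<in>S. 1 / y)" by simp
    also have "\<dots> \<le> (\<Sum>n\<in>S. 1 / real n)" using S xy by (intro sum_mono divide_left_mono) auto
    finally have "1 - x / y - 1 / y \<le> (\<Sum>n\<in>S. 1 / real n)" using xy by (simp add: diff_divide_distrib)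
    moreover have "x / y = exp (- (2 / l))" by (simp add: x_def y_def flip: exp_diff)
    moreover have "exp (- (2 / l)) \<le> 1 - 1 / l"
    proof -
      define z where "z = 2 / l"
      have z: "0 < z" "z \<le> 1" using l by (auto simp: z_def)
      have "exp (- z) = 1 / exp z" by (simp add: exp_minus inverse_eq_divide)
      also have "\<dots> \<le> 1 / (1 + z)" using exp_ge_add_one_self[of z] z by (intro divide_left_mono) auto
      also have "\<dots> \<le> 1 - z / 2" using z by (simp add: divide_simps) (simp add: algebra_simps mult_left_le)
      finally show ?thesis by (simp add: z_def)
    qed
    moreover have "1 / y \<le> 1 / (2 * l)"
    proof -
      have "1 / y = exp (- T - 1 / l)" by (simp add: y_def exp_diff exp_add exp_minus field_simps)
      also have "\<dots> \<le> exp (- T)" using l by simp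
      finally show ?thesis using T by simp
    qed
    ultimately show ?thesis by (simp add: field_simps)
  qed
  ultimately show ?thesis using S(3) by (intro exI[of _ S]) (auto simp: S_def)
qed

section \<open>Smoothed sums of \<open>mangoldt n - 1\<close> around \<open>ln n = T\<close>\<close>

locale zeta_continuation =
  fixes H :: "complex \<Rightarrow> complex" and \<Omega> :: "complex set"
  assumes opn: "open \<Omega>" and half_plane: "{s. Re s \<ge> 1} \<subseteq> \<Omega>" and hol: "H holomorphic_on \<Omega>"
    and H_sums: "\<And>s. Re s > 1 \<Longrightarrow> (\<lambda>n. (mangoldt n - 1) * of_nat n powr (- s)) sums H s"
begin

text \<open>As an integral this still makes sense at \<open>\<eta> = 0\<close>, on the line itself,
  where \<open>H\<close> is given by continuation only.\<close>

definition osc :: "real \<Rightarrow> real \<Rightarrow> real \<Rightarrow> real" where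
  "osc l \<eta> T = integral {0..l} (\<lambda>t. (1 - t / l) * Re (cis (t * T) * H (Complex (1 + \<eta>) t)))"

lemma H_continuous: "continuous_on {s. Re s \<ge> 1} H"
  using holomorphic_on_imp_continuous_on[OF hol] half_plane continuous_on_subset by blast

lemma continuous_H_line:
  assumes "\<eta> \<ge> 0"
  shows "continuous_on A (\<lambda>t. H (Complex (1 + \<eta>) t))"
proof -
  have "continuous_on A (\<lambda>t. Complex (1 + \<eta>) t)"
    unfolding Complex_eq by (intro continuous_intros)
  then show ?thesis
    by (rule continuous_on_compose2[OF H_continuous]) (use assms in auto)
qed

lemma osc_integrand_continuous:
  assumes "\<eta> \<ge> 0" "l > 0"
  shows "continuous_on {0..l} (\<lambda>t. (1 - t / l) * Re (cis (t * T) * H (Complex (1 + \<eta>) t)))"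
  using assms by (intro continuous_intros continuous_H_line) auto

text \<open>For fixed positive \<eta> the series converges uniformly on the segment, so it can be
  integrated term by term; each term produces one value of \<open>fejer\<close>.\<close>

lemma osc_sums:
  assumes \<eta>: "\<eta> > 0" and l: "l > 0"
  shows "(\<lambda>n. (mangoldt n - 1) * real n powr (- 1 - \<eta>) * fejer l (T - ln (real n))) sums osc l \<eta> T"
proof -
  define c where "c n = (mangoldt n - 1) * real n powr (- 1 - \<eta>)" for n :: nat
  define f where "f n t = c n * ((1 - t / l) * cos (t * (T - ln (real n))))" for n t
  have pw: "(\<lambda>n. f n t) sums ((1 - t / l) * Re (cis (t * T) * H (Complex (1 + \<eta>) t)))" for t
  proof -
    define s where "s = Complex (1 + \<eta>) t"
    have "(\<lambda>n. cis (t * T) * ((mangoldt n - 1) * of_nat n powr (- s))) sums (cis (t * T) * H s)"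
      using \<eta> by (intro sums_mult H_sums) (simp add: s_def)
    from sums_mult[OF sums_Re[OF this], of "1 - t / l"]
    have "(\<lambda>n. (1 - t / l) * Re (cis (t * T) * ((mangoldt n - 1) * of_nat n powr (- s)))) sums ((1
        - t / l) * Re (cis (t * T) * H s))" .
    moreover have "(1 - t / l) * Re (cis (t * T) * ((mangoldt n - 1) * of_nat n powr (- s))) = f n t" for n
    proof (cases "n = 0")
      case True
      then show ?thesis by (simp add: f_def c_def)
    next
      case False
      have m: "(mangoldt n - 1 :: complex) = of_real (mangoldt n - 1)" by simp
      have "(of_nat n :: complex) powr (- s) = exp (- s * of_real (ln (real n)))"
        using False by (simp add: powr_def Ln_of_nat)
      also have "\<dots> = of_real (real n powr (- 1 - \<eta>)) * cis (- t * ln (real n))"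
        using False by (simp add: exp_eq_polar s_def powr_def algebra_simps)
      finally have "cis (t * T) * ((mangoldt n - 1) * of_nat n powr (- s))
          = of_real (c n) * (cis (t * T) * cis (- t * ln (real n)))"
        unfolding m c_def by (simp only: of_real_mult mult_ac)
      also have "cis (t * T) * cis (- t * ln (real n)) = cis (t * (T - ln (real n)))"
        by (simp add: cis_mult algebra_simps)
      finally show ?thesis by (simp add: f_def)
    qed
    ultimately show ?thesis by (simp add: s_def)
  qed
  have ul: "uniform_limit {0..l} (\<lambda>n t. \<Sum>i<n. f i t) (\<lambda>t. \<Sum>i. f i t) sequentially"
  proof (rule Weierstrass_m_test)
    show "summable (\<lambda>n. mangoldt n * real n powr (- (1 + \<eta>)) + real n powr (- (1 + \<eta>)))"
      using \<eta> by (intro summable_add summable_mangoldt_powr) (auto simp: summable_real_powr_iff)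
    fix n t assume t: "t \<in> {0..l}"
    have "\<bar>(1 - t / l) * cos (t * (T - ln (real n)))\<bar> \<le> 1"
      unfolding abs_mult using t l by (intro mult_le_one) auto
    then have "\<bar>c n\<bar> * \<bar>(1 - t / l) * cos (t * (T - ln (real n)))\<bar> \<le> \<bar>c n\<bar> * 1"
      by (intro mult_left_mono) auto
    then have "norm (f n t) \<le> \<bar>c n\<bar>" by (simp add: f_def abs_mult)
    also have "\<bar>c n\<bar> \<le> (mangoldt n + 1) * real n powr (- 1 - \<eta>)"
      unfolding c_def abs_mult using mangoldt_nonneg[of n] by (intro mult_mono) auto
    finally show "norm (f n t) \<le> mangoldt n * real n powr (- (1 + \<eta>)) + real n powr (- (1 + \<eta>))"
      by (simp add: distrib_right)
  qed
  have cont: "continuous_on {0..l} (\<lambda>t. \<Sum>i<n. f i t)" for n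
    unfolding f_def using l by (intro continuous_intros) auto
  obtain I J where IJ: "\<And>n. ((\<lambda>t. \<Sum>i<n. f i t) has_integral I n) {0..l}"
    "((\<lambda>t. \<Sum>i. f i t) has_integral J) {0..l}" "I \<longlonglongrightarrow> J"
    using uniform_limit_integral[OF ul cont] by (metis sequentially_bot)
  have "J = osc l \<eta> T"
  proof -
    have "(\<lambda>t. \<Sum>i. f i t) = (\<lambda>t. (1 - t / l) * Re (cis (t * T) * H (Complex (1 + \<eta>) t)))"
      using sums_unique[OF pw] by auto
    then show ?thesis using IJ(2) unfolding osc_def by (metis integral_unique)
  qed
  moreover have "I = (\<lambda>n. \<Sum>i<n. c i * fejer l (T - ln (real i)))"
  proof
    fix n
    have "((\<lambda>t. \<Sum>i<n. f i t) has_integral (\<Sum>i<n. c i * fejer l (T - ln (real i)))) {0..l}"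
      unfolding f_def fejer_def using l
      by (intro has_integral_sum has_integral_mult_right integrable_integral fejer_integrable) auto
    then show "I n = (\<Sum>i<n. c i * fejer l (T - ln (real i)))" using IJ(1) has_integral_unique by blast
  qed
  ultimately show ?thesis using IJ(3) unfolding sums_def c_def by (simp only:)
qed

lemma continuous_on_osc:
  assumes "l > 0"
  shows "continuous_on {0..1} (\<lambda>\<eta>. osc l \<eta> T)"
proof -
  have "continuous_on ({0..1} \<times> cbox 0 l) (\<lambda>(\<eta>, t). (1 - t / l) * Re (cis (t * T) * H (Complex (1 + \<eta>) t)))"
  proof -
    have "continuous_on ({0..1} \<times> cbox 0 l) (\<lambda>x. H (Complex (1 + fst x) (snd x)))"
      unfolding Complex_eq
      by (rule continuous_on_compose2[OF H_continuous]) (auto intro!: continuous_intros)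
    then show ?thesis unfolding case_prod_unfold using assms by (intro continuous_intros) auto
  qed
  then show ?thesis
    unfolding osc_def by (intro integral_continuous_on_param[where a = 0 and b = l, simplified]) auto
qed

text \<open>Continuity of \<open>H\<close> on a compact rectangle. The uniformity in \<eta> and
  \<open>T\<close> is what \<open>mangoldt_window_bound\<close> rests on.\<close>

lemma osc_bounded:
  assumes l: "l > 0"
  shows "\<exists>B. \<forall>\<eta>\<in>{0..1}. \<forall>T. \<bar>osc l \<eta> T\<bar> \<le> B"
proof -
  let ?K = "{0..1} \<times> {0..l}"
  have "continuous_on ?K (\<lambda>x. H (Complex (1 + fst x) (snd x)))"
    unfolding Complex_eq
    by (rule continuous_on_compose2[OF H_continuous]) (auto intro!: continuous_intros)
  then have "bounded ((\<lambda>x. H (Complex (1 + fst x) (snd x))) ` ?K)"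
    by (intro compact_imp_bounded compact_continuous_image compact_Times) auto
  then obtain B where B: "\<And>\<eta> t. \<eta> \<in> {0..1} \<Longrightarrow> t \<in> {0..l} \<Longrightarrow> cmod (H (Complex (1 + \<eta>) t)) \<le> B"
    unfolding bounded_iff by fastforce
  have "\<bar>osc l \<eta> T\<bar> \<le> B * (l - 0)" if \<eta>: "\<eta> \<in> {0..1}" for \<eta> T
    unfolding osc_def real_norm_def[symmetric]
  proof (rule integral_bound)
    show "continuous_on {0..l} (\<lambda>t. (1 - t / l) * Re (cis (t * T) * H (Complex (1 + \<eta>) t)))"
      using \<eta> l by (intro osc_integrand_continuous) auto
    fix t assume t: "t \<in> {0..l}"
    have "\<bar>1 - t / l\<bar> \<le> 1" using t l by (auto simp: abs_le_iff)
    moreover have "\<bar>Re (cis (t * T) * H (Complex (1 + \<eta>) t))\<bar> \<le> cmod (cis (t * T) * H (Complex (1 + \<eta>) t))"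
      by (rule abs_Re_le_cmod)
    ultimately have "\<bar>1 - t / l\<bar> * \<bar>Re (cis (t * T) * H (Complex (1 + \<eta>) t))\<bar>
        \<le> 1 * cmod (H (Complex (1 + \<eta>) t))"
      by (intro mult_mono) (auto simp: norm_mult)
    then show "norm ((1 - t / l) * Re (cis (t * T) * H (Complex (1 + \<eta>) t))) \<le> B"
      using B[OF \<eta> t] by (simp add: abs_mult)
  qed (use l in auto)
  then show ?thesis by blast
qed

text \<open>The Riemann-Lebesgue lemma with a rate: \<open>H\<close> is holomorphic across the line,
  so one integration by parts gives a bound \<open>M / T\<close>.\<close>

lemma osc_0_tendsto:
  assumes l: "l > 0"
  shows "(osc l 0 \<longlongrightarrow> 0) at_top"
proof -
  define h where "h t = H (Complex 1 t)" for t
  define h' where "h' t = \<i> * deriv H (Complex 1 t)" for t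
  have hd: "(h has_vector_derivative h' t) (at t within A)" for t A
  proof -
    have "Complex 1 t \<in> \<Omega>" using half_plane by auto
    then have "(H has_field_derivative deriv H (Complex 1 t)) (at (Complex 1 t))"
      using hol opn holomorphic_derivI by blast
    moreover have "((\<lambda>t. Complex 1 t) has_vector_derivative \<i>) (at t within A)"
      unfolding Complex_eq by (auto intro!: derivative_eq_intros)
    ultimately have "(H \<circ> (\<lambda>t. Complex 1 t) has_vector_derivative \<i>
        * deriv H (Complex 1 t)) (at t within A)"
      by (intro field_vector_diff_chain_within) (auto intro: has_field_derivative_at_within)
    moreover have "H \<circ> (\<lambda>t. Complex 1 t) = h" by (simp add: fun_eq_iff h_def)
    ultimately show ?thesis by (simp add: h'_def)
  qed
  have ch: "continuous_on A h" for A
    using hd by (meson continuous_on_vector_derivative)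
  have ch': "continuous_on A h'" for A
  proof -
    have "continuous_on \<Omega> (deriv H)" using holomorphic_deriv[OF hol opn]
      by (rule holomorphic_on_imp_continuous_on)
    moreover have "continuous_on A (\<lambda>t. Complex 1 t)" unfolding Complex_eq by (intro continuous_intros)
    ultimately have "continuous_on A (\<lambda>t. deriv H (Complex 1 t))"
      by (rule continuous_on_compose2) (use half_plane in auto)
    then show ?thesis unfolding h'_def by (intro continuous_intros)
  qed
  define g where "g t = of_real (1 - t / l) * h t" for t
  define g' where "g' t = of_real (1 - t / l) * h' t - of_real (1 / l) * h t" for t
  have gd: "(g has_vector_derivative g' t) (at t within A)" for t A
    unfolding g_def g'_def using l
    by (auto intro!: derivative_eq_intros hd simp: scaleR_conv_of_real)
  have cg: "continuous_on A g" and cg': "continuous_on A g'" for A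
    unfolding g_def g'_def using l by (auto intro!: continuous_intros ch ch')
  have "bounded (g' ` {0..l})" by (intro compact_imp_bounded compact_continuous_image cg') auto
  then obtain B where B: "\<And>t. t \<in> {0..l} \<Longrightarrow> cmod (g' t) \<le> B" unfolding bounded_iff by fastforce
  define M where "M = cmod (g l) + cmod (g 0) + B * l"
  have main: "\<bar>osc l 0 T\<bar> \<le> M / T" if T: "T > 0" for T
  proof -
    define G where "G t = g t * cis (t * T)" for t
    have cd: "((\<lambda>t. cis (t * T)) has_vector_derivative \<i> * of_real T * cis (t * T)) (at t within {0..l})"
      for t
    proof -
      have "((\<lambda>z. exp (\<i> * of_real T * z)) has_field_derivative \<i> * of_real T
          * exp (\<i> * of_real T * of_real t)) (at (of_real t))"
        by (auto intro!: derivative_eq_intros)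
      from has_vector_derivative_real_field[OF this] show ?thesis by (simp add: cis_conv_exp mult_ac)
    qed
    have "(G has_vector_derivative (g t * (\<i> * of_real T * cis (t * T)) + g' t
        * cis (t * T))) (at t within {0..l})" for t
      unfolding G_def by (rule has_vector_derivative_mult[OF gd cd])
    then have "((\<lambda>t. g t * (\<i> * of_real T * cis (t * T)) + g' t * cis (t * T)) has_integral (G l
        - G 0)) {0..l}"
      using l by (intro fundamental_theorem_of_calculus) auto
    moreover have i2: "(\<lambda>t. g' t * cis (t * T)) integrable_on {0..l}"
      by (intro integrable_continuous_interval continuous_intros cg')
    have i1: "(\<lambda>t. g t * cis (t * T)) integrable_on {0..l}"
      by (intro integrable_continuous_interval continuous_intros cg)
    then have "((\<lambda>t. (\<i> * of_real T) * (g t * cis (t * T)) + g' t * cis (t * T)) has_integral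
       ((\<i> * of_real T) * integral {0..l} (\<lambda>t. g t * cis (t * T)) + integral {0..l}
         (\<lambda>t. g' t * cis (t * T)))) {0..l}"
      using i2 by (intro has_integral_add has_integral_mult_right integrable_integral)
    ultimately have eq: "(\<i> * of_real T) * integral {0..l} (\<lambda>t. g t * cis (t * T))
        + integral {0..l} (\<lambda>t. g' t * cis (t * T)) = G l - G 0"
      by (simp add: mult_ac has_integral_iff)
    have b: "cmod (integral {0..l} (\<lambda>t. g' t * cis (t * T))) \<le> B * (l - 0)"
      using l B by (intro integral_bound continuous_intros cg') (auto simp: norm_mult)
    have "T * cmod (integral {0..l} (\<lambda>t. g t * cis (t * T)))
        = cmod ((\<i> * of_real T) * integral {0..l} (\<lambda>t. g t * cis (t * T)))"
      using T by (simp add: norm_mult)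
    also have "\<dots> = cmod (G l - G 0 - integral {0..l} (\<lambda>t. g' t * cis (t * T)))" unfolding eq[symmetric]
      by simp
    also have "\<dots> \<le> cmod (G l) + cmod (G 0) + cmod (integral {0..l} (\<lambda>t. g' t * cis (t * T)))"
      by (meson add_right_mono norm_triangle_ineq4 order_trans)
    also have "\<dots> \<le> M" using b by (simp add: M_def G_def norm_mult)
    finally have 1: "cmod (integral {0..l} (\<lambda>t. g t * cis (t * T))) \<le> M / T" using T
      by (simp add: field_simps)
    have "osc l 0 T = integral {0..l} (\<lambda>t. Re (g t * cis (t * T)))"
    proof -
      have "Re (g t * cis (t * T)) = (1 - t / l) * Re (cis (t * T) * H (Complex 1 t))" for t
      proof -
        have "g t * cis (t * T) = of_real (1 - t / l) * (cis (t * T) * H (Complex 1 t))"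
          by (simp only: g_def h_def mult_ac)
        moreover have "Re (of_real c * z) = c * Re z" for c z by simp
        ultimately show ?thesis by (simp only:)
      qed
      then show ?thesis by (simp add: osc_def)
    qed
    also have "\<dots> = Re (integral {0..l} (\<lambda>t. g t * cis (t * T)))"
      using integral_linear[OF i1 bounded_linear_Re] by (simp add: o_def)
    finally show ?thesis using 1 abs_Re_le_cmod order_trans by metis
  qed
  have "((\<lambda>T. M / T) \<longlongrightarrow> 0) at_top" by real_asymp
  moreover have "eventually (\<lambda>T. norm (osc l 0 T) \<le> M / T) at_top"
    using eventually_gt_at_top[of 0] by eventually_elim (use main in auto)
  ultimately show ?thesis by (rule Lim_null_comparison[rotated])
qed

definition fejer_sum :: "(nat \<Rightarrow> real) \<Rightarrow> real \<Rightarrow> real \<Rightarrow> real \<Rightarrow> real" where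
  "fejer_sum a l \<eta> T = (\<Sum>n. a n * real n powr (- 1 - \<eta>) * fejer l (T - ln (real n)))"

lemma fejer_summable:
  assumes "summable (\<lambda>n. a n * real n powr (- 1 - \<eta>))" "\<And>n. a n \<ge> 0" "l > 0"
  shows "summable (\<lambda>n. a n * real n powr (- 1 - \<eta>) * fejer l (T - ln (real n)))"
proof (rule summable_comparison_test'[OF summable_mult2[OF assms(1), of l], of 0])
  fix n
  have "a n * real n powr (- 1 - \<eta>) * fejer l (T - ln (real n)) \<le> a n * real n powr (- 1 - \<eta>) * l"
    using assms fejer_le_l by (intro mult_left_mono) auto
  then show "norm (a n * real n powr (- 1 - \<eta>) * fejer l (T - ln (real n)))
      \<le> a n * real n powr (- 1 - \<eta>) * l"
    using assms fejer_nonneg[of l] by simp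
qed

lemma summable_mangoldt_eta: "\<eta> > 0 \<Longrightarrow> summable (\<lambda>n. mangoldt n * real n powr (- 1 - \<eta>))"
  using summable_mangoldt_powr[of "1 + \<eta>"] by simp

lemma summable_one_eta: "\<eta> > 0 \<Longrightarrow> summable (\<lambda>n. 1 * real n powr (- 1 - \<eta>))"
  by (simp add: summable_real_powr_iff)

lemma fejer_sum_mangoldt:
  assumes "\<eta> > 0" "l > 0"
  shows "fejer_sum mangoldt l \<eta> T = fejer_sum (\<lambda>_. 1) l \<eta> T + osc l \<eta> T"
proof -
  have 1: "summable (\<lambda>n. mangoldt n * real n powr (- 1 - \<eta>) * fejer l (T - ln (real n)))"
    using assms by (intro fejer_summable summable_mangoldt_eta mangoldt_nonneg)
  have 2: "summable (\<lambda>n. 1 * real n powr (- 1 - \<eta>) * fejer l (T - ln (real n)))"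
    using assms by (intro fejer_summable summable_one_eta) auto
  have "(\<lambda>n. (mangoldt n * real n powr (- 1 - \<eta>) * fejer l (T - ln (real n)))
      - (1 * real n powr (- 1 - \<eta>) * fejer l (T - ln (real n))))
     sums (fejer_sum mangoldt l \<eta> T - fejer_sum (\<lambda>_. 1) l \<eta> T)"
    unfolding fejer_sum_def by (intro sums_diff summable_sums 1 2)
  moreover have "(mangoldt n * real n powr (- 1 - \<eta>) * fejer l (T - ln (real n)))
      - (1 * real n powr (- 1 - \<eta>) * fejer l (T - ln (real n)))
     = (mangoldt n - 1) * real n powr (- 1 - \<eta>) * fejer l (T - ln (real n))" for n :: nat
    by (simp add: left_diff_distrib)
  ultimately have "fejer_sum mangoldt l \<eta> T - fejer_sum (\<lambda>_. 1) l \<eta> T = osc l \<eta> T"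
    using osc_sums[OF assms, of T] sums_unique2 by fastforce
  then show ?thesis by simp
qed

lemma powr_eta_le: "\<eta> \<ge> 0 \<Longrightarrow> n > 0 \<Longrightarrow> real n powr (- 1 - \<eta>) \<le> 1 / real n"
  using powr_mono[of "- 1 - \<eta>" "- 1" "real n"] by (simp add: powr_minus inverse_eq_divide)

lemma powr_eta_tendsto: "n > 0 \<Longrightarrow> ((\<lambda>\<eta>. real n powr (- 1 - \<eta>)) \<longlongrightarrow> 1 / real n) (at_right 0)"
proof -
  assume n: "n > 0"
  have "((\<lambda>\<eta>. real n powr (- 1 - \<eta>)) \<longlongrightarrow> real n powr (- 1 - 0)) (at_right 0)"
    using n by (intro tendsto_intros) auto
  then show ?thesis using n by (simp add: powr_minus inverse_eq_divide)
qed

lemma osc_tendsto: "l > 0 \<Longrightarrow> ((\<lambda>\<eta>. osc l \<eta> T) \<longlongrightarrow> osc l 0 T) (at_right 0)"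
proof -
  assume l: "l > 0"
  have "((\<lambda>\<eta>. osc l \<eta> T) \<longlongrightarrow> osc l 0 T) (at 0 within {0..1})"
    using continuous_on_osc[OF l, of T] by (simp add: continuous_on_def)
  then show ?thesis by (simp add: at_within_Icc_at_right)
qed

text \<open>A Chebyshev-type estimate. With \<open>l = 1\<close> the kernel is at least 1/4 on the
  window around its centre, while the whole smoothed sum is that of the constant 1, which is
  bounded, plus the bounded \<open>osc\<close>. A window is finite, so \<eta> can tend to 0.\<close>

lemma mangoldt_window_bound: "\<exists>A. \<forall>k. (\<Sum>n\<in>ln_window k. mangoldt n / real n) \<le> A"
proof -
  obtain C where C: "C > 0" "\<And>a A T S. (\<forall>n. a n \<ge> 0) \<Longrightarrow> (\<forall>k. (\<Sum>n\<in>ln_window k. a n) \<le> A) \<Longrightarrow> T \<ge> 0 \<Longrightarrow>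
      finite S \<Longrightarrow> 0 \<notin> S \<Longrightarrow>
     (\<Sum>n\<in>S. a n / (1 + (T - ln (real n))\<^sup>2)) \<le> C * A" using window_sum_bound by blast
  obtain B where "\<forall>\<eta>\<in>{0..1}. \<forall>T. \<bar>osc 1 \<eta> T\<bar> \<le> B" using osc_bounded[of 1] by auto
  then have B: "\<bar>osc 1 \<eta> T\<bar> \<le> B" if "\<eta> \<in> {0..1}" for \<eta> T using that by blast
  have one: "fejer_sum (\<lambda>_. 1) 1 \<eta> T \<le> 4 * (C * 3)" if "\<eta> > 0" "T \<ge> 0" for \<eta> T
    unfolding fejer_sum_def
  proof (rule suminf_le_const)
    show "summable (\<lambda>n. 1 * real n powr (- 1 - \<eta>) * fejer 1 (T - ln (real n)))"
      using that by (intro fejer_summable summable_one_eta) auto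
    fix m
    have "(\<Sum>n<m. 1 * real n powr (- 1 - \<eta>) * fejer 1 (T - ln (real n)))
        = (\<Sum>n\<in>{..<m} - {0}. 1 * real n powr (- 1 - \<eta>) * fejer 1 (T - ln (real n)))"
      by (intro sum.mono_neutral_right) auto
    also have "\<dots> \<le> (\<Sum>n\<in>{..<m} - {0}. 4 * (1 / real n / (1 + (T - ln (real n))\<^sup>2)))"
    proof (rule sum_mono)
      fix n assume "n \<in> {..<m} - {0}"
      then have "real n powr (- 1 - \<eta>) * fejer 1 (T - ln (real n))
          \<le> 1 / real n * (4 / (1 + (T - ln (real n))\<^sup>2))"
        using that powr_eta_le[of \<eta> n] fejer_1_le fejer_nonneg[of 1] by (intro mult_mono) auto
      then show "1 * real n powr (- 1 - \<eta>) * fejer 1 (T - ln (real n))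
          \<le> 4 * (1 / real n / (1 + (T - ln (real n))\<^sup>2))" by simp
    qed
    also have "\<dots> = 4 * (\<Sum>n\<in>{..<m} - {0}. 1 / real n / (1 + (T - ln (real n))\<^sup>2))"
      by (rule sum_distrib_left[symmetric])
    also have "\<dots> \<le> 4 * (C * 3)"
      using that ln_window_sum_inverse by (intro mult_left_mono C(2)) auto
    finally show "(\<Sum>n<m. 1 * real n powr (- 1 - \<eta>) * fejer 1 (T - ln (real n))) \<le> 4 * (C * 3)" .
  qed
  have "(\<Sum>n\<in>ln_window k. mangoldt n / real n) \<le> 4 * (4 * (C * 3) + B)" for k
  proof -
    define T where "T = real k + 1 / 2"
    have T: "T \<ge> 0" by (simp add: T_def)
    have fin: "(\<Sum>n\<in>ln_window k. mangoldt n * real n powr (- 1 - \<eta>) * (1 / 4)) \<le> 4 * (C * 3) + B"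
      if \<eta>: "\<eta> > 0" "\<eta> \<le> 1" for \<eta>
    proof -
      have "(\<Sum>n\<in>ln_window k. mangoldt n * real n powr (- 1 - \<eta>) * (1 / 4))
          \<le> (\<Sum>n\<in>ln_window k. mangoldt n * real n powr (- 1 - \<eta>) * fejer 1 (T - ln (real n)))"
      proof (rule sum_mono)
        fix n assume "n \<in> ln_window k"
        then have "\<bar>T - ln (real n)\<bar> \<le> 1 / 1" by (auto simp: ln_window_def T_def abs_le_iff)
        then have "1 / 4 \<le> fejer 1 (T - ln (real n))" by (intro fejer_ge) auto
        then show "mangoldt n * real n powr (- 1 - \<eta>) * (1 / 4)
            \<le> mangoldt n * real n powr (- 1 - \<eta>) * fejer 1 (T - ln (real n))"
          by (intro mult_left_mono) (auto simp: mangoldt_nonneg)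
      qed
      also have "\<dots> \<le> fejer_sum mangoldt 1 \<eta> T"
        unfolding fejer_sum_def using \<eta> fejer_nonneg[of 1]
        by (intro sum_le_suminf fejer_summable summable_mangoldt_eta finite_ln_window)
          (auto simp: mangoldt_nonneg)
      also have "\<dots> \<le> 4 * (C * 3) + B"
        using fejer_sum_mangoldt[of \<eta> 1 T] one[OF \<eta>(1) T] B[of \<eta> T] \<eta> by auto
      finally show ?thesis .
    qed
    have "((\<lambda>\<eta>. \<Sum>n\<in>ln_window k. mangoldt n * real n powr (- 1 - \<eta>)
        * (1 / 4)) \<longlongrightarrow> (\<Sum>n\<in>ln_window k. mangoldt n * (1 / real n) * (1 / 4))) (at_right 0)"
      by (intro tendsto_intros powr_eta_tendsto) (simp add: ln_window_def)
    moreover have "eventually (\<lambda>\<eta>. (\<Sum>n\<in>ln_window k. mangoldt n * real n powr (- 1 - \<eta>) * (1 / 4))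
        \<le> 4 * (C * 3) + B) (at_right 0)"
      using eventually_at_right[of 0 "1 :: real"] fin by (auto intro!: exI[of _ 1])
    ultimately have "(\<Sum>n\<in>ln_window k. mangoldt n * (1 / real n) * (1 / 4)) \<le> 4 * (C * 3) + B"
      by (rule tendsto_upperbound) auto
    moreover have "(\<Sum>n\<in>ln_window k. mangoldt n * (1 / real n) * (1 / 4))
        = (\<Sum>n\<in>ln_window k. mangoldt n / real n) * (1 / 4 :: real)"
      by (subst sum_distrib_right) simp
    ultimately have "(\<Sum>n\<in>ln_window k. mangoldt n / real n) * (1 / 4) \<le> 4 * (C * 3) + B" by simp
    then show ?thesis by simp
  qed
  then show ?thesis by blast
qed

text \<open>Without prime powers near \<open>exp T\<close> the kernel would see
  \<open>mangoldt\<close> with total weight of order \<open>1 / l\<close>, whereas the constant 1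
  contributes at least 1/8 for every \<open>l\<close>. The difference is \<open>osc\<close>, which
  vanishes for large \<open>T\<close>.\<close>

theorem primepow_near_exp:
  assumes \<delta>: "\<delta> > 0"
  shows "eventually (\<lambda>T. \<exists>n. primepow n \<and> \<bar>T - ln (real n)\<bar> < \<delta>) at_top"
proof -
  obtain A where A: "\<And>k. (\<Sum>n\<in>ln_window k. mangoldt n / real n) \<le> A" using mangoldt_window_bound by blast
  obtain C where C: "C > 0" "\<And>a A T S. (\<forall>n. a n \<ge> 0) \<Longrightarrow> (\<forall>k. (\<Sum>n\<in>ln_window k. a n) \<le> A) \<Longrightarrow> T \<ge> 0 \<Longrightarrow>
      finite S \<Longrightarrow> 0 \<notin> S \<Longrightarrow>
     (\<Sum>n\<in>S. a n / (1 + (T - ln (real n))\<^sup>2)) \<le> C * A" using window_sum_bound by blast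
  define D where "D = (1 + 1 / \<delta>\<^sup>2) * (C * \<bar>A\<bar>)"
  have D: "D \<ge> 0" using C by (auto simp: D_def intro!: mult_nonneg_nonneg add_nonneg_nonneg)
  \<comment> \<open>The factor 64 brings \<open>2 / l * D\<close> below 1/32; with
    \<open>osc\<close> also below 1/32 in absolute value this contradicts 1/8. The choice of
    \<open>l\<close> precedes that of \<open>T\<close>, because the decay of \<open>osc\<close>
    depends on \<open>l\<close>.\<close>
  define l where "l = 2 + 64 * D"
  have l: "l \<ge> 2" "l > 0" using D by (auto simp: l_def)
  have lD: "2 / l * D \<le> 1 / 32" using D by (simp add: l_def divide_simps)
  have ev1: "eventually (\<lambda>T. \<bar>osc l 0 T\<bar> < 1 / 32) at_top"
    using tendstoD[OF osc_0_tendsto[OF l(2)], of "1 / 32"] by (simp add: dist_real_def)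
  have "((\<lambda>T :: real. exp (- T)) \<longlongrightarrow> 0) at_top" by real_asymp
  then have ev2: "eventually (\<lambda>T :: real. exp (- T) < 1 / (2 * l)) at_top"
    using l by (intro order_tendstoD) auto
  show ?thesis
    using ev1 ev2 eventually_ge_at_top[of 0]
  proof eventually_elim
    case (elim T)
    show ?case
    proof (rule ccontr)
      assume none: "\<not> (\<exists>n. primepow n \<and> \<bar>T - ln (real n)\<bar> < \<delta>)"
      obtain S where S: "finite S" "\<And>n. n \<in> S \<Longrightarrow>
          n > 0 \<and> \<bar>T - ln (real n)\<bar> \<le> 1 / l" "(\<Sum>n\<in>S. 1 / real n) \<ge> 1 / (2 * l)"
        using sum_inverse_near_ge[of l T] l elim by auto
      have up: "fejer_sum mangoldt l \<eta> T \<le> 1 / 32" if \<eta>: "\<eta> > 0" for \<eta>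
        unfolding fejer_sum_def
      proof (rule suminf_le_const)
        show "summable (\<lambda>n. mangoldt n * real n powr (- 1 - \<eta>) * fejer l (T - ln (real n)))"
          using \<eta> l by (intro fejer_summable summable_mangoldt_eta mangoldt_nonneg)
        fix m
        have "(\<Sum>n<m. mangoldt n * real n powr (- 1 - \<eta>) * fejer l (T - ln (real n)))
          = (\<Sum>n\<in>{..<m} - {0}. mangoldt n * real n powr (- 1 - \<eta>) * fejer l (T - ln (real n)))"
          by (intro sum.mono_neutral_right) auto
        also have "\<dots> \<le> (\<Sum>n\<in>{..<m} - {0}. 2 / l * (1 + 1 / \<delta>\<^sup>2)
            * (mangoldt n / real n / (1 + (T - ln (real n))\<^sup>2)))"
        proof (rule sum_mono)
          fix n assume n: "n \<in> {..<m} - {0}"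
          show "mangoldt n * real n powr (- 1 - \<eta>) * fejer l (T - ln (real n))
             \<le> 2 / l * (1 + 1 / \<delta>\<^sup>2) * (mangoldt n / real n / (1 + (T - ln (real n))\<^sup>2))"
          proof (cases "primepow n")
            case True
            then have "\<bar>T - ln (real n)\<bar> \<ge> \<delta>" using none by (auto simp: not_less)
            then have 1: "fejer l (T - ln (real n)) \<le> 2 / l * (1 + 1 / \<delta>\<^sup>2) / (1 + (T - ln (real n))\<^sup>2)"
              using l \<delta> by (intro fejer_le_away)
            have 2: "mangoldt n * real n powr (- 1 - \<eta>) \<le> mangoldt n * (1 / real n)"
              using powr_eta_le[of \<eta> n] \<eta> n by (intro mult_left_mono) (auto simp: mangoldt_nonneg)
            have "mangoldt n * real n powr (- 1 - \<eta>) * fejer l (T - ln (real n))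
              \<le> mangoldt n * (1 / real n) * (2 / l * (1 + 1 / \<delta>\<^sup>2) / (1 + (T - ln (real n))\<^sup>2))"
              by (rule mult_mono[OF 2 1]) (use fejer_nonneg[OF l(2)] in \<open>auto simp: mangoldt_nonneg\<close>)
            then show ?thesis by (simp add: mult_ac)
          qed (simp add: mangoldt_def)
        qed
        also have "\<dots> = 2 / l * (1 + 1 / \<delta>\<^sup>2)
            * (\<Sum>n\<in>{..<m} - {0}. mangoldt n / real n / (1 + (T - ln (real n))\<^sup>2))"
          by (rule sum_distrib_left[symmetric])
        also have "\<dots> \<le> 2 / l * (1 + 1 / \<delta>\<^sup>2) * (C * A)"
          using elim A l by (intro mult_left_mono C(2)) (auto simp: mangoldt_nonneg)
        also have "\<dots> \<le> 2 / l * (1 + 1 / \<delta>\<^sup>2) * (C * \<bar>A\<bar>)"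
          using C l by (intro mult_left_mono) auto
        also have "\<dots> = 2 / l * D" by (simp add: D_def)
        finally show "(\<Sum>n<m. mangoldt n * real n powr (- 1 - \<eta>) * fejer l (T - ln (real n))) \<le> 1 / 32"
          using lD by simp
      qed
      have low: "(\<Sum>n\<in>S. 1 * real n powr (- 1 - \<eta>) * (l / 4)) + osc l \<eta> T \<le> 1 / 32" if \<eta>: "\<eta> > 0" for \<eta>
      proof -
        have "(\<Sum>n\<in>S. 1 * real n powr (- 1 - \<eta>) * (l / 4))
            \<le> (\<Sum>n\<in>S. 1 * real n powr (- 1 - \<eta>) * fejer l (T - ln (real n)))"
          using S l by (intro sum_mono mult_left_mono fejer_ge) auto
        also have "\<dots> \<le> fejer_sum (\<lambda>_. 1) l \<eta> T"
          unfolding fejer_sum_def using \<eta> fejer_nonneg[OF l(2)] S l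
          by (intro sum_le_suminf fejer_summable summable_one_eta) auto
        finally show ?thesis using fejer_sum_mangoldt[OF \<eta> l(2), of T] up[OF \<eta>] by linarith
      qed
      \<comment> \<open>Here \<eta> tends to 0 at fixed \<open>T\<close>, since the smallness of
        \<open>osc\<close> is known only at \<open>\<eta> = 0\<close>.\<close>
      have "((\<lambda>\<eta>. (\<Sum>n\<in>S. 1 * real n powr (- 1 - \<eta>) * (l / 4)) + osc l \<eta> T) \<longlongrightarrow> (\<Sum>n\<in>S. 1 * (1 / real n)
          * (l / 4)) + osc l 0 T) (at_right 0)"
        using S l by (intro tendsto_intros powr_eta_tendsto osc_tendsto) auto
      moreover have "eventually (\<lambda>\<eta>. (\<Sum>n\<in>S. 1 * real n powr (- 1 - \<eta>) * (l / 4)) + osc l \<eta> T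
          \<le> 1 / 32) (at_right 0)"
        using eventually_at_right_less[of 0] by eventually_elim (rule low)
      ultimately have "(\<Sum>n\<in>S. 1 * (1 / real n) * (l / 4)) + osc l 0 T \<le> 1 / 32"
        by (rule tendsto_upperbound) auto
      moreover have "(\<Sum>n\<in>S. 1 * (1 / real n) * (l / 4)) \<ge> 1 / 8"
      proof -
        have "(\<Sum>n\<in>S. 1 * (1 / real n) * (l / 4)) = (\<Sum>n\<in>S. 1 / real n) * (l / 4)"
          by (simp add: sum_distrib_right)
        also have "\<dots> \<ge> 1 / (2 * l) * (l / 4)" using S l by (intro mult_right_mono) auto
        finally show ?thesis using l by simp
      qed
      ultimately show False using elim(1) by linarith
    qed
  qed
qed

end

text \<open>Centring at \<open>ln x - \<delta> / 2\<close> turns the two-sided estimate into one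
  from below, as required by \<open>q ^ a \<le> n\<close>.\<close>

corollary eventually_primepow_between:
  assumes "\<delta> > 0"
  shows "eventually (\<lambda>x :: real. \<exists>q. primepow q \<and> exp (- \<delta>) * x \<le> real q \<and> real q \<le> x) at_top"
proof -
  obtain H \<Omega> where "open \<Omega>" "{s. Re s \<ge> 1} \<subseteq> \<Omega>" "H holomorphic_on \<Omega>"
    "\<And>s. Re s > 1 \<Longrightarrow> (\<lambda>n. (mangoldt n - 1) * of_nat n powr (- s)) sums H s"
    using mangoldt_minus_one_continuation by blast
  then interpret zeta_continuation H \<Omega> by unfold_locales
  have "filterlim (\<lambda>x :: real. ln x - \<delta> / 2) at_top at_top" by real_asymp
  then have "eventually (\<lambda>x. \<exists>n. primepow n \<and> \<bar>(ln x - \<delta> / 2) - ln (real n)\<bar> < \<delta> / 2) at_top"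
    using eventually_compose_filterlim[OF primepow_near_exp[of "\<delta> / 2"]] assms by simp
  then show ?thesis using eventually_gt_at_top[of 0]
  proof eventually_elim
    case (elim x)
    then obtain n where n: "primepow n" "\<bar>(ln x - \<delta> / 2) - ln (real n)\<bar> < \<delta> / 2" by blast
    have n0: "real n > 0" using primepow_gt_0_nat[OF n(1)] by simp
    have "ln x - \<delta> \<le> ln (real n)" "ln (real n) \<le> ln x" using n(2) by (auto simp: abs_less_iff field_simps)
    then have "exp (ln x - \<delta>) \<le> exp (ln (real n))" "exp (ln (real n)) \<le> exp (ln x)" by auto
    then show ?case using n n0 elim by (intro exI[of _ n]) (auto simp: exp_diff exp_minus field_simps)
  qed
qed

section \<open>Bounds on the generalized Turan number\<close>

abbreviation edge_rel :: "'a graph \<Rightarrow> 'a \<Rightarrow> 'a \<Rightarrow> bool" where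
  "edge_rel G x y \<equiv> {x, y} \<in> edges G"

lemma edge_rel_irrefl: "simple_graph G \<Longrightarrow> \<not> edge_rel G x x"
  by (auto simp: simple_graph_def nsets_def)

lemma edge_rel_symp: "symp (edge_rel G)"
  by (auto simp: symp_def insert_commute)

lemma copies_complete_graph:
  assumes G: "simple_graph G"
  shows "copies (complete_graph r) G = (\<lambda>S. (S, [S]\<^bsup>2\<^esup>)) ` cliques (edge_rel G) (verts G) r"
proof (intro equalityI subsetI)
  fix H assume H: "H \<in> copies (complete_graph r) G"
  then obtain f where f: "bij_betw f {..<r} (verts H)" "edges H = (\<lambda>e. f ` e) ` [{..<r}]\<^bsup>2\<^esup>"
    by (auto simp: copies_def graph_iso_def complete_graph_def)
  have "edges H = [verts H]\<^bsup>2\<^esup>"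
    using bij_betw_nsets[OF f(1), of 2] f(2) by (auto simp: bij_betw_def)
  moreover have "verts H \<in> cliques (edge_rel G) (verts G) r"
  proof -
    have sub: "verts H \<subseteq> verts G" "edges H \<subseteq> edges G" "finite (verts H)"
      using H by (auto simp: copies_def subgraph_def simple_graph_def)
    have "{x, y} \<in> edges G" if "x \<in> verts H" "y \<in> verts H" "x \<noteq> y" for x y
    proof -
      have "{x, y} \<in> [verts H]\<^bsup>2\<^esup>" using that by (auto simp: nsets_def)
      then show ?thesis using sub \<open>edges H = [verts H]\<^bsup>2\<^esup>\<close> by auto
    qed
    then show ?thesis using sub bij_betw_same_card[OF f(1)] by (auto simp: cliques_def)
  qed
  ultimately show "H \<in> (\<lambda>S. (S, [S]\<^bsup>2\<^esup>)) ` cliques (edge_rel G) (verts G) r"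
    by (intro image_eqI[of _ _ "verts H"]) (auto simp: prod_eq_iff)
next
  fix H assume "H \<in> (\<lambda>S. (S, [S]\<^bsup>2\<^esup>)) ` cliques (edge_rel G) (verts G) r"
  then obtain S where S: "S \<in> cliques (edge_rel G) (verts G) r" "H = (S, [S]\<^bsup>2\<^esup>)" by auto
  have fS: "finite S" "card S = r" "S \<subseteq> verts G" using S by (auto simp: cliques_def)
  obtain f where f: "bij_betw f {..<r} S"
    using ex_bij_betw_nat_finite[OF fS(1)] fS(2) by (metis lessThan_atLeast0)
  have "[S]\<^bsup>2\<^esup> = (\<lambda>e. f ` e) ` [{..<r}]\<^bsup>2\<^esup>"
    using bij_betw_nsets[OF f, of 2] by (auto simp: bij_betw_def)
  moreover have "[S]\<^bsup>2\<^esup> \<subseteq> edges G"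
  proof
    fix e assume "e \<in> [S]\<^bsup>2\<^esup>"
    then obtain x y where "e = {x, y}" "x \<noteq> y" "x \<in> S" "y \<in> S"
      by (auto simp: nsets_def card_2_iff)
    then show "e \<in> edges G" using S by (auto simp: cliques_def)
  qed
  ultimately show "H \<in> copies (complete_graph r) G"
    using f fS S(2) by (auto simp: copies_def subgraph_def simple_graph_def graph_iso_def
      complete_graph_def)
qed

lemma card_copies_complete_graph:
  "simple_graph G \<Longrightarrow> card (copies (complete_graph r) G) = card (cliques (edge_rel G) (verts G) r)"
  by (subst copies_complete_graph) (auto simp: card_image inj_on_def)

text \<open>The copy with index 0 already exhibits \<open>b\<close> common neighbours of an
  \<open>a\<close>-set.\<close>

lemma no_disjoint_bicliques_if_biclique_free:
  assumes G: "simple_graph G" and free: "biclique_free (edge_rel G) (verts G) a b"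
  shows "copies (disjoint_copies (t + 1) (complete_bipartite a b)) G = {}"
proof (rule ccontr)
  assume "copies (disjoint_copies (t + 1) (complete_bipartite a b)) G \<noteq> {}"
  then obtain H where H: "H \<in> copies (disjoint_copies (t + 1) (complete_bipartite a b)) G" by blast
  then obtain f where f: "bij_betw f ({..<t + 1} \<times> ({..<a} <+> {..<b})) (verts H)"
    "edges H = (\<lambda>e. f ` e) ` {Pair i ` e | i e. i < t + 1 \<and> e \<in> {{Inl i, Inr j} | i j. i < a \<and> j < b}}"
    by (auto simp: copies_def graph_iso_def disjoint_copies_def complete_bipartite_def)
  have sub: "verts H \<subseteq> verts G" "edges H \<subseteq> edges G"
    using H by (auto simp: copies_def subgraph_def)
  have inj: "inj_on f ({..<t + 1} \<times> ({..<a} <+> {..<b}))"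
    and im: "f ` ({..<t + 1} \<times> ({..<a} <+> {..<b})) = verts H"
    using f(1) by (auto simp: bij_betw_def)
  define A where "A = (\<lambda>i. f (0, Inl i)) ` {..<a}"
  define B where "B = (\<lambda>j. f (0, Inr j)) ` {..<b}"
  have cA: "card A = a" unfolding A_def
  proof (subst card_image)
    show "inj_on (\<lambda>i. f (0, Inl i)) {..<a}"
    proof (rule inj_onI)
      fix i j assume "i \<in> {..<a}" "j \<in> {..<a}" "f (0, Inl i) = f (0, Inl j)"
      then show "i = j" using inj_onD[OF inj, of "(0, Inl i)" "(0, Inl j)"] by auto
    qed
  qed simp
  have cB: "card B = b" unfolding B_def
  proof (subst card_image)
    show "inj_on (\<lambda>j. f (0, Inr j)) {..<b}"
    proof (rule inj_onI)
      fix i j assume "i \<in> {..<b}" "j \<in> {..<b}" "f (0, Inr i) = f (0, Inr j)"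
      then show "i = j" using inj_onD[OF inj, of "(0, Inr i)" "(0, Inr j)"] by auto
    qed
  qed simp
  have AV: "A \<subseteq> verts G" "B \<subseteq> verts G" using im sub by (auto simp: A_def B_def)
  have "edge_rel G x y" if xy: "x \<in> A" "y \<in> B" for x y
  proof -
    obtain i j where ij: "i < a" "j < b" "x = f (0, Inl i)" "y = f (0, Inr j)" using xy
      by (auto simp: A_def B_def)
    have "Pair 0 ` {Inl i, Inr j} \<in> {Pair i ` e | i e. i < t + 1
        \<and> e \<in> {{Inl i, Inr j} | i j. i < a \<and> j < b}}"
    proof -
      have "{Inl i, Inr j} \<in> {{Inl i, Inr j} | i j. i < a \<and> j < b}"
        by (intro CollectI exI[of _ i] exI[of _ j] conjI refl ij)
      then have "Pair 0 ` {Inl i, Inr j} = Pair 0 ` {Inl i, Inr j} \<and> 0 < t + 1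
          \<and> {Inl i, Inr j} \<in> {{Inl i, Inr j} | i j. i < a \<and> j < b}" by simp
      then show ?thesis unfolding mem_Collect_eq by (intro exI)
    qed
    then have "f ` (Pair 0 ` {Inl i, Inr j}) \<in> edges H" unfolding f(2) by (rule imageI)
    then show ?thesis using sub ij by auto
  qed
  then have "B \<subseteq> {v \<in> verts G. \<forall>u\<in>A. edge_rel G u v}" using AV by auto
  moreover have "finite {v \<in> verts G. \<forall>u\<in>A. edge_rel G u v}" using G by (simp add: simple_graph_def)
  ultimately have "b \<le> card {v \<in> verts G. \<forall>u\<in>A. edge_rel G u v}" using cB card_mono by blast
  moreover have "card {v \<in> verts G. \<forall>u\<in>A. edge_rel G u v} < b"
    using free AV cA by (simp add: biclique_free_def)
  ultimately show False by simp
qed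

section \<open>Packings of disjoint bicliques and their removal\<close>

definition biclique :: "'a graph \<Rightarrow> nat \<Rightarrow> nat \<Rightarrow> 'a set \<Rightarrow> 'a set \<Rightarrow> bool" where
  "biclique G a b X Y \<longleftrightarrow> X \<subseteq> verts G \<and> Y \<subseteq> verts G \<and> card X = a \<and> card Y = b \<and> X \<inter> Y = {}
     \<and> (\<forall>x\<in>X. \<forall>y\<in>Y. edge_rel G x y)"

definition biclique_packing :: "'a graph \<Rightarrow> nat \<Rightarrow> nat \<Rightarrow> nat \<Rightarrow> (nat \<Rightarrow> 'a set) \<Rightarrow> (nat \<Rightarrow> 'a set) \<Rightarrow> bool" where
  "biclique_packing G a b m A B \<longleftrightarrow> (\<forall>i<m. biclique G a b (A i) (B i)) \<and>
     (\<forall>i<m. \<forall>j<m. i \<noteq> j \<longrightarrow> (A i \<union> B i) \<inter> (A j \<union> B j) = {})"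

lemma copies_if_biclique_packing:
  assumes G: "simple_graph G" and P: "biclique_packing G a b m A B"
  shows "copies (disjoint_copies m (complete_bipartite a b)) G \<noteq> {}"
proof -
  have fG: "finite (verts G)" using G by (simp add: simple_graph_def)
  have AB: "A i \<subseteq> verts G" "B i \<subseteq> verts G" "card (A i) = a" "card (B i) = b" "A i \<inter> B i = {}"
    "\<And>x y. x \<in> A i \<Longrightarrow> y \<in> B i \<Longrightarrow> edge_rel G x y" if "i < m" for i
    using P that unfolding biclique_packing_def biclique_def by simp_all
  have dis: "(A i \<union> B i) \<inter> (A j \<union> B j) = {}" if "i < m" "j < m" "i \<noteq> j" for i j
    using P that unfolding biclique_packing_def by simp
  have "\<exists>\<alpha>. bij_betw \<alpha> {..<a} (A i)" if "i < m" for i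
    using ex_bij_betw_nat_finite[of "A i"] AB(1,3)[OF that] fG finite_subset by (metis lessThan_atLeast0)
  then obtain \<alpha> where \<alpha>: "\<And>i. i < m \<Longrightarrow> bij_betw (\<alpha> i) {..<a} (A i)" by metis
  have "\<exists>\<beta>. bij_betw \<beta> {..<b} (B i)" if "i < m" for i
    using ex_bij_betw_nat_finite[of "B i"] AB(2,4)[OF that] fG finite_subset by (metis lessThan_atLeast0)
  then obtain \<beta> where \<beta>: "\<And>i. i < m \<Longrightarrow> bij_betw (\<beta> i) {..<b} (B i)" by metis
  define f where "f x = (case x of (i, Inl j) \<Rightarrow> \<alpha> i j | (i, Inr j) \<Rightarrow> \<beta> i j)" for x :: "nat \<times> (nat + nat)"
  let ?D = "disjoint_copies m (complete_bipartite a b)"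
  define H where "H = (f ` verts ?D, (\<lambda>e. f ` e) ` edges ?D)"
  have \<alpha>A: "\<alpha> i j \<in> A i" if "i < m" "j < a" for i j using \<alpha>[OF that(1)] that(2) by (auto simp: bij_betw_def)
  have \<beta>B: "\<beta> i j \<in> B i" if "i < m" "j < b" for i j using \<beta>[OF that(1)] that(2) by (auto simp: bij_betw_def)
  have vD: "verts ?D = {..<m} \<times> ({..<a} <+> {..<b})"
    by (simp add: disjoint_copies_def complete_bipartite_def)
  have fin: "f (i, z) \<in> A i \<union> B i" if "i < m" "z \<in> {..<a} <+> {..<b}" for i z
    using that \<alpha>A \<beta>B by (auto simp: f_def)
  have inj: "inj_on f (verts ?D)"
  proof (rule inj_onI)
    fix x y assume xy: "x \<in> verts ?D" "y \<in> verts ?D" "f x = f y"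
    obtain i z j w where ij: "x = (i, z)" "y = (j, w)" "i < m" "j
        < m" "z \<in> {..<a} <+> {..<b}" "w \<in> {..<a} <+> {..<b}"
      using xy unfolding vD by auto
    have "i = j"
    proof (rule ccontr)
      assume "i \<noteq> j"
      then show False using dis[OF ij(3,4)] fin[OF ij(3,5)] fin[OF ij(4,6)] xy(3) ij(1,2) by auto
    qed
    moreover have "z = w"
    proof (cases z; cases w)
      fix u v assume "z = Inl u" "w = Inl v"
      then show ?thesis using xy(3) ij \<open>i = j\<close> \<alpha>[OF ij(3)] by (auto simp: f_def bij_betw_def dest!: inj_onD)
    next
      fix u v assume "z = Inr u" "w = Inr v"
      then show ?thesis using xy(3) ij \<open>i = j\<close> \<beta>[OF ij(3)] by (auto simp: f_def bij_betw_def dest!: inj_onD)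
    next
      fix u v assume zw: "z = Inl u" "w = Inr v"
      then have "\<alpha> i u = \<beta> i v" "u < a" "v < b" using ij \<open>i = j\<close> xy(3) by (auto simp: f_def)
      then show ?thesis using AB(5)[OF ij(3)] \<alpha>A[OF ij(3), of u] \<beta>B[OF ij(3), of v] by auto
    next
      fix u v assume zw: "z = Inr u" "w = Inl v"
      then have "\<beta> i u = \<alpha> i v" "u < b" "v < a" using ij \<open>i = j\<close> xy(3) by (auto simp: f_def)
      then show ?thesis using AB(5)[OF ij(3)] \<alpha>A[OF ij(3), of v] \<beta>B[OF ij(3), of u] by auto
    qed
    ultimately show "x = y" using ij by simp
  qed
  have edge: "e \<in> edges G \<and> e \<in> [f ` verts ?D]\<^bsup>2\<^esup>" if eH: "e \<in> edges H" for e
  proof -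
    obtain i u v where e: "e = f ` (Pair i ` {Inl u, Inr v})" "i < m" "u < a" "v < b"
      using eH unfolding H_def disjoint_copies_def complete_bipartite_def by auto
    have "e = {\<alpha> i u, \<beta> i v}" by (simp add: e(1) f_def)
    moreover have "edge_rel G (\<alpha> i u) (\<beta> i v)" using AB(6)[OF e(2)] \<alpha>A \<beta>B e by auto
    moreover have "\<alpha> i u \<in> f ` verts ?D" unfolding vD
      by (rule image_eqI[of _ _ "(i, Inl u)"]) (use e in \<open>auto simp: f_def\<close>)
    moreover have "\<beta> i v \<in> f ` verts ?D" unfolding vD
      by (rule image_eqI[of _ _ "(i, Inr v)"]) (use e in \<open>auto simp: f_def\<close>)
    moreover have "\<alpha> i u \<noteq> \<beta> i v" using \<open>edge_rel G (\<alpha> i u) (\<beta> i v)\<close> edge_rel_irrefl[OF G] by auto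
    ultimately show ?thesis by (auto simp: nsets_def)
  qed
  have "f ` verts ?D \<subseteq> verts G" unfolding vD using fin AB(1,2) by fastforce
  moreover have "finite (f ` verts ?D)" unfolding vD by simp
  ultimately have "subgraph H G" using edge unfolding subgraph_def simple_graph_def by (auto simp: H_def)
  moreover have "graph_iso ?D H" unfolding graph_iso_def
    using inj by (intro exI[of _ f]) (auto simp: H_def bij_betw_def)
  ultimately have "H \<in> copies ?D G" by (simp add: copies_def)
  then show ?thesis by blast
qed

lemma biclique_free_after_removal:
  assumes G: "simple_graph G" and free: "copies (disjoint_copies (t + 1) (complete_bipartite a b)) G = {}"
  shows "\<exists>M\<subseteq>verts G. card M \<le> t * (a + b) \<and> biclique_free (edge_rel G) (verts G - M) a b"
proof -
  let ?P = "\<lambda>m. \<exists>A B. biclique_packing G a b m A B"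
  have fG: "finite (verts G)" using G by (simp add: simple_graph_def)
  have mono: "?P m" if Pn: "?P n" "m \<le> n" for m n
  proof -
    obtain A B where "biclique_packing G a b n A B" using Pn(1) by blast
    then have "biclique_packing G a b m A B" using Pn(2) by (simp add: biclique_packing_def)
    then show ?thesis by blast
  qed
  have no: "\<not> ?P (t + 1)" using copies_if_biclique_packing[OF G] free by blast
  have "?P 0" by (simp add: biclique_packing_def)
  then obtain m where m: "?P m" "\<not> ?P (Suc m)" "m \<le> t"
  proof -
    have "\<exists>m. ?P m \<and> \<not> ?P (Suc m)"
    proof (rule ccontr)
      assume "\<nexists>m. ?P m \<and> \<not> ?P (Suc m)"
      then have step: "?P n \<Longrightarrow> ?P (Suc n)" for n by blast
      have "?P n" for n by (induction n) (rule \<open>?P 0\<close>, erule step)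
      then show False using no by blast
    qed
    then obtain m where "?P m" "\<not> ?P (Suc m)" by blast
    moreover have "m \<le> t"
    proof (rule ccontr)
      assume "\<not> m \<le> t"
      then show False using mono[OF \<open>?P m\<close>, of "t + 1"] no by simp
    qed
    ultimately show ?thesis using that by blast
  qed
  then obtain A B where AB: "biclique_packing G a b m A B" by blast
  define M where "M = (\<Union>i<m. A i \<union> B i)"
  have bicl: "biclique G a b (A i) (B i)" if "i < m" for i using AB that by (simp add: biclique_packing_def)
  have MV: "M \<subseteq> verts G" unfolding M_def using bicl[unfolded biclique_def]
    by (intro UN_least Un_least) simp_all
  have "card M \<le> (\<Sum>i<m. card (A i \<union> B i))" unfolding M_def by (rule card_UN_le) simp
  also have "\<dots> \<le> (\<Sum>i<m. a + b)"
  proof (rule sum_mono)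
    fix i assume "i \<in> {..<m}"
    then show "card (A i \<union> B i) \<le> a + b" using bicl[of i] card_Un_le[of "A i" "B i"]
      by (simp add: biclique_def)
  qed
  also have "\<dots> \<le> t * (a + b)" using m(3) by simp
  finally have cM: "card M \<le> t * (a + b)" .
  have "biclique_free (edge_rel G) (verts G - M) a b"
  proof (rule ccontr)
    assume "\<not> biclique_free (edge_rel G) (verts G - M) a b"
    then have "\<exists>X. X \<subseteq> verts G - M \<and> card X = a \<and> b \<le> card {v \<in> verts G - M. \<forall>u\<in>X. edge_rel G u v}"
      by (simp only: biclique_free_def not_all not_imp not_less)
    then obtain X where X: "X \<subseteq> verts G - M" "card X = a" "b \<le> card {v \<in> verts G - M. \<forall>u\<in>X. edge_rel G u v}"
      by (elim exE conjE)
    obtain Y where Y: "Y \<subseteq> {v \<in> verts G - M. \<forall>u\<in>X. edge_rel G u v}" "card Y = b" "finite Y"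
      by (rule obtain_subset_with_card_n[OF X(3)])
    have Yv: "v \<in> verts G - M \<and> (\<forall>u\<in>X. edge_rel G u v)" if "v \<in> Y" for v using subsetD[OF Y(1) that] by simp
    have XY: "X \<inter> Y = {}"
    proof (rule ccontr)
      assume "X \<inter> Y \<noteq> {}"
      then obtain v where v: "v \<in> X" "v \<in> Y" by blast
      then have "edge_rel G v v" using Yv[OF v(2)] by (elim conjE) (rule bspec)
      then show False using edge_rel_irrefl[OF G] by (rule notE[rotated])
    qed
    have XV: "X \<subseteq> verts G" "X \<inter> M = {}" using X(1) by auto
    have YV: "Y \<subseteq> verts G" "Y \<inter> M = {}" using Yv by auto
    have new: "biclique G a b X Y" using XV YV X(2) Y(2) XY Yv by (simp add: biclique_def)
    have XM: "(X \<union> Y) \<inter> (A k \<union> B k) = {}" if "k < m" for k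
    proof -
      have "A k \<union> B k \<subseteq> M" unfolding M_def using that by blast
      then show ?thesis using XV(2) YV(2) by blast
    qed
    have "biclique_packing G a b (Suc m) (A(m := X)) (B(m := Y))"
      unfolding biclique_packing_def
    proof (intro conjI allI impI)
      show "biclique G a b ((A(m := X)) i) ((B(m := Y)) i)" if "i < Suc m" for i
        using that bicl[of i] new by (cases "i = m") simp_all
    next
      fix i j assume ij: "i < Suc m" "j < Suc m" "i \<noteq> j"
      consider "i < m" "j < m" | "i = m" "j < m" | "i < m" "j = m" using ij by linarith
      then show "((A(m := X)) i \<union> (B(m := Y)) i) \<inter> ((A(m := X)) j \<union> (B(m := Y)) j) = {}"
      proof cases
        case 1
        then show ?thesis using AB ij unfolding biclique_packing_def by simp
      next
        case 2
        then show ?thesis using XM[of j] by simp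
      next
        case 3
        then show ?thesis using XM[of i] by (simp add: Int_commute)
      qed
    qed
    then show False using m(2) by blast
  qed
  then show ?thesis using MV cM by blast
qed

text \<open>A clique that meets \<open>M\<close> is recovered from its trace on \<open>M\<close> and
  a strictly smaller clique outside, so removing boundedly many vertices costs only terms of lower
  order.\<close>

lemma card_cliques_removal_le:
  assumes V: "finite V" and M: "M \<subseteq> V" "card M \<le> m"
  shows "card (cliques R V r) \<le> card (cliques R (V - M) r) + 2 ^ m * (\<Sum>s<r. card (cliques R (V - M) s))"
proof -
  have fM: "finite M" using V M finite_subset by blast
  have split: "cliques R V r \<subseteq> cliques R (V
      - M) r \<union> (\<lambda>(A, S). A \<union> S) ` (Pow M \<times> (\<Union>s<r. cliques R (V - M) s))"
  proof
    fix S assume S: "S \<in> cliques R V r"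
    show "S \<in> cliques R (V - M) r \<union> (\<lambda>(A, S). A \<union> S) ` (Pow M \<times> (\<Union>s<r. cliques R (V - M) s))"
    proof (cases "S \<inter> M = {}")
      case True
      then show ?thesis using S by (auto simp: cliques_def)
    next
      case False
      have "card (S - M) < card S"
        using S False by (intro psubset_card_mono) (auto simp: cliques_def)
      then have "S - M \<in> (\<Union>s<r. cliques R (V - M) s)"
        using S by (auto simp: cliques_def intro!: bexI[of _ "card (S - M)"])
      moreover have "S = (\<lambda>(A, S). A \<union> S) (S \<inter> M, S - M)" by auto
      ultimately show ?thesis by blast
    qed
  qed
  have "card (cliques R V r) \<le> card (cliques R (V - M) r \<union> (\<lambda>(A, S). A \<union> S) ` (Pow M \<times> (\<Union>s<r. cliques R (V - M) s)))"
    using V fM finite_cliques[of "V - M" R] by (intro card_mono[OF _ split]) auto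
  also have "\<dots> \<le> card (cliques R (V - M) r)
      + card ((\<lambda>(A, S). A \<union> S) ` (Pow M \<times> (\<Union>s<r. cliques R (V - M) s)))"
    by (rule card_Un_le)
  also have "card ((\<lambda>(A, S). A \<union> S) ` (Pow M \<times> (\<Union>s<r. cliques R (V - M) s)))
      \<le> card (Pow M \<times> (\<Union>s<r. cliques R (V - M) s))"
    using V fM finite_cliques[of "V - M" R] by (intro card_image_le) auto
  also have "\<dots> = 2 ^ card M * card (\<Union>s<r. cliques R (V - M) s)"
    using fM by (simp add: card_cartesian_product card_Pow)
  also have "\<dots> \<le> 2 ^ m * (\<Sum>s<r. card (cliques R (V - M) s))"
    using M by (intro mult_mono card_UN_le power_increasing) auto
  finally show ?thesis by simp
qed

lemma clique_exponent_le: "a \<ge> 1 \<Longrightarrow> s \<le> a \<Longrightarrow> clique_exponent s a \<le> real s / 2"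
proof -
  assume a: "a \<ge> 1" "s \<le> a"
  have "real s * (real s - 1) \<le> real s * real a" using a by (intro mult_left_mono) auto
  then show ?thesis using a by (simp add: clique_exponent_def field_simps)
qed

text \<open>As a quadratic in \<open>s\<close> the exponent increases up to
  \<open>a + 1 / 2\<close>. This makes the summands with \<open>s < r\<close> negligible.\<close>

lemma growth_exponent_mono:
  assumes "s < r" "r \<le> a"
  shows "real s - clique_exponent s a < real r - clique_exponent r a"
proof -
  have "clique_exponent r a - clique_exponent s a
      = (real r - real s) * (real r + real s - 1) / (2 * real a)"
    using assms by (simp add: clique_exponent_def diff_divide_distrib[symmetric] algebra_simps)
  also have "\<dots> < (real r - real s) * 1"
  proof -
    have "real r + real s - 1 < 2 * real a" using assms by linarith
    then have "(real r + real s - 1) / (2 * real a) < 1" using assms by simp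
    then have "(real r - real s) * ((real r + real s - 1) / (2 * real a)) < (real r - real s) * 1"
      using assms by (intro mult_strict_left_mono) auto
    then show ?thesis by simp
  qed
  finally show ?thesis by simp
qed

section \<open>Asymptotics for fixed parameters\<close>

context
  fixes t r a b :: nat
  assumes tr: "t \<ge> r" and r3: "r \<ge> 3" and ar: "a \<ge> 2 * (r - 1)" and bf: "b \<ge> fact (a - 1) + 1"
begin

abbreviation (input) "turan_nr n \<equiv> gen_turan n (complete_graph r) (disjoint_copies (t
    + 1) (complete_bipartite a b))"

abbreviation (input) "gexp s \<equiv> real s - clique_exponent s a"

lemma a_ge: "a \<ge> r" "a \<ge> 4" using r3 ar by auto

lemma b_ge: "b \<ge> 2"
proof -
  have "fact (a - 1) \<ge> (1 :: nat)" by (rule fact_ge_1)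
  then show ?thesis using bf by linarith
qed

text \<open>The edgeless graph shows that the maximum is taken over a nonempty set and so has its
  intended meaning.\<close>

lemma gen_turan_attained:
  "\<exists>G :: nat graph. simple_graph G \<and> card (verts G) = n
     \<and> copies (disjoint_copies (t + 1) (complete_bipartite a b)) G = {}
     \<and> turan_nr n = card (cliques (edge_rel G) (verts G) r)"
proof -
  let ?S = "{card (copies (complete_graph r) G) | G :: nat graph.
            simple_graph G \<and> card (verts G) = n \<and> copies
              (disjoint_copies (t + 1) (complete_bipartite a b)) G = {}}"
  define G0 :: "nat graph" where "G0 = ({..<n}, {})"
  have G0: "simple_graph G0" "card (verts G0) = n" by (simp_all add: G0_def simple_graph_def)
  have "biclique_free (edge_rel G0) (verts G0) a b"
    unfolding biclique_free_def
  proof (intro allI impI)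
    fix A :: "nat set" assume "card A = a"
    then have "A \<noteq> {}" using a_ge by auto
    then show "card {v \<in> verts G0. \<forall>u\<in>A. edge_rel G0 u v} < b" using b_ge by (simp add: G0_def)
  qed
  then have "copies (disjoint_copies (t + 1) (complete_bipartite a b)) G0 = {}"
    by (rule no_disjoint_bicliques_if_biclique_free[OF G0(1)])
  then have "\<exists>G :: nat graph. card (copies (complete_graph r) G0) = card (copies (complete_graph r) G)
      \<and> simple_graph G
      \<and> card (verts G) = n \<and> copies (disjoint_copies (t + 1) (complete_bipartite a b)) G = {}"
    using G0 by (intro exI[of _ G0] conjI refl)
  then have "card (copies (complete_graph r) G0) \<in> ?S" by (rule CollectI)
  then have "turan_nr n \<in> ?S" unfolding gen_turan_def by (intro Max_in finite_gen_turan_set) auto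
  then obtain G :: "nat graph" where "turan_nr n = card (copies (complete_graph r) G)" "simple_graph G"
    "card (verts G) = n" "copies (disjoint_copies (t + 1) (complete_bipartite a b)) G = {}" by blast
  then show ?thesis by (intro exI[of _ G]) (simp add: card_copies_complete_graph)
qed

lemma gen_turan_ge:
  fixes G :: "nat graph"
  assumes "simple_graph G" "card (verts G) = n" "biclique_free (edge_rel G) (verts G) a b"
  shows "card (cliques (edge_rel G) (verts G) r) \<le> turan_nr n"
proof -
  have "card (copies (complete_graph r) G) \<le> turan_nr n"
    unfolding gen_turan_def using assms no_disjoint_bicliques_if_biclique_free[OF assms(1,3)]
    by (intro Max_ge finite_gen_turan_set) blast
  then show ?thesis using card_copies_complete_graph[OF assms(1)] by simp
qed

lemma gen_turan_upper:
  assumes \<epsilon>: "\<epsilon> > 0"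
  shows "eventually (\<lambda>n. real (turan_nr n)
      \<le> (1 / fact r + \<epsilon>) * (real b - 1) powr clique_exponent r a * real n powr gexp r) sequentially"
proof -
  define m where "m = t * (a + b)"
  define c where "c s = (real b - 1) powr clique_exponent s a" for s
  \<comment> \<open>Half of the slack goes to the main term, since
    \<open>\<delta> / fact r = \<epsilon> / 2\<close>; the other half absorbs the lower-order
    terms.\<close>
  define \<delta> where "\<delta> = \<epsilon> * fact r / 2"
  have \<delta>: "\<delta> > 0" using \<epsilon> by (simp add: \<delta>_def)
  have b1: "real b - 1 \<ge> 1" using b_ge by simp
  have c0: "c s > 0" for s using b1 by (simp add: c_def)
  have "\<exists>C\<ge>0. \<forall>(V :: nat set) R. finite V \<longrightarrow> symp R \<longrightarrow> biclique_free R V a b \<longrightarrow>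
    real (card (cliques R V r)) \<le> (1 + \<delta>) / fact r * c r * real (card V) powr gexp r + C"
    unfolding c_def using r3 a_ge b_ge \<delta> by (intro cliques_count_upper) auto
  then obtain C where C: "\<forall>(V :: nat set) R. finite V \<longrightarrow> symp R \<longrightarrow> biclique_free R V a b \<longrightarrow>
    real (card (cliques R V r)) \<le> (1 + \<delta>) / fact r * c r * real (card V) powr gexp r + C"
    by (elim exE conjE)
  have "\<exists>D\<ge>0. \<forall>(V :: nat set) R. finite V \<longrightarrow> symp R \<longrightarrow> biclique_free R V a b \<longrightarrow>
    real (card (cliques R V s)) \<le> D * real (card V) powr gexp s + D" if s: "s < r" for s
  \<comment> \<open>Size 0 is separate because \<open>cliques_count_upper\<close> starts at 1; there
    the empty clique is the only one.\<close>
  proof (cases "s = 0")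
    case True
    have "cliques R V 0 = {{}}" for V :: "nat set" and R by (auto simp: cliques_def)
    then show ?thesis using True by (intro exI[of _ 1]) auto
  next
    case False
    have "\<exists>D\<ge>0. \<forall>(V :: nat set) R. finite V \<longrightarrow> symp R \<longrightarrow> biclique_free R V a b \<longrightarrow>
      real (card (cliques R V s)) \<le> (1 + 1) / fact s * c s * real (card V) powr gexp s + D"
      unfolding c_def using False s a_ge b_ge by (intro cliques_count_upper) auto
    then obtain D where D: "D \<ge> 0" "\<forall>(V :: nat set) R. finite V \<longrightarrow> symp R \<longrightarrow> biclique_free R V a b \<longrightarrow>
      real (card (cliques R V s)) \<le> (1 + 1) / fact s * c s * real (card V) powr gexp s + D"
      by (elim exE conjE)
    define D' where "D' = max D ((1 + 1) / fact s * c s)"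
    show ?thesis
    proof (intro exI[of _ D'] conjI allI impI)
      fix V :: "nat set" and R assume V: "finite V" "symp R" "biclique_free R V a b"
      have "real (card (cliques R V s)) \<le> (1 + 1) / fact s * c s * real (card V) powr gexp s + D"
        by (rule D(2)[rule_format, OF V])
      also have "\<dots> \<le> D' * real (card V) powr gexp s + D'"
        by (intro add_mono mult_right_mono) (auto simp: D'_def)
      finally show "real (card (cliques R V s)) \<le> D' * real (card V) powr gexp s + D'" .
    qed (use D in \<open>simp add: D'_def\<close>)
  qed
  then have "\<forall>s. \<exists>D. s < r \<longrightarrow> D \<ge> 0 \<and> (\<forall>(V :: nat set) R. finite V \<longrightarrow> symp R \<longrightarrow> biclique_free R V a b \<longrightarrow>
    real (card (cliques R V s)) \<le> D * real (card V) powr gexp s + D)" by simp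
  from choice[OF this] obtain D where D: "\<forall>s. s < r \<longrightarrow> D s \<ge> 0 \<and> (\<forall>(V :: nat set) R. finite V \<longrightarrow> symp R
    \<longrightarrow> biclique_free R V a b \<longrightarrow> real (card (cliques R V s)) \<le> D s * real (card V) powr gexp s + D
      s)" by (rule exE)
  have D0: "D s \<ge> 0" if "s < r" for s using D that by simp
  have D1: "real (card (cliques R V s)) \<le> D s * real (card V) powr gexp s + D s"
    if "s < r" "finite V" "symp R" "biclique_free R V a b" for s and V :: "nat set" and R
    using D that by simp
  have g0: "gexp s \<ge> 0" if "s \<le> r" for s
    using clique_exponent_le[of a s] that a_ge by auto
  have bound: "real (turan_nr n)
      \<le> (1 + \<delta>) / fact r * c r * real n powr gexp r + C + 2 ^ m *
      (\<Sum>s<r. D s * real n powr gexp s + D s)" for n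
  proof -
    obtain G :: "nat graph" where G: "simple_graph G" "card (verts G) = n"
      "copies (disjoint_copies (t + 1) (complete_bipartite a b)) G = {}"
      "turan_nr n = card (cliques (edge_rel G) (verts G) r)" using gen_turan_attained by blast
    obtain M where M: "M \<subseteq> verts G" "card M \<le> m" "biclique_free (edge_rel G) (verts G - M) a b"
      using biclique_free_after_removal[OF G(1,3)] unfolding m_def by blast
    have fG: "finite (verts G)" using G by (simp add: simple_graph_def)
    have fin: "finite (verts G - M)" using fG by simp
    have le: "real (card (verts G - M)) \<le> real n" using card_mono[OF fG, of "verts G - M"] G(2) by simp
    have pw: "real (card (verts G - M)) powr gexp s \<le> real n powr gexp s" if "s \<le> r" for s
      using le g0[OF that] by (intro powr_mono2) auto
    have "real (turan_nr n) \<le> real (card (cliques (edge_rel G) (verts G - M) r)) + 2 ^ m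
        * (\<Sum>s<r. real (card (cliques (edge_rel G) (verts G - M) s)))"
      using of_nat_mono[OF card_cliques_removal_le[OF fG M(1,2), of "edge_rel G" r], where 'a = real] G(4)
        by simp
    also have "real (card (cliques (edge_rel G) (verts G - M) r))
        \<le> (1 + \<delta>) / fact r * c r * real (card (verts G - M)) powr gexp r + C"
      by (rule C[rule_format, OF fin edge_rel_symp M(3)])
    also have "\<dots> \<le> (1 + \<delta>) / fact r * c r * real n powr gexp r + C"
      using pw[of r] c0[of r] \<delta> by (intro add_right_mono mult_left_mono) auto
    also have "(\<Sum>s<r. real (card (cliques (edge_rel G) (verts G - M) s)))
        \<le> (\<Sum>s<r. D s * real n powr gexp s + D s)"
    proof (rule sum_mono)
      fix s assume s: "s \<in> {..<r}"
      have "real (card (cliques (edge_rel G) (verts G - M) s))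
          \<le> D s * real (card (verts G - M)) powr gexp s + D s"
        using s by (intro D1 fin edge_rel_symp M(3)) auto
      also have "\<dots> \<le> D s * real n powr gexp s + D s"
        using s D0 pw[of s] by (intro add_right_mono mult_left_mono) auto
      finally show "real (card (cliques (edge_rel G) (verts G - M) s)) \<le> D s * real n powr gexp s + D s" .
    qed
    finally show ?thesis by simp
  qed
  have gr: "gexp r > 0" using growth_exponent_mono[of 0 r a] r3 a_ge by (simp add: clique_exponent_def)
  have lim0: "(\<lambda>n. real n powr gexp s / real n powr gexp r) \<longlonglongrightarrow> 0" if "s < r" for s
  proof -
    have "gexp s - gexp r < 0" using growth_exponent_mono[OF that a_ge(1)] by simp
    then have "(\<lambda>n. real n powr (gexp s - gexp r)) \<longlonglongrightarrow> 0"
      by (intro tendsto_neg_powr filterlim_real_sequentially)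
    then show ?thesis by (simp add: powr_diff)
  qed
  have inv: "1 / real n powr gexp r = real n powr (- gexp r)" for n
    by (simp only: powr_minus inverse_eq_divide)
  have lim1: "(\<lambda>n. 1 / real n powr gexp r) \<longlonglongrightarrow> 0"
    unfolding inv using gr by (intro tendsto_neg_powr filterlim_real_sequentially) auto
  let ?L = "\<lambda>n. (1 + \<delta>) / fact r * c r + C * (1 / real n powr gexp r)
     + 2 ^ m * (\<Sum>s<r. D s * (real n powr gexp s / real n powr gexp r) + D s * (1 / real n powr gexp r))"
  have "?L \<longlonglongrightarrow> (1 + \<delta>) / fact r * c r + C * 0 + 2 ^ m * (\<Sum>s<r. D s * 0 + D s * 0)"
    by (intro tendsto_intros lim0 lim1) auto
  moreover have "(1 + \<delta>) / fact r * c r + C * 0 + 2 ^ m * (\<Sum>s<r. D s * 0 + D s * 0)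
      < (1 / fact r + \<epsilon>) * c r"
    using \<epsilon> c0[of r] by (simp add: \<delta>_def field_simps)
  ultimately have "eventually (\<lambda>n. ?L n < (1 / fact r + \<epsilon>) * c r) sequentially"
    by (rule order_tendstoD(2))
  then show ?thesis using eventually_gt_at_top[of 0]
  proof eventually_elim
    case (elim n)
    then have np: "real n powr gexp r > 0" by simp
    have "(1 + \<delta>) / fact r * c r * real n powr gexp r + C + 2 ^ m * (\<Sum>s<r. D s * real n powr gexp s + D s)
       = ?L n * real n powr gexp r"
      using np by (simp add: distrib_right sum_distrib_right mult.assoc)
    also have "\<dots> \<le> (1 / fact r + \<epsilon>) * c r * real n powr gexp r"
      using elim np by (intro mult_right_mono) auto
    finally show ?case using bound[of n] unfolding c_def by linarith
  qed
qed

text \<open>The graph is moved into the naturals, loses its loops and is padded with isolated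
  vertices to order \<open>n\<close>. A set with an isolated vertex has no common neighbours, and
  since \<open>a > 0\<close> no isolated vertex is a common neighbour of an \<open>a\<close>-set, so
  the padding creates no biclique.\<close>

lemma gen_turan_ge_embedded:
  fixes V :: "'v set"
  assumes V: "finite V" "card V \<le> n" and sym: "\<And>u v. adj u v \<Longrightarrow> adj v u"
    and free: "\<And>A. A \<subseteq> V \<Longrightarrow> card A = a \<Longrightarrow> card {v \<in> V. \<forall>u\<in>A. adj u v} < b"
  shows "card (cliques adj V r) \<le> turan_nr n"
proof -
  obtain g where g: "inj_on g V" "g ` V \<subseteq> {..<n}"
    using V inj_on_iff_card_le[of V "{..<n}"] by auto
  define G :: "nat graph" where "G = ({..<n}, {{g u, g v} | u v. u \<in> V \<and> v \<in> V \<and> u \<noteq> v \<and> adj u v})"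
  have vG: "verts G = {..<n}" by (simp add: G_def)
  have er: "edge_rel G x y \<longleftrightarrow> (\<exists>u\<in>V. \<exists>v\<in>V. u \<noteq> v \<and> adj u v \<and> x = g u \<and> y = g v)" for x y
  proof
    assume "edge_rel G x y"
    then obtain u v where uv: "{x, y} = {g u, g v}" "u \<in> V" "v \<in> V" "u \<noteq> v" "adj u v"
      by (auto simp: G_def)
    then have "x = g u \<and> y = g v \<or> x = g v \<and> y = g u" by (simp add: doubleton_eq_iff)
    then show "\<exists>u\<in>V. \<exists>v\<in>V. u \<noteq> v \<and> adj u v \<and> x = g u \<and> y = g v"
      using uv sym[OF uv(5)] by metis
  qed (auto simp: G_def)
  have sG: "simple_graph G" unfolding simple_graph_def
  proof
    show "edges G \<subseteq> [verts G]\<^bsup>2\<^esup>"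
    proof
      fix e assume "e \<in> edges G"
      then obtain u v where e: "e = {g u, g v}" "u \<in> V" "v \<in> V" "u \<noteq> v" by (auto simp: G_def)
      then have "g u \<noteq> g v" using g(1) by (auto dest: inj_onD)
      then show "e \<in> [verts G]\<^bsup>2\<^esup>" using e g(2) by (auto simp: vG nsets_def)
    qed
  qed (simp add: vG)
  have "biclique_free (edge_rel G) (verts G) a b"
    unfolding biclique_free_def
  proof (intro allI impI)
    fix A assume A: "A \<subseteq> verts G" "card A = a"
    show "card {v \<in> verts G. \<forall>u\<in>A. edge_rel G u v} < b"
    proof (cases "A \<subseteq> g ` V")
      case True
      define A' where "A' = {u \<in> V. g u \<in> A}"
      have AA: "A = g ` A'" using True by (auto simp: A'_def)
      have "inj_on g A'" using g(1) by (rule inj_on_subset) (auto simp: A'_def)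
      then have cA: "card A' = a" using A(2) AA by (simp add: card_image)
      have "{v \<in> verts G. \<forall>u\<in>A. edge_rel G u v} \<subseteq> g ` {v \<in> V. \<forall>u\<in>A'. adj u v}"
      proof
        fix y assume y: "y \<in> {v \<in> verts G. \<forall>u\<in>A. edge_rel G u v}"
        have "A' \<noteq> {}" using cA a_ge by auto
        then obtain u0 where "u0 \<in> A'" by blast
        then have "edge_rel G (g u0) y" using y AA by auto
        then obtain v where v: "v \<in> V" "y = g v" unfolding er by blast
        have "adj u v" if u: "u \<in> A'" for u
        proof -
          have "edge_rel G (g u) (g v)" using y AA u v by auto
          then obtain u' v' where "u' \<in> V" "v' \<in> V" "adj u' v'" "g u = g u'" "g v = g v'" unfolding er
            by blast
          moreover have "u \<in> V" using u by (simp add: A'_def)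
          ultimately show ?thesis using v(1) inj_onD[OF g(1)] by metis
        qed
        then show "y \<in> g ` {v \<in> V. \<forall>u\<in>A'. adj u v}" using v by auto
      qed
      then have "card {v \<in> verts G. \<forall>u\<in>A. edge_rel G u v} \<le> card {v \<in> V. \<forall>u\<in>A'. adj u v}"
        using V(1) by (intro surj_card_le) auto
      also have "\<dots> < b" using cA by (intro free) (auto simp: A'_def)
      finally show ?thesis .
    next
      case False
      then obtain x where "x \<in> A" "x \<notin> g ` V" by blast
      then have "{v \<in> verts G. \<forall>u\<in>A. edge_rel G u v} = {}" unfolding er by auto
      then show ?thesis using b_ge by (simp only: card.empty)
    qed
  qed
  then have "card (cliques (edge_rel G) (verts G) r) \<le> turan_nr n"
    by (intro gen_turan_ge sG) (simp add: vG)
  moreover have "card (cliques adj V r) \<le> card (cliques (edge_rel G) (verts G) r)"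
  proof (rule card_inj_on_le)
    show "inj_on ((`) g) (cliques adj V r)"
      by (rule inj_on_subset[OF inj_on_image_Pow[OF g(1)]]) (auto simp: cliques_def)
    show "(`) g ` cliques adj V r \<subseteq> cliques (edge_rel G) (verts G) r"
    proof clarify
      fix S assume S: "S \<in> cliques adj V r"
      then have SV: "S \<subseteq> V" by (simp add: cliques_def)
      have "card (g ` S) = r" using S inj_on_subset[OF g(1) SV] by (simp add: cliques_def card_image)
      moreover have "edge_rel G x y" if xy: "x \<in> g ` S" "y \<in> g ` S" "x \<noteq> y" for x y
      proof -
        obtain u v where uv: "u \<in> S" "v \<in> S" "x = g u" "y = g v" using xy by auto
        then have "u \<noteq> v" "adj u v" using xy(3) S by (auto simp: cliques_def)
        then show ?thesis unfolding er using uv SV by blast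
      qed
      ultimately show "g ` S \<in> cliques (edge_rel G) (verts G) r"
        using S image_mono[OF SV, of g] g(2) by (simp add: cliques_def vG subset_trans)
    qed
    show "finite (cliques (edge_rel G) (verts G) r)" by (rule finite_cliques) (simp add: vG)
  qed
  ultimately show ?thesis by simp
qed

lemma choose_two_le: "r choose 2 \<le> a * r"
proof -
  have "r choose 2 \<le> r * (r - 1)" by (simp add: choose_two)
  also have "\<dots> \<le> r * a" using a_ge by (intro mult_left_mono) auto
  finally show ?thesis by (simp add: mult.commute)
qed

text \<open>About \<open>(q ^ a) ^ r\<close> tuples of vertices of the norm graph, each pair
  adjacent with density about \<open>1 / q\<close>, account for the exponent. The lower bound on
  \<open>q\<close> makes the second moment threshold hold with \<open>x\<close> in the role of
  \<epsilon>.\<close>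

lemma gen_turan_ge_primepow:
  assumes q: "primepow q" "q ^ a \<le> n" and x: "0 < x" "x \<le> 1 / 2" and qx: "32 * 4 ^ r / x ^ 3 \<le> real q"
  shows "(1 - x) ^ (r\<^sup>2 + r) * real q ^ (a * r - (r choose 2)) \<le> fact r * real (turan_nr n)"
proof -
  define k where "k = a - 1"
  have ak: "a = Suc k" "k > 0" using a_ge by (auto simp: k_def)
  have q2: "q \<ge> 2" using primepow_gt_Suc_0[OF q(1)] by simp
  obtain V :: "(int poly \<times> nat) set" and adj where V: "finite V" "card V = q ^ k * (q - 1)"
    and sym: "\<forall>u v. adj u v \<longrightarrow> adj v u"
    and deg: "\<forall>u\<in>V. card {v \<in> V. adj u v} = q ^ k - 1"
    and codeg: "\<forall>u\<in>V. \<forall>u'\<in>V. u \<noteq> u' \<longrightarrow> (q - 1) * card {v \<in> V. adj u v \<and> adj u' v} \<le> q ^ k - 1"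
    and free: "\<forall>A\<subseteq>V. card A = Suc k \<longrightarrow> card {v \<in> V. \<forall>u\<in>A. adj u v} \<le> fact k"
    using projective_norm_graph[OF q(1) ak(2)] by (elim exE conjE)
  have x3: "x ^ 3 > 0" "x ^ 3 \<le> x"
    using x power_decreasing[of 1 3 x] by auto
  have qx': "32 * 4 ^ r \<le> real q * x ^ 3" using qx x3 by (simp add: field_simps)
  have "(1 :: real) \<le> 32 * 4 ^ r" using one_le_power[of "4 :: real" r] by linarith
  also have "\<dots> \<le> real q * x" using qx' mult_left_mono[OF x3(2), of "real q"] by linarith
  finally have "real q - 1 \<ge> real q * (1 - x)" by (simp add: algebra_simps)
  then have "real q ^ k * (real q * (1 - x)) \<le> real q ^ k * (real q - 1)" by (intro mult_left_mono) auto
  then have N: "real q ^ a * (1 - x) \<le> real (card V)"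
    using q2 V(2) by (simp add: ak(1) of_nat_diff mult_ac)
  have "real q ^ a / 2 \<le> real q ^ a * (1 - x)"
    using mult_left_mono[of "1 / 2" "1 - x" "real q ^ a"] x by simp
  then have "real q ^ a / 2 \<le> real (card V)" using N by linarith
  then have "(real q ^ a / 2)\<^sup>2 \<le> (real (card V))\<^sup>2" by (intro power_mono) auto
  then have N2: "real q ^ (2 * a) / 4 \<le> (real (card V))\<^sup>2"
    by (simp add: power_divide power_mult[symmetric] mult.commute)
  have thr: "8 * 4 ^ r * real q ^ (k + 2 * r) \<le> (real (card V))\<^sup>2 * x ^ 3 * (real q)\<^sup>2"
  proof -
    \<comment> \<open>Here \<open>a \<ge> 2 * (r - 1)\<close> is used in full: as
      \<open>k = a - 1\<close>, the claim reads \<open>a + 2 * r \<le> 2 * a + 2\<close>. The spare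
      factor \<open>q\<close> absorbs \<open>32 * 4 ^ r / x ^ 3\<close>.\<close>
    have "k + 2 * r + 1 \<le> 2 * a + 2" using ar ak by linarith
    then have pw: "real q ^ (k + 2 * r + 1) \<le> real q ^ (2 * a + 2)" using q2
      by (intro power_increasing) auto
    have "8 * 4 ^ r * real q ^ (k + 2 * r) = (32 * 4 ^ r) * real q ^ (k + 2 * r) / 4" by simp
    also have "\<dots> \<le> (real q * x ^ 3) * real q ^ (k + 2 * r) / 4"
      using qx' by (intro divide_right_mono mult_right_mono) auto
    also have "\<dots> = x ^ 3 * real q ^ (k + 2 * r + 1) / 4" by simp
    also have "\<dots> \<le> x ^ 3 * real q ^ (2 * a + 2) / 4"
      using pw x3 by (intro divide_right_mono mult_left_mono) auto
    also have "\<dots> = (real q ^ (2 * a) / 4) * x ^ 3 * (real q)\<^sup>2" by (simp add: power_add power2_eq_square)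
    also have "\<dots> \<le> (real (card V))\<^sup>2 * x ^ 3 * (real q)\<^sup>2"
      using N2 x3 by (intro mult_right_mono) auto
    finally show ?thesis .
  qed
  have main: "(1 - x) ^ (r\<^sup>2) * real (card V) ^ r
      \<le> fact r * real (card (cliques adj V r)) * real q ^ (r choose 2)"
    using deg codeg sym r3
    by (intro clique_count_lower[OF V q2 ak(2) _ _ _ x _ _ thr]) (auto intro: sympI)
  have "card (cliques adj V r) \<le> turan_nr n"
  proof (rule gen_turan_ge_embedded[OF V(1)])
    have "card V \<le> q ^ k * q" using V(2) by simp
    then show "card V \<le> n" using q(2) by (simp add: ak(1) mult.commute)
    show "card {v \<in> V. \<forall>u\<in>A. adj u v} < b" if "A \<subseteq> V" "card A = a" for A
    proof -
      have "card {v \<in> V. \<forall>u\<in>A. adj u v} \<le> fact k" using free that ak(1) by blast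
      then show ?thesis using bf by (simp add: k_def)
    qed
  qed (use sym in blast)
  then have "fact r * real (card (cliques adj V r)) * real q ^ (r choose 2)
      \<le> fact r * real (turan_nr n) * real q ^ (r choose 2)"
    by (intro mult_right_mono mult_left_mono) auto
  moreover have "(1 - x) ^ (r\<^sup>2) * (real q ^ a * (1 - x)) ^ r \<le> (1 - x) ^ (r\<^sup>2) * real (card V) ^ r"
    using N x by (intro mult_left_mono power_mono) auto
  moreover have "(1 - x) ^ (r\<^sup>2) * (real q ^ a * (1 - x)) ^ r
      = (1 - x) ^ (r\<^sup>2 + r) * real q ^ (a * r - (r choose 2)) * real q ^ (r choose 2)"
  proof -
    have "real q ^ (a * r) = real q ^ (a * r - (r choose 2)) * real q ^ (r choose 2)"
      using choose_two_le by (simp add: power_add[symmetric])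
    then show ?thesis by (simp add: power_mult_distrib power_mult[symmetric] power_add)
  qed
  ultimately have "(1 - x) ^ (r\<^sup>2 + r) * real q ^ (a * r - (r choose 2)) * real q ^ (r choose 2)
      \<le> fact r * real (turan_nr n) * real q ^ (r choose 2)" using main by linarith
  moreover have "real q ^ (r choose 2) > 0" using q2 by simp
  ultimately show ?thesis by (meson mult_le_cancel_right_pos)
qed

lemma gen_turan_lower:
  assumes \<epsilon>: "\<epsilon> > 0"
  shows "eventually (\<lambda>n. real (turan_nr n) \<ge> (1 / fact r - \<epsilon>) * real n powr gexp r) sequentially"
proof -
  \<comment> \<open>The constant that results from both losses: powers of \<open>1 - x\<close> from
    the clique count, and powers of \<open>exp (- x)\<close> because \<open>q\<close> falls short of
    \<open>n powr (1 / a)\<close>.\<close>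
  let ?h = "\<lambda>x :: real. (1 - x) ^ (r\<^sup>2 + r) * exp (- x) ^ (a * r) / fact r"
  have "(?h \<longlongrightarrow> (1 - 0) ^ (r\<^sup>2 + r) * exp (- 0) ^ (a * r) / fact r) (at_right 0)"
    by (intro tendsto_intros) auto
  then have "eventually (\<lambda>x. ?h x > 1 / fact r - \<epsilon>) (at_right 0)"
    by (rule order_tendstoD(1)) (use \<epsilon> in simp)
  moreover have "eventually (\<lambda>x :: real. x \<in> {0<..<1 / 2}) (at_right 0)"
    by (rule eventually_at_right_real) simp
  ultimately have "eventually (\<lambda>x. ?h x > 1 / fact r - \<epsilon> \<and> x \<in> {0<..<1 / 2}) (at_right 0)"
    by (rule eventually_conj)
  then obtain x where h: "?h x > 1 / fact r - \<epsilon>" and x: "0 < x" "x \<le> 1 / 2"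
    using eventually_happens by fastforce
  have lim: "filterlim (\<lambda>n. real n powr (1 / real a)) at_top sequentially"
    using a_ge by (intro filterlim_compose[OF real_powr_at_top] filterlim_real_sequentially) auto
  have "eventually (\<lambda>n. \<exists>q. primepow q \<and> exp (- x) * (real n powr (1 / real a)) \<le> real q
      \<and> real q \<le> real n powr (1 / real a)) sequentially"
    using filterlim_iff[THEN iffD1, OF lim] eventually_primepow_between[OF x(1)] by blast
  moreover have "eventually (\<lambda>n. real n powr (1 / real a) \<ge> 32 * 4 ^ r / x ^ 3 / exp (- x)) sequentially"
    using lim by (simp add: filterlim_at_top)
  ultimately show ?thesis using eventually_gt_at_top[of 0]
  proof eventually_elim
    case (elim n)
    define y where "y = real n powr (1 / real a)"
    define m where "m = a * r - (r choose 2)"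
    have y0: "y > 0" using elim by (simp add: y_def)
    obtain q where q: "primepow q" "exp (- x) * y \<le> real q" "real q \<le> y" using elim unfolding y_def by blast
    have ya: "y ^ a = real n" using elim a_ge by (simp add: y_def powr_power)
    have "real q ^ a \<le> real n" using power_mono[OF q(3), of a] ya by simp
    then have "q ^ a \<le> n" by (metis of_nat_le_iff of_nat_power)
    moreover have "32 * 4 ^ r / x ^ 3 \<le> real q"
    proof -
      have "32 * 4 ^ r / x ^ 3 \<le> y * exp (- x)" using elim(2)
        by (simp only: y_def pos_divide_le_eq[OF exp_gt_zero])
      then show ?thesis using q(2) by (simp add: mult.commute)
    qed
    ultimately have low: "(1 - x) ^ (r\<^sup>2 + r) * real q ^ m \<le> fact r * real (turan_nr n)"
      unfolding m_def using q x by (intro gen_turan_ge_primepow) auto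
    \<comment> \<open>Dividing the exponent \<open>a * r - (r choose 2)\<close> of \<open>q\<close>
      by \<open>a\<close> yields the exponent of \<open>n\<close>.\<close>
    have ym: "y ^ m = real n powr gexp r"
    proof -
      have "even (r * (r - 1))" using r3 by simp
      then have "2 * (r choose 2) = r * (r - 1)" by (simp only: choose_two dvd_mult_div_cancel)
      then have "2 * real (r choose 2) = real r * real (r - 1)" by (metis of_nat_mult of_nat_numeral)
      then have "2 * real (r choose 2) = real r * (real r - 1)" using r3 by (simp add: of_nat_diff)
      moreover have "real m = real a * real r - real (r choose 2)"
        unfolding m_def using choose_two_le by (simp add: of_nat_diff)
      ultimately have "real m / real a = gexp r" using a_ge by (simp add: clique_exponent_def field_simps)
      moreover have "y ^ m = real n powr (real m * (1 / real a))"
        unfolding y_def using elim by (intro powr_power) auto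
      ultimately show ?thesis by simp
    qed
    have "exp (- x) ^ (a * r) * y ^ m \<le> exp (- x) ^ m * y ^ m"
      using x y0 by (intro mult_right_mono power_decreasing) (auto simp: m_def)
    also have "\<dots> = (exp (- x) * y) ^ m" by (simp add: power_mult_distrib)
    also have "\<dots> \<le> real q ^ m" using q(2) y0 by (intro power_mono) auto
    finally have "(1 - x) ^ (r\<^sup>2 + r) * (exp (- x) ^ (a * r) * y ^ m) \<le> (1 - x) ^ (r\<^sup>2 + r) * real q ^ m"
      using x by (intro mult_left_mono) auto
    then have "(1 - x) ^ (r\<^sup>2 + r) * (exp (- x) ^ (a * r) * y ^ m) \<le> fact r * real (turan_nr n)" using low
      by linarith
    then have "?h x * y ^ m \<le> real (turan_nr n)" by (simp add: pos_divide_le_eq mult_ac)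
    moreover have "(1 / fact r - \<epsilon>) * y ^ m \<le> ?h x * y ^ m" using h y0 by (intro mult_right_mono) auto
    ultimately show ?case unfolding ym by linarith
  qed
qed

lemma shifted_ratio_tendsto: "(\<lambda>n. (real n / (real n - real t)) powr e) \<longlonglongrightarrow> 1"
proof -
  have "(\<lambda>n. real n / (real n - real t)) \<longlonglongrightarrow> 1" by real_asymp
  then have "(\<lambda>n. (real n / (real n - real t)) powr e) \<longlonglongrightarrow> 1 powr e" by (intro tendsto_intros) auto
  then show ?thesis by simp
qed

text \<open>The excess over \<open>1 / fact r\<close>, cut off at 0, will be the error of the top
  summand; the cut turns an upper bound alone into convergence. Passing from \<open>n\<close> to
  \<open>n - t\<close> costs a ratio that tends to 1.\<close>

lemma upper_error_tendsto:
  defines "c \<equiv> (real b - 1) powr clique_exponent r a"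
  shows "(\<lambda>n. max 0 (real (turan_nr n) / (c * (real n - real t) powr gexp r) - 1 / fact r)) \<longlonglongrightarrow> 0"
proof (rule order_tendstoI)
  fix \<eta> :: real assume "\<eta> < 0"
  then show "eventually (\<lambda>n. \<eta>
      < max 0 (real (turan_nr n) / (c * (real n - real t) powr gexp r) - 1 / fact r)) sequentially"
    by (intro always_eventually allI) (simp add: less_max_iff_disj)
next
  fix \<eta> :: real assume \<eta>: "0 < \<eta>"
  have c0: "c > 0" using b_ge by (simp add: c_def)
  have "(\<lambda>n. (1 / fact r + \<eta> / 2) * (real n / (real n - real t)) powr gexp r) \<longlonglongrightarrow> (1 / fact r + \<eta> / 2) * 1"
    by (intro tendsto_intros shifted_ratio_tendsto)
  then have "eventually (\<lambda>n. (1 / fact r + \<eta> / 2) * (real n / (real n - real t)) powr gexp r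
      < 1 / fact r + \<eta>) sequentially"
    by (rule order_tendstoD(2)) (use \<eta> in simp)
  moreover have "eventually (\<lambda>n. real (turan_nr n)
      \<le> (1 / fact r + \<eta> / 2) * c * real n powr gexp r) sequentially"
    unfolding c_def using \<eta> by (intro gen_turan_upper) auto
  ultimately show "eventually (\<lambda>n. max 0 (real (turan_nr n) / (c * (real n - real t) powr gexp r)
      - 1 / fact r) < \<eta>) sequentially"
    using eventually_gt_at_top[of t]
  proof eventually_elim
    case (elim n)
    have p: "(real n - real t) powr gexp r > 0" using elim by simp
    have "real (turan_nr n) / (c * (real n - real t) powr gexp r)
      \<le> (1 / fact r + \<eta> / 2) * c * real n powr gexp r / (c * (real n - real t) powr gexp r)"
      using elim p c0 by (intro divide_right_mono) auto
    also have "\<dots> = (1 / fact r + \<eta> / 2) * (real n / (real n - real t)) powr gexp r"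
      using c0 elim by (simp add: powr_divide)
    also have "\<dots> < 1 / fact r + \<eta>" by (rule elim)
    finally show ?case using \<eta> by simp
  qed
qed

text \<open>The lower summands \<open>S\<close> are subtracted before normalising; they have smaller
  order and do not disturb the limit.\<close>

lemma lower_error_tendsto:
  defines "S \<equiv> \<lambda>n. \<Sum>s<r. real (t choose (r - s)) * (1 / fact s) * (real n - real t) powr gexp s"
  shows "(\<lambda>n. min 0 ((real (turan_nr n) - S n) / (real n - real t) powr gexp r - 1 / fact r)) \<longlonglongrightarrow> 0"
proof (rule order_tendstoI)
  fix \<eta> :: real assume "0 < \<eta>"
  then show "eventually (\<lambda>n. min 0 ((real (turan_nr n) - S n) / (real n - real t) powr gexp r
      - 1 / fact r) < \<eta>) sequentially"
    by (intro always_eventually allI) (simp add: min_less_iff_disj)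
next
  fix \<eta> :: real assume \<eta>: "\<eta> < 0"
  have lim: "filterlim (\<lambda>n. real n - real t) at_top sequentially" by real_asymp
  have lim0: "(\<lambda>n. (real n - real t) powr (gexp s - gexp r)) \<longlonglongrightarrow> 0" if "s < r" for s
    using growth_exponent_mono[OF that a_ge(1)] by (intro tendsto_neg_powr lim) auto
  let ?L = "\<lambda>n. (1 / fact r + \<eta> / 2) * (real n / (real n - real t)) powr gexp r
      - (\<Sum>s<r. real (t choose (r - s)) * (1 / fact s) * (real n - real t) powr (gexp s - gexp r))"
  have "?L \<longlonglongrightarrow> (1 / fact r + \<eta> / 2) * 1 - (\<Sum>s<r. real (t choose (r - s)) * (1 / fact s) * 0)"
    by (intro tendsto_diff tendsto_mult tendsto_sum tendsto_const shifted_ratio_tendsto lim0) auto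
  then have "eventually (\<lambda>n. ?L n > 1 / fact r + \<eta>) sequentially"
    by (rule order_tendstoD(1)) (use \<eta> in simp)
  moreover have "eventually (\<lambda>n. real (turan_nr n) \<ge> (1 / fact r - (- \<eta> / 2))
      * real n powr gexp r) sequentially"
    using \<eta> by (intro gen_turan_lower) auto
  ultimately show "eventually (\<lambda>n. \<eta>
      < min 0 ((real (turan_nr n) - S n) / (real n - real t) powr gexp r - 1 / fact r)) sequentially"
    using eventually_gt_at_top[of t]
  proof eventually_elim
    case (elim n)
    have p: "(real n - real t) powr gexp r > 0" using elim by simp
    have d: "(real n - real t) powr (gexp s - gexp r)
        = (real n - real t) powr gexp s / (real n - real t) powr gexp r" for s
      by (rule powr_diff)
    have d': "(real n / (real n - real t)) powr gexp r = real n powr gexp r / (real n - real t) powr gexp r"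
      by (rule powr_divide)
    have "?L n = ((1 / fact r + \<eta> / 2) * real n powr gexp r - S n) / (real n - real t) powr gexp r"
      by (simp only: S_def d d' diff_divide_distrib sum_divide_distrib times_divide_eq_right)
    also have "\<dots> \<le> (real (turan_nr n) - S n) / (real n - real t) powr gexp r"
      using elim p by (intro divide_right_mono) auto
    finally show ?case using elim \<eta> by simp
  qed
qed

end

theorem theorem1p1:
  fixes t r a b :: nat
  assumes "t \<ge> r" and "r \<ge> 3" and "a \<ge> 2 * (r - 1)" and "b \<ge> fact (a - 1) + 1"
  shows
    "(\<exists>\<epsilon> :: nat \<Rightarrow> nat \<Rightarrow> real.
        (\<forall>s\<le>r. \<epsilon> s \<longlonglongrightarrow> 0) \<and>
        (\<forall>\<^sub>F n in sequentially.
           real (gen_turan n (complete_graph r) (disjoint_copies (t + 1) (complete_bipartite a b)))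
           \<le> (\<Sum>s=0..r. real (t choose (r - s)) * (1 / fact s + \<epsilon> s n)
                 * (real b - 1) powr (real s * (real s - 1) / (2 * real a))
                 * (real n - real t) powr (real s - real s * (real s - 1) / (2 * real a)))))
     \<and>
     (\<exists>\<epsilon> :: nat \<Rightarrow> nat \<Rightarrow> real.
        (\<forall>s\<le>r. \<epsilon> s \<longlonglongrightarrow> 0) \<and>
        (\<forall>\<^sub>F n in sequentially.
           real (gen_turan n (complete_graph r) (disjoint_copies (t + 1) (complete_bipartite a b)))
           \<ge> (\<Sum>s=0..r. real (t choose (r - s)) * (1 / fact s + \<epsilon> s n)
                 * (real n - real t) powr (real s - real s * (real s - 1) / (2 * real a)))))"
proof (intro conjI)
  let ?T = "\<lambda>n. real (gen_turan n (complete_graph r) (disjoint_copies (t + 1) (complete_bipartite a b)))"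
  let ?e = "\<lambda>s. real s - real s * (real s - 1) / (2 * real a)"
  define c where "c s = (real b - 1) powr (real s * (real s - 1) / (2 * real a))" for s :: nat
  have c0: "c s > 0" for s using b_ge[OF assms] by (simp add: c_def)
  have split: "(\<Sum>s=0..r. f s) = (\<Sum>s<r. f s) + f r" for f :: "nat \<Rightarrow> real"
    by (simp add: atLeast0AtMost lessThan_Suc_atMost[symmetric])
  show "\<exists>\<epsilon> :: nat \<Rightarrow> nat \<Rightarrow> real. (\<forall>s\<le>r. \<epsilon> s \<longlonglongrightarrow> 0) \<and>
    (\<forall>\<^sub>F n in sequentially. ?T n \<le> (\<Sum>s=0..r. real (t choose (r - s)) * (1 / fact s + \<epsilon> s n)
       * (real b - 1) powr (real s * (real s - 1) / (2 * real a)) * (real n - real t) powr ?e s))"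
  proof -
    \<comment> \<open>The whole discrepancy is charged to \<open>s = r\<close>; the other summands
      are nonnegative and only help.\<close>
    define \<epsilon> where "\<epsilon> s n = (if s
        = r then max 0 (?T n / (c r * (real n - real t) powr ?e r) - 1 / fact r) else 0)" for s n
    have "\<epsilon> s \<longlonglongrightarrow> 0" for s
      using upper_error_tendsto[OF assms] unfolding clique_exponent_def
      by (cases "s = r") (simp_all add: \<epsilon>_def[abs_def] c_def)
    moreover have "\<forall>\<^sub>F n in sequentially. ?T n \<le> (\<Sum>s=0..r. real (t choose (r - s)) * (1 / fact s + \<epsilon> s n)
       * c s * (real n - real t) powr ?e s)"
      using eventually_gt_at_top[of t]
    proof eventually_elim
      case (elim n)
      have p: "c r * (real n - real t) powr ?e r > 0" using elim c0 by simp
      have "?T n / (c r * (real n - real t) powr ?e r) \<le> 1 / fact r + \<epsilon> r n" by (simp add: \<epsilon>_def)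
      then have "?T n \<le> (1 / fact r + \<epsilon> r n) * (c r * (real n - real t) powr ?e r)"
        using p by (simp only: pos_divide_le_eq)
      moreover have "0 \<le> (\<Sum>s<r. real (t choose (r - s)) * (1 / fact s + \<epsilon> s n) * c s
          * (real n - real t) powr ?e s)"
        using c0 by (intro sum_nonneg mult_nonneg_nonneg) (auto simp: \<epsilon>_def less_imp_le)
      ultimately show ?case unfolding split by (simp add: mult.assoc)
    qed
    ultimately show ?thesis unfolding c_def by blast
  qed
  show "\<exists>\<epsilon> :: nat \<Rightarrow> nat \<Rightarrow> real. (\<forall>s\<le>r. \<epsilon> s \<longlonglongrightarrow> 0) \<and>
    (\<forall>\<^sub>F n in sequentially. ?T n \<ge> (\<Sum>s=0..r. real (t choose (r - s)) * (1 / fact s + \<epsilon> s n)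
       * (real n - real t) powr ?e s))"
  proof -
    define S where "S n = (\<Sum>s<r. real (t choose (r - s)) * (1 / fact s) * (real n - real t) powr ?e s)"
      for n
    \<comment> \<open>In this direction the other summands count against the bound, so the error at
      \<open>s = r\<close> has to make up for them.\<close>
    define \<epsilon> where "\<epsilon> s n = (if s
        = r then min 0 ((?T n - S n) / (real n - real t) powr ?e r - 1 / fact r) else 0)" for s n
    have "\<epsilon> s \<longlonglongrightarrow> 0" for s
      using lower_error_tendsto[OF assms] unfolding clique_exponent_def
      by (cases "s = r") (simp_all add: \<epsilon>_def[abs_def] S_def)
    moreover have "\<forall>\<^sub>F n in sequentially. ?T n \<ge> (\<Sum>s=0..r. real (t choose (r - s)) * (1 / fact s + \<epsilon> s n)
       * (real n - real t) powr ?e s)"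
      using eventually_gt_at_top[of t]
    proof eventually_elim
      case (elim n)
      have p: "(real n - real t) powr ?e r > 0" using elim by simp
      have "1 / fact r + \<epsilon> r n \<le> (?T n - S n) / (real n - real t) powr ?e r" by (simp add: \<epsilon>_def)
      then have "(1 / fact r + \<epsilon> r n) * (real n - real t) powr ?e r \<le> ?T n - S n"
        using p by (simp only: pos_le_divide_eq)
      moreover have "(\<Sum>s<r. real (t choose (r - s)) * (1 / fact s + \<epsilon> s n) * (real n - real t) powr ?e s)
          = S n"
        unfolding S_def by (intro sum.cong) (auto simp: \<epsilon>_def)
      ultimately show ?case unfolding split by simp
    qed
    ultimately show ?thesis by blast
  qed
qed

end
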